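(* Let $L\in\mathbb{N}$ and let $D_1,\dots,D_L$ be closed discs of radius $1/L$ contained in the closed unit disc of $\mathbb{C}$, whose centers do not all lie on one line. Let $\mathcal{G}_n$ ($n\ge 1$) be the union of the images of the closed unit disc under all $n$-fold compositions of the maps $T_j(z)=z/L+c_j$, where $c_j$ is the center of $D_j$, $j=1,\dots,L$. Then there exist constants $C<\infty$ and $\epsilon_0>0$ (not depending on $n$) such that for all $n\in\mathbb{N}$, $n\geq 1$, $$\operatorname{Fav}(\mathcal{G}_n)\le C\,e^{-\epsilon_0\sqrt{\log n}}.$$
   Context: For $E\subset\mathbb{C}$, the Favard length is $\operatorname{Fav}(E)=\frac1\pi\int_0^\pi|\mathrm{proj}_\theta(E)|\,d\theta$, where $\mathrm{proj}_\theta$ is the orthogonal projection onto the line through the origin making angle $\theta$ with the real axis and $|\cdot|$ is one-dimensional Lebesgue measure. *)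

theory Defs
  imports "HOL-Analysis.Analysis"
begin

text \<open>Orthogonal projection onto the line through the origin with direction \<open>cis \<theta>\<close>;
  the value is the projected point of the plane, not its coordinate.\<close>

definition proj_line :: "real \<Rightarrow> complex \<Rightarrow> complex" where
  "proj_line \<theta> z = (z \<bullet> cis \<theta>) *\<^sub>R cis \<theta>"

text \<open>One-dimensional Lebesgue measure on that line, transported from the real axis by the
  isometry that sends \<open>t\<close> to \<open>t *\<^sub>R cis \<theta>\<close>.\<close>

definition line_measure :: "real \<Rightarrow> complex set \<Rightarrow> ennreal" where
  "line_measure \<theta> A = emeasure lebesgue {t. t *\<^sub>R cis \<theta> \<in> A}"

text \<open>Extended-valued, because the projections of an unbounded set may have infinite length.\<close>

definition Fav :: "complex set \<Rightarrow> ennreal" where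
  "Fav E = ennreal (1 / pi) *
     (\<integral>\<^sup>+ \<theta>\<in>{0..pi}. line_measure \<theta> (proj_line \<theta> ` E) \<partial>lebesgue)"

definition disc_map :: "nat \<Rightarrow> (nat \<Rightarrow> complex) \<Rightarrow> nat \<Rightarrow> complex \<Rightarrow> complex" where
  "disc_map L c j z = z / of_nat L + c j"

text \<open>An \<open>n\<close>-fold composition of the maps is encoded by a word of length \<open>n\<close> over the
  indices; letters may repeat.\<close>

definition word_map :: "nat \<Rightarrow> (nat \<Rightarrow> complex) \<Rightarrow> nat list \<Rightarrow> complex \<Rightarrow> complex" where
  "word_map L c w = foldr (\<circ>) (map (disc_map L c) w) id"

definition cantor_stage :: "nat \<Rightarrow> (nat \<Rightarrow> complex) \<Rightarrow> nat \<Rightarrow> complex set" where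
  "cantor_stage L c n =
     (\<Union>w \<in> {w. length w = n \<and> set w \<subseteq> {1..L}}. word_map L c w ` cball 0 1)"

end

theory Submission imports Defs begin

text \<open>Fix a direction and let \<open>x w\<close> be the projected centre of the disc with word \<open>w\<close>. Either at some
  generation up to \<open>N\<close> many discs overlap over a sizeable proportion of the words, and then
  self-similarity makes the projection of generation \<open>N M\<close> shorter than \<open>18 / K\<close>; or the number of
  close pairs at every generation up to \<open>N\<close> is at most \<open>2 K L^n\<close>, which bounds mean squares of the
  normalised exponential sums \<open>Phi n = (\<Prod>i=1..n. phi (L^i y))\<close>. In the second case \<open>|Phi N|^2\<close> is
  integrated over \<open>J\<close> disjoint \<open>L\<close>-adic ranges of length ratio \<open>L^m\<close>. On each of them the factors of
  \<open>Phi N\<close> split into the coarse scales \<open>Phi s\<close>, whose mean square is bounded below by its diagonal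
  terms, the next \<open>m\<close> factors, which are smaller than \<open>\<delta>^m\<close> only near \<open>O(m L^m)\<close> points, and a
  harmless tail. Near these points \<open>Phi s\<close> carries little mass, because for all directions outside a
  set of measure \<open>O(L^-m)\<close> its factors with \<open>i \<le> 4 m\<close> have a uniformly small product. So \<open>J\<close> is at most
  about \<open>K \<delta>^(-2 m)\<close>. With \<open>K = b^m\<close> and \<open>\<delta> = exp (- O(m))\<close> this gives a bound of order
  \<open>exp (- c m)\<close> for the Favard length at a generation of order \<open>exp (O(m^2))\<close>.\<close>

section \<open>Exponential sums\<close>

text \<open>The obstacle is that \<open>phi\<close> may have zeros, whose position varies with the
  direction, so its factors admit no fixed lower bound. Turan's inequality locates the small values
  only at a price: to confine them to intervals of radius \<open>L^-5m\<close> inside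
  \<open>[0, L^m]\<close>, the threshold \<open>\<delta>\<close> has to be of order
  \<open>L^(-11 L m)\<close>. Then \<open>m\<close> factors cost
  \<open>\<delta>^m = exp (- O(m^2))\<close>, so the number of ranges is exponential in
  \<open>m^2\<close>; this is the source of the square root of the logarithm. The radius
  \<open>L^-5m\<close> is chosen because magnification by \<open>L^j\<close> with
  \<open>j < m\<close> must leave intervals of radius at most \<open>L^-4m\<close>, on which the
  mean square of the coarse factors beyond the first \<open>4 m\<close> is still controlled. The
  number \<open>4 m\<close> makes the exceptional directions rare: a pair of integers fixes a
  direction up to \<open>O(L^-4m)\<close>, and only \<open>O(L^3m)\<close> pairs occur. These
  integers come from two differences of centres. Two independent ones are used because the frequency
  \<open>y\<close> is unknown and is eliminated between them; here noncollinearity enters.\<close>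

definition expsum :: "'i set \<Rightarrow> ('i \<Rightarrow> complex) \<Rightarrow> ('i \<Rightarrow> real) \<Rightarrow> real \<Rightarrow> complex" where
  "expsum A b \<mu> t = (\<Sum>j\<in>A. b j * cis (\<mu> j * t))"

text \<open>The difference operator \<open>p(t + h) - cis (\<mu> a * h) * p(t)\<close> kills one
  frequency. Induction bounds the difference, and summing it back over \<open>M\<close> steps costs
  a factor \<open>2 * M + 1\<close> per frequency. The growth is polynomial in \<open>M\<close> and
  independent of the frequencies, so smallness can be carried over long distances.\<close>

lemma expsum_turan:
  fixes t0 h B :: real
  assumes "finite A" and "B \<ge> 0"
    and "\<And>k::nat. k < card A \<Longrightarrow> norm (expsum A b \<mu> (t0 + real k * h)) \<le> B"
  shows "norm (expsum A b \<mu> (t0 + real M * h)) \<le> (2 * real M + 1) ^ card A * B"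
  using assms
proof (induction A arbitrary: b B M rule: finite_induct)
  case empty
  then show ?case by (simp add: expsum_def)
next
  case (insert a A)
  let ?p = "expsum (insert a A) b \<mu>"
  define b' where "b' j = b j * (cis (\<mu> j * h) - cis (\<mu> a * h))" for j
  have q: "?p (t + h) - cis (\<mu> a * h) * ?p t = expsum A b' \<mu> t" for t
    using insert.hyps
    by (simp add: expsum_def b'_def sum_distrib_left sum.distrib sum_subtractf
        algebra_simps flip: cis_mult)
  have B0: "norm (expsum A b' \<mu> (t0 + real k * h)) \<le> 2 * B" if "k < card A" for k
  proof -
    have "norm (?p (t0 + real (Suc k) * h)) \<le> B" "norm (?p (t0 + real k * h)) \<le> B"
      using insert.prems(2)[of "Suc k"] insert.prems(2)[of k] that insert.hyps by auto
    then have "norm (?p (t0 + real k * h + h) - cis (\<mu> a * h) * ?p (t0 + real k * h)) \<le> B + B"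
      by (intro order_trans[OF norm_triangle_ineq4] add_mono)
        (simp_all add: norm_mult algebra_simps)
    then show ?thesis by (simp only: q) 
  qed
  have IH: "norm (expsum A b' \<mu> (t0 + real k * h)) \<le> (2 * real k + 1) ^ card A * (2 * B)" for k
    using insert.IH[of "2 * B" b'] B0 insert.prems(1) by simp
  have "norm (?p (t0 + real n * h)) \<le> B + real n * ((2 * real M + 1) ^ card A * (2 * B))"
    if "n \<le> M" for n
    using that
  proof (induction n)
    case 0
    then show ?case using insert.prems(2)[of 0] insert.hyps by simp
  next
    case (Suc n)
    have "?p (t0 + real (Suc n) * h) =
      cis (\<mu> a * h) * ?p (t0 + real n * h) + expsum A b' \<mu> (t0 + real n * h)"
      using q[of "t0 + real n * h"] by (simp add: algebra_simps)
    then have "norm (?p (t0 + real (Suc n) * h)) \<le>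
      norm (?p (t0 + real n * h)) + norm (expsum A b' \<mu> (t0 + real n * h))"
      by (metis norm_triangle_ineq norm_mult norm_cis mult_1)
    also have "norm (expsum A b' \<mu> (t0 + real n * h)) \<le> (2 * real M + 1) ^ card A * (2 * B)"
      using Suc.prems insert.prems(1)
      by (intro order_trans[OF IH] mult_right_mono power_mono) auto
    finally show ?case using Suc by (simp add: algebra_simps)
  qed
  from this[of M] have "norm (?p (t0 + real M * h)) \<le> B + real M * ((2 * real M + 1) ^ card A * (2 * B))"
    by simp
  also have "\<dots> \<le> (2 * real M + 1) ^ card A * B + real M * ((2 * real M + 1) ^ card A * (2 * B))"
    using insert.prems(1) by (simp add: mult_le_cancel_right1)
  also have "\<dots> = (2 * real M + 1) ^ card (insert a A) * B"
    using insert.hyps by (simp add: algebra_simps)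
  finally show ?case .
qed

lemma expsum_has_derivative:
  "((\<lambda>t. Re (expsum A b \<mu> t)) has_real_derivative
     Re (expsum A (\<lambda>j. \<i> * complex_of_real (\<mu> j) * b j) \<mu> t)) (at t)"
  unfolding expsum_def Re_sum
  by (rule DERIV_sum) (auto intro!: derivative_eq_intros simp: algebra_simps)

text \<open>Only every second mean value point is kept, so that the new points are again \<open>\<rho>\<close>-separated.\<close>

lemma separated_mean_value:
  fixes g g' :: "real \<Rightarrow> real" and p :: "nat \<Rightarrow> real"
  assumes der: "\<And>t. t \<in> {x..y} \<Longrightarrow> (g has_real_derivative g' t) (at t)"
    and p: "\<And>i. i < 2 * n \<Longrightarrow> p i \<in> {x..y}" "\<And>i. Suc i < 2 * n \<Longrightarrow> p i + \<rho> \<le> p (Suc i)"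
    and \<rho>: "\<rho> > 0" and small: "\<And>i. i < 2 * n \<Longrightarrow> \<bar>g (p i)\<bar> \<le> \<epsilon>"
  shows "\<exists>\<xi>. (\<forall>i<n. \<xi> i \<in> {x..y} \<and> \<bar>g' (\<xi> i)\<bar> \<le> 2 * \<epsilon> / \<rho>) \<and>
             (\<forall>i. Suc i < n \<longrightarrow> \<xi> i + \<rho> \<le> \<xi> (Suc i))"
proof -
  have "\<exists>z. p (2*i) < z \<and> z < p (Suc (2*i)) \<and> \<bar>g' z\<bar> \<le> 2 * \<epsilon> / \<rho>" if i: "i < n" for i
  proof -
    have l: "p (2*i) + \<rho> \<le> p (Suc (2*i))" "p (2*i) \<in> {x..y}" "p (Suc (2*i)) \<in> {x..y}"
      using p i by auto
    obtain z where z: "p (2*i) < z" "z < p (Suc (2*i))"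
      "g (p (Suc (2*i))) - g (p (2*i)) = (p (Suc (2*i)) - p (2*i)) * g' z"
      using MVT2[of "p (2*i)" "p (Suc (2*i))" g g'] l \<rho> der by force
    have "\<rho> * \<bar>g' z\<bar> \<le> (p (Suc (2*i)) - p (2*i)) * \<bar>g' z\<bar>"
      using l by (intro mult_right_mono) auto
    also have "\<dots> = \<bar>g (p (Suc (2*i))) - g (p (2*i))\<bar>" using z l \<rho> by (simp add: abs_mult)
    also have "\<dots> \<le> 2 * \<epsilon>" using small[of "2*i"] small[of "Suc (2*i)"] i by linarith
    finally have "\<bar>g' z\<bar> \<le> 2 * \<epsilon> / \<rho>" using \<rho> by (simp add: field_simps)
    with z show ?thesis by blast
  qed
  then obtain \<xi> where \<xi>: "\<And>i. i < n \<Longrightarrow> p (2*i) < \<xi> i \<and> \<xi> i < p (Suc (2*i)) \<and> \<bar>g' (\<xi> i)\<bar> \<le> 2 * \<epsilon> / \<rho>"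
    by metis
  have "\<xi> i \<in> {x..y}" if "i < n" for i
    using \<xi>[OF that] p(1)[of "2*i"] p(1)[of "Suc (2*i)"] that by auto
  moreover have "\<xi> i + \<rho> \<le> \<xi> (Suc i)" if "Suc i < n" for i
    using \<xi>[of i] \<xi>[of "Suc i"] p(2)[of "Suc (2*i)"] that by auto
  ultimately show ?thesis using \<xi> by blast
qed

lemma abs_diff_le_of_deriv:
  fixes g g' :: "real \<Rightarrow> real"
  assumes der: "\<And>t. t \<in> {x..x+1} \<Longrightarrow> (g has_real_derivative g' t) (at t)"
    and bnd: "\<And>t. t \<in> {x..x+1} \<Longrightarrow> \<bar>g' t\<bar> \<le> B"
    and st: "s \<in> {x..x+1}" "t \<in> {x..x+1}"
  shows "\<bar>g t\<bar> \<le> \<bar>g s\<bar> + B"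
proof -
  have "norm (g t - g s) \<le> B * norm (t - s)"
    by (rule field_differentiable_bound[of "{x..x+1}" g g'])
       (use assms in \<open>auto intro: has_field_derivative_at_within\<close>)
  also have "\<dots> \<le> B * 1"
    using st bnd[OF st(1)] by (intro mult_left_mono) auto
  finally show ?thesis by simp
qed

lemma cos_ge_quadratic: "1 - x\<^sup>2 / 2 \<le> cos (x::real)"
proof -
  have "(sin (x/2))\<^sup>2 \<le> (x/2)\<^sup>2"
    by (metis abs_le_square_iff abs_sin_x_le_abs_x)
  moreover have "cos x = 1 - 2 * (sin (x/2))\<^sup>2"
    using cos_double_sin[of "x/2"] by simp
  ultimately show ?thesis by (simp add: power2_eq_square)
qed

lemma cos_ge_of_le_half:
  fixes x :: real
  assumes "\<bar>x\<bar> \<le> 1/2"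
  shows "3/4 \<le> cos x"
proof -
  from assms have "x^2 \<le> (1/2)^2" by (metis abs_ge_zero power2_abs power_mono)
  with cos_ge_quadratic[of x] show ?thesis by (simp add: power2_eq_square)
qed

text \<open>Induction on the number of frequencies: \<open>u'' + l^2 * u\<close> removes the
  frequency \<open>l\<close> from the real part \<open>u\<close>. The operator is factored into two
  first derivatives, each of which costs half of the points and a factor \<open>\<rho>\<close> in
  the mean value theorem; hence \<open>4^n\<close> points and \<open>\<rho> ^ (2 * n)\<close>.
  Smallness returns from the reduced sum by two integrations over the unit interval.\<close>

lemma Re_expsum_small:
  "\<exists>C\<ge>0. \<forall>(A::'i set) \<mu> b p x \<rho> \<delta>. finite A \<longrightarrow> card A = n \<longrightarrow> (\<forall>j\<in>A. \<bar>\<mu> j\<bar> \<le> 1) \<longrightarrow>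
     0 < \<rho> \<longrightarrow> \<rho> \<le> 1 \<longrightarrow> 0 \<le> \<delta> \<longrightarrow>
     (\<forall>i<4^n. p i \<in> {x..x+1} \<and> \<bar>Re (expsum A b \<mu> (p i))\<bar> \<le> \<delta>) \<longrightarrow>
     (\<forall>i. Suc i < 4^n \<longrightarrow> p i + \<rho> \<le> p (Suc i)) \<longrightarrow>
     (\<forall>t\<in>{x..x+1}. \<bar>Re (expsum A b \<mu> t)\<bar> \<le> C * \<delta> / \<rho> ^ (2 * n))"
proof (induction n)
  case 0
  then show ?case by (intro exI[of _ 0]) (simp add: expsum_def card_eq_0_iff)
next
  case (Suc n)
  obtain C where C0: "C \<ge> 0" and IH0: "\<forall>(A::'i set) \<mu> b p x \<rho> \<delta>. finite A \<longrightarrow> card A = n \<longrightarrow> (\<forall>j\<in>A. \<bar>\<mu> j\<bar> \<le> 1) \<longrightarrow>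
     0 < \<rho> \<longrightarrow> \<rho> \<le> 1 \<longrightarrow> 0 \<le> \<delta> \<longrightarrow>
     (\<forall>i<4^n. p i \<in> {x..x+1} \<and> \<bar>Re (expsum A b \<mu> (p i))\<bar> \<le> \<delta>) \<longrightarrow>
     (\<forall>i. Suc i < 4^n \<longrightarrow> p i + \<rho> \<le> p (Suc i)) \<longrightarrow>
     (\<forall>t\<in>{x..x+1}. \<bar>Re (expsum A b \<mu> t)\<bar> \<le> C * \<delta> / \<rho> ^ (2 * n))"
    using Suc.IH by (elim exE conjE) (rule that)
  show ?case
  proof (rule exI[of _ "18 + 64 * C"], intro conjI allI impI ballI)
    show "0 \<le> 18 + 64 * C" using C0 by simp
    fix A :: "'i set" and \<mu> b p x \<rho> \<delta> t
    assume A: "finite A" "card A = Suc n" and \<mu>: "\<forall>j\<in>A. \<bar>\<mu> j\<bar> \<le> 1"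
      and \<rho>: "0 < \<rho>" "\<rho> \<le> (1::real)" and \<delta>: "0 \<le> (\<delta>::real)"
      and p1: "\<forall>i<4^Suc n. p i \<in> {x..x+1} \<and> \<bar>Re (expsum A b \<mu> (p i))\<bar> \<le> \<delta>"
      and p2: "\<forall>i. Suc i < 4^Suc n \<longrightarrow> p i + \<rho> \<le> p (Suc i)"
      and t: "t \<in> {x..x+1}"
    from A obtain a A' where A': "A = insert a A'" "a \<notin> A'" "card A' = n" "finite A'"
      by (metis card_Suc_eq finite_insert)
    let ?l = "\<mu> a"
    have l: "\<bar>?l\<bar> \<le> 1" using \<mu> A' by auto
    \<comment> \<open>\<open>k\<close> solves \<open>k'' + l^2 * k = 0\<close>. Centred at the
      midpoint and with \<open>\<bar>l\<bar> \<le> 1\<close>, its argument stays within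
      \<open>1/2\<close>, so \<open>k \<ge> 3/4\<close> and division by it is harmless.\<close>
    define k where "k s = cos (?l * (s - (x + 1/2)))" for s
    define u where "u s = Re (expsum A b \<mu> s)" for s
    define b1 where "b1 j = \<i> * complex_of_real (\<mu> j) * b j" for j
    define u1 where "u1 s = Re (expsum A b1 \<mu> s)" for s
    define b2 where "b2 j = \<i> * complex_of_real (\<mu> j) * b1 j" for j
    define u2 where "u2 s = Re (expsum A b2 \<mu> s)" for s
    define k1 where "k1 s = - ?l * sin (?l * (s - (x + 1/2)))" for s
    have kge: "3/4 \<le> k s" if "s \<in> {x..x+1}" for s
    proof -
      have "\<bar>s - (x + 1/2)\<bar> \<le> 1/2"
        using that by (auto simp: abs_if)
      then have "\<bar>?l\<bar> * \<bar>s - (x + 1/2)\<bar> \<le> 1 * (1/2)"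
        using l by (intro mult_mono) auto
      then show ?thesis unfolding k_def by (intro cos_ge_of_le_half) (simp add: abs_mult)
    qed
    have kle: "k s \<le> 1" "\<bar>k s\<bar> \<le> 1" for s by (simp_all add: k_def)
    have du: "(u has_real_derivative u1 s) (at s)" for s
      using expsum_has_derivative[of A b \<mu> s] by (simp add: u_def[abs_def] u1_def b1_def[abs_def])
    have du1: "(u1 has_real_derivative u2 s) (at s)" for s
      using expsum_has_derivative[of A b1 \<mu> s] by (simp add: u1_def[abs_def] u2_def b2_def[abs_def])
    have dk: "(k has_real_derivative k1 s) (at s)" for s
      unfolding k_def[abs_def] k1_def by (auto intro!: derivative_eq_intros)
    have dk1: "(k1 has_real_derivative - ?l\<^sup>2 * k s) (at s)" for s
      unfolding k_def[abs_def] k1_def[abs_def]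
      by (auto intro!: derivative_eq_intros simp: power2_eq_square)
    \<comment> \<open>With \<open>u = k * g\<close>, the Wronskian \<open>h\<close> satisfies
      \<open>g' = h / k^2\<close> and \<open>h' = k * F\<close>: the second order operator
      \<open>F\<close> is reached by two successive first derivatives.\<close>
    define g where "g s = u s / k s" for s
    define h where "h s = u1 s * k s - u s * k1 s" for s
    define F where "F s = u2 s + ?l\<^sup>2 * u s" for s
    \<comment> \<open>The coefficient vanishes at \<open>a\<close>, so \<open>F\<close> is a sum
      over \<open>A'\<close> only.\<close>
    define bF where "bF j = complex_of_real (?l\<^sup>2 - (\<mu> j)\<^sup>2) * b j" for j
    have F: "F s = Re (expsum A' bF \<mu> s)" for s
    proof -
      have "Re (expsum A' bF \<mu> s) = Re (expsum A bF \<mu> s)"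
        using A' by (simp add: expsum_def bF_def)
      also have "expsum A bF \<mu> s = expsum A b2 \<mu> s + complex_of_real (?l\<^sup>2) * expsum A b \<mu> s"
        unfolding expsum_def sum_distrib_left
        by (simp add: bF_def b2_def b1_def power2_eq_square algebra_simps flip: sum.distrib)
      finally show ?thesis by (simp add: F_def u2_def u_def)
    qed
    have dg: "(g has_real_derivative h s / (k s)\<^sup>2) (at s)" if "s \<in> {x..x+1}" for s
      using kge[OF that] unfolding g_def[abs_def] h_def
      by (auto intro!: derivative_eq_intros du dk simp: power2_eq_square)
    have dh: "(h has_real_derivative k s * F s) (at s)" for s
      unfolding h_def[abs_def] F_def
      by (auto intro!: derivative_eq_intros du dk du1 dk1 simp: algebra_simps)
    have sq: "1/2 \<le> (k s)\<^sup>2" "(k s)\<^sup>2 \<le> 1" if "s \<in> {x..x+1}" for s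
      using power_mono[OF kge[OF that], of 2] kge[OF that] kle(1)[of s]
      by (auto simp: power2_eq_square mult_le_one)
    have g_small: "\<bar>g (p i)\<bar> \<le> 2 * \<delta>" if "i < 2 * (2 * 4 ^ n)" for i
    proof -
      have "\<bar>u (p i)\<bar> \<le> \<delta>" "p i \<in> {x..x+1}" using p1 that by (auto simp: u_def)
      then have "\<bar>g (p i)\<bar> \<le> \<delta> / (3/4)"
        unfolding g_def abs_divide using kge[of "p i"] \<delta> by (intro frac_le) auto
      then show ?thesis using \<delta> by simp
    qed
    obtain \<xi> where \<xi>: "\<And>i. i < 2 * 4^n \<Longrightarrow> \<xi> i \<in> {x..x+1} \<and> \<bar>h (\<xi> i) / (k (\<xi> i))\<^sup>2\<bar> \<le> 2 * (2 * \<delta>) / \<rho>"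
      "\<And>i. Suc i < 2 * 4^n \<Longrightarrow> \<xi> i + \<rho> \<le> \<xi> (Suc i)"
      using separated_mean_value[of x "x+1" g "\<lambda>s. h s / (k s)\<^sup>2" "2*4^n" p \<rho> "2*\<delta>"]
        dg p1 p2 \<rho> g_small by auto
    have h_small: "\<bar>h (\<xi> i)\<bar> \<le> 4 * \<delta> / \<rho>" if "i < 2 * 4^n" for i
    proof -
      have "\<bar>h (\<xi> i)\<bar> = \<bar>h (\<xi> i) / (k (\<xi> i))\<^sup>2\<bar> * (k (\<xi> i))\<^sup>2"
        using kge[of "\<xi> i"] \<xi>(1)[OF that] by (simp add: abs_mult)
      also have "\<dots> \<le> (2 * (2 * \<delta>) / \<rho>) * 1"
        using \<xi>(1)[OF that] sq[of "\<xi> i"] \<rho> \<delta> by (intro mult_mono) auto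
      finally show ?thesis by simp
    qed
    obtain \<zeta> where \<zeta>: "\<And>i. i < 4^n \<Longrightarrow> \<zeta> i \<in> {x..x+1} \<and> \<bar>k (\<zeta> i) * F (\<zeta> i)\<bar> \<le> 2 * (4 * \<delta> / \<rho>) / \<rho>"
      "\<And>i. Suc i < 4^n \<Longrightarrow> \<zeta> i + \<rho> \<le> \<zeta> (Suc i)"
      using separated_mean_value[of x "x+1" h "\<lambda>s. k s * F s" "4^n" \<xi> \<rho> "4 * \<delta> / \<rho>"]
        dh \<xi> \<rho> h_small by auto
    have F_small: "\<bar>F (\<zeta> i)\<bar> \<le> 16 * \<delta> / \<rho>\<^sup>2" if "i < 4^n" for i
    proof -
      have "3/4 * \<bar>F (\<zeta> i)\<bar> \<le> k (\<zeta> i) * \<bar>F (\<zeta> i)\<bar>"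
        using kge[of "\<zeta> i"] \<zeta>(1)[OF that] by (intro mult_right_mono) auto
      also have "\<dots> \<le> 8 * \<delta> / \<rho>\<^sup>2"
        using \<zeta>(1)[OF that] kge[of "\<zeta> i"] by (simp add: abs_mult power2_eq_square)
      finally have "\<bar>F (\<zeta> i)\<bar> \<le> 4/3 * (8 * \<delta> / \<rho>\<^sup>2)" by simp
      also have "\<dots> \<le> 16 * \<delta> / \<rho>\<^sup>2" using \<delta> \<rho> by (simp add: field_simps)
      finally show ?thesis .
    qed
    define \<Phi> where "\<Phi> = C * (16 * \<delta> / \<rho>\<^sup>2) / \<rho> ^ (2 * n)"
    have F_all: "\<bar>F s\<bar> \<le> \<Phi>" if "s \<in> {x..x+1}" for s
      unfolding F \<Phi>_def
      by (rule IH0[rule_format, where p = \<zeta>])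
        (use A' \<mu> \<rho> \<delta> \<zeta> F_small that in \<open>simp_all add: F\<close>)
    have pos: "(0::nat) < 4^n" by simp
    have "\<bar>h s\<bar> \<le> 4 * \<delta> / \<rho> + \<Phi>" if s: "s \<in> {x..x+1}" for s
    proof -
      have "\<bar>h s\<bar> \<le> \<bar>h (\<xi> 0)\<bar> + \<Phi>"
      proof (rule abs_diff_le_of_deriv[OF dh _ _ s])
        show "\<xi> 0 \<in> {x..x+1}" using \<xi>(1)[of 0] by simp
        fix r assume r: "r \<in> {x..x+1}"
        have "\<bar>k r\<bar> * \<bar>F r\<bar> \<le> 1 * \<Phi>" using kle F_all[OF r] by (intro mult_mono) auto
        then show "\<bar>k r * F r\<bar> \<le> \<Phi>" by (simp add: abs_mult)
      qed
      with h_small[of 0] show ?thesis by simp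
    qed
    note h_le = this
    have g': "\<bar>h s / (k s)\<^sup>2\<bar> \<le> (4 * \<delta> / \<rho> + \<Phi>) / (1/2)" if s: "s \<in> {x..x+1}" for s
    proof -
      have "0 \<le> 4 * \<delta> / \<rho> + \<Phi>" using h_le[OF s] abs_ge_zero[of "h s"] by linarith
      with h_le[OF s] sq[OF s] show ?thesis unfolding abs_divide by (intro frac_le) auto
    qed
    have "\<bar>g t\<bar> \<le> \<bar>g (p 0)\<bar> + (4 * \<delta> / \<rho> + \<Phi>) / (1/2)"
      by (rule abs_diff_le_of_deriv[OF dg g' _ t]) (use p1 in auto)
    also have "\<dots> \<le> 2 * \<delta> + 8 * \<delta> / \<rho> + 2 * \<Phi>" using g_small[of 0] by (simp add: field_simps)
    finally have "\<bar>g t\<bar> \<le> 2 * \<delta> + 8 * \<delta> / \<rho> + 2 * \<Phi>" .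
    moreover have "\<bar>u t\<bar> \<le> \<bar>g t\<bar>"
    proof -
      have "\<bar>u t\<bar> = \<bar>g t\<bar> * \<bar>k t\<bar>" using kge[OF t] by (simp add: g_def abs_mult)
      also have "\<dots> \<le> \<bar>g t\<bar> * 1" using kle by (intro mult_left_mono) auto
      finally show ?thesis by simp
    qed
    ultimately have ut: "\<bar>u t\<bar> \<le> 2 * \<delta> + 8 * \<delta> / \<rho> + 2 * \<Phi>" by simp
    have pw: "\<rho> ^ (2 * Suc n) \<le> 1" "\<rho> ^ (2 * Suc n) \<le> \<rho>"
      using \<rho> power_le_one[of \<rho> "2 * Suc n"] power_decreasing[of 1 "2 * Suc n" \<rho>]
      by (simp_all del: power_Suc mult_Suc_right)
    have "2 * \<delta> \<le> 2 * \<delta> / \<rho> ^ (2 * Suc n)"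
      using pw(1) \<rho> \<delta> divide_left_mono[of "\<rho> ^ (2 * Suc n)" 1 "2 * \<delta>"] by simp
    moreover have "8 * \<delta> / \<rho> \<le> 8 * \<delta> / \<rho> ^ (2 * Suc n)"
      using pw \<rho> \<delta> by (intro divide_left_mono) auto
    moreover have "2 * \<Phi> = 32 * C * \<delta> / \<rho> ^ (2 * Suc n)"
      by (simp add: \<Phi>_def power_add power2_eq_square)
    moreover have "32 * C * \<delta> / \<rho> ^ (2 * Suc n) \<ge> 0" using C0 \<delta> \<rho> by simp
    moreover have "8 * \<delta> / \<rho> ^ (2 * Suc n) \<ge> 0" using \<delta> \<rho> by simp
    ultimately have "\<bar>u t\<bar> \<le> 2 * \<delta> / \<rho> ^ (2 * Suc n) + 16 * \<delta> / \<rho> ^ (2 * Suc n) + 64 * C * \<delta> / \<rho> ^ (2 * Suc n)"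
      using ut by linarith
    also have "\<dots> = (18 + 64 * C) * \<delta> / \<rho> ^ (2 * Suc n)"
      by (simp add: algebra_simps add_divide_distrib)
    finally show "\<bar>Re (expsum A b \<mu> t)\<bar> \<le> (18 + 64 * C) * \<delta> / \<rho> ^ (2 * Suc n)"
      by (simp add: u_def)
  qed
qed

text \<open>Multiplying the coefficients by \<open>- \<i>\<close> turns the imaginary part into a
  real part, so the estimate for real parts applies twice.\<close>

lemma expsum_small:
  "\<exists>C\<ge>0. \<forall>(A::'i set) \<mu> b p x \<rho> \<delta>. finite A \<longrightarrow> card A = n \<longrightarrow> (\<forall>j\<in>A. \<bar>\<mu> j\<bar> \<le> 1) \<longrightarrow>
     0 < \<rho> \<longrightarrow> \<rho> \<le> 1 \<longrightarrow> 0 \<le> \<delta> \<longrightarrow>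
     (\<forall>i<4^n. p i \<in> {x..x+1} \<and> norm (expsum A b \<mu> (p i)) \<le> \<delta>) \<longrightarrow>
     (\<forall>i. Suc i < 4^n \<longrightarrow> p i + \<rho> \<le> p (Suc i)) \<longrightarrow>
     (\<forall>t\<in>{x..x+1}. norm (expsum A b \<mu> t) \<le> C * \<delta> / \<rho> ^ (2 * n))"
proof -
  obtain C where C0: "C \<ge> 0" and C: "\<forall>(A::'i set) \<mu> b p x \<rho> \<delta>. finite A \<longrightarrow> card A = n \<longrightarrow> (\<forall>j\<in>A. \<bar>\<mu> j\<bar> \<le> 1) \<longrightarrow>
     0 < \<rho> \<longrightarrow> \<rho> \<le> 1 \<longrightarrow> 0 \<le> \<delta> \<longrightarrow>
     (\<forall>i<4^n. p i \<in> {x..x+1} \<and> \<bar>Re (expsum A b \<mu> (p i))\<bar> \<le> \<delta>) \<longrightarrow>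
     (\<forall>i. Suc i < 4^n \<longrightarrow> p i + \<rho> \<le> p (Suc i)) \<longrightarrow>
     (\<forall>t\<in>{x..x+1}. \<bar>Re (expsum A b \<mu> t)\<bar> \<le> C * \<delta> / \<rho> ^ (2 * n))"
    using Re_expsum_small[where 'i = 'i and n = n] by (elim exE conjE) (rule that)
  show ?thesis
  proof (rule exI[of _ "2 * C"], intro conjI allI impI ballI)
    show "0 \<le> 2 * C" using C0 by simp
    fix A :: "'i set" and \<mu> b p x \<rho> \<delta> t
    assume A: "finite A" "card A = n" and \<mu>: "\<forall>j\<in>A. \<bar>\<mu> j\<bar> \<le> 1"
      and \<rho>: "0 < \<rho>" "\<rho> \<le> (1::real)" and \<delta>: "0 \<le> (\<delta>::real)"
      and p1: "\<forall>i<4^n. p i \<in> {x..x+1} \<and> norm (expsum A b \<mu> (p i)) \<le> \<delta>"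
      and p2: "\<forall>i. Suc i < 4^n \<longrightarrow> p i + \<rho> \<le> p (Suc i)"
      and t: "t \<in> {x..x+1}"
    have *: "\<bar>Re (expsum A (\<lambda>j. \<omega> * b j) \<mu> t)\<bar> \<le> C * \<delta> / \<rho> ^ (2 * n)" if \<omega>: "norm \<omega> = 1" for \<omega>
    proof (rule C[rule_format, where p = p])
      fix i :: nat assume i: "i < 4^n"
      have "\<bar>Re (expsum A (\<lambda>j. \<omega> * b j) \<mu> (p i))\<bar> \<le> norm (\<omega> * expsum A b \<mu> (p i))"
        by (simp only: expsum_def sum_distrib_left mult.assoc abs_Re_le_cmod)
      also have "\<dots> \<le> \<delta>" using p1 i \<omega> by (simp add: norm_mult)
      finally show "p i \<in> {x..x+1} \<and> \<bar>Re (expsum A (\<lambda>j. \<omega> * b j) \<mu> (p i))\<bar> \<le> \<delta>"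
        using p1 i by simp
    qed (use A \<mu> \<rho> \<delta> p2 t in auto)
    have "Im (expsum A b \<mu> t) = Re (expsum A (\<lambda>j. - \<i> * b j) \<mu> t)"
      by (simp add: expsum_def)
    then have "\<bar>Im (expsum A b \<mu> t)\<bar> \<le> C * \<delta> / \<rho> ^ (2 * n)" using *[of "- \<i>"] by simp
    moreover have "\<bar>Re (expsum A b \<mu> t)\<bar> \<le> C * \<delta> / \<rho> ^ (2 * n)" using *[of 1] by simp
    ultimately show "norm (expsum A b \<mu> t) \<le> 2 * C * \<delta> / \<rho> ^ (2 * n)"
      using cmod_le[of "expsum A b \<mu> t"] by simp
  qed
qed

section \<open>Covering the set where an exponential sum is small\<close>

text \<open>A separated subset of largest cardinality is a \<open>\<rho>\<close>-net, because a
  point farther than \<open>\<rho>\<close> from all its members could be added to it.\<close>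

lemma separated_cover:
  fixes S :: "real set"
  assumes "\<And>Z. finite Z \<Longrightarrow> Z \<subseteq> S \<Longrightarrow> \<forall>x\<in>Z. \<forall>y\<in>Z. x < y \<longrightarrow> x + \<rho> \<le> y \<Longrightarrow> card Z \<le> n"
    and "\<rho> > 0"
  shows "\<exists>Z. finite Z \<and> card Z \<le> n \<and> S \<subseteq> (\<Union>z\<in>Z. {z - \<rho>..z + \<rho>})"
proof -
  define sep where "sep Z \<longleftrightarrow> finite Z \<and> Z \<subseteq> S \<and> (\<forall>x\<in>Z. \<forall>y\<in>Z. x < y \<longrightarrow> x + \<rho> \<le> y)" for Z
  have bd: "\<forall>Z. sep Z \<longrightarrow> card Z < Suc n" using assms(1) by (auto simp: sep_def less_Suc_eq_le)
  have "sep {}" by (simp add: sep_def)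
  from ex_has_greatest_nat[OF this bd] obtain Z where Z: "sep Z" "\<And>Y. sep Y \<Longrightarrow> card Y \<le> card Z" by blast
  have "x \<in> (\<Union>z\<in>Z. {z - \<rho>..z + \<rho>})" if x: "x \<in> S" for x
  proof (rule ccontr)
    assume nx: "x \<notin> (\<Union>z\<in>Z. {z - \<rho>..z + \<rho>})"
    then have far: "x + \<rho> < z \<or> z + \<rho> < x" if "z \<in> Z" for z
      using that by (auto simp: not_le algebra_simps)
    from far[of x] have "x \<notin> Z" using assms(2) by auto
    moreover have "sep (insert x Z)"
      unfolding sep_def
    proof (intro conjI ballI impI)
      fix u v assume "u \<in> insert x Z" "v \<in> insert x Z" "u < v"
      then show "u + \<rho> \<le> v" using Z(1) far[of u] far[of v] assms(2) by (auto simp: sep_def)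
    qed (use Z(1) x in \<open>auto simp: sep_def\<close>)
    ultimately show False using Z(2)[of "insert x Z"] Z(1) by (simp add: sep_def)
  qed
  then have "S \<subseteq> (\<Union>z\<in>Z. {z - \<rho>..z + \<rho>})" by (rule subsetI)
  moreover have "finite Z" "card Z \<le> n" using Z(1) assms(1)[of Z] unfolding sep_def by auto
  ultimately show ?thesis by (intro exI[of _ Z] conjI)
qed

text \<open>If a unit interval contained more than \<open>4^n\<close> separated points of the
  sublevel set, the sum would be small on the whole interval, and Turan's inequality run backwards
  would make it small at \<open>0\<close>, where it equals \<open>1\<close>. The factor
  \<open>T ^ n\<close> in the threshold pays for the distance to \<open>0\<close>.\<close>

lemma expsum_sublevel_cover:
  assumes n: "n \<ge> 1"
  shows "\<exists>C>0. \<forall>(A::'i set) \<mu> b \<rho> (T::nat). finite A \<longrightarrow> card A = n \<longrightarrow> (\<forall>j\<in>A. \<bar>\<mu> j\<bar> \<le> 1) \<longrightarrow>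
     expsum A b \<mu> 0 = 1 \<longrightarrow> 0 < \<rho> \<longrightarrow> \<rho> \<le> 1 \<longrightarrow> 1 \<le> T \<longrightarrow>
     (\<exists>Z. finite Z \<and> card Z \<le> 4^n * T \<and>
       {t \<in> {0..real T}. norm (expsum A b \<mu> t) \<le> C * \<rho> ^ (2*n) / real T ^ n} \<subseteq> (\<Union>z\<in>Z. {z - \<rho>..z + \<rho>}))"
proof -
  obtain C1 where C1: "C1 \<ge> 0" and sm: "\<forall>(A::'i set) \<mu> b p x \<rho> \<delta>. finite A \<longrightarrow> card A = n \<longrightarrow> (\<forall>j\<in>A. \<bar>\<mu> j\<bar> \<le> 1) \<longrightarrow>
     0 < \<rho> \<longrightarrow> \<rho> \<le> 1 \<longrightarrow> 0 \<le> \<delta> \<longrightarrow>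
     (\<forall>i<4^n. p i \<in> {x..x+1} \<and> norm (expsum A b \<mu> (p i)) \<le> \<delta>) \<longrightarrow>
     (\<forall>i. Suc i < 4^n \<longrightarrow> p i + \<rho> \<le> p (Suc i)) \<longrightarrow>
     (\<forall>t\<in>{x..x+1}. norm (expsum A b \<mu> t) \<le> C1 * \<delta> / \<rho> ^ (2 * n))"
    using expsum_small[where 'i = 'i and n = n] by (elim exE conjE) (rule that)
  \<comment> \<open>Chosen so that the final product becomes
    \<open>C1 / (2 * (C1 + 1)) < 1\<close>.\<close>
  define C where "C = 1 / (2 * (3 * real n) ^ n * (C1 + 1))"
  have C: "C > 0" using C1 n by (simp add: C_def)
  show ?thesis
  proof (rule exI[of _ C], intro conjI allI impI)
    show "C > 0" by (rule C)
    fix A :: "'i set" and \<mu> b \<rho> and T :: nat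
    assume A: "finite A" "card A = n" and \<mu>: "\<forall>j\<in>A. \<bar>\<mu> j\<bar> \<le> 1" and one: "expsum A b \<mu> 0 = 1"
      and \<rho>: "0 < \<rho>" "\<rho> \<le> (1::real)" and T: "1 \<le> T"
    define \<delta> where "\<delta> = C * \<rho> ^ (2*n) / real T ^ n"
    have \<delta>: "\<delta> > 0" using C \<rho> T by (simp add: \<delta>_def)
    define S where "S k = {t \<in> {real k..real k + 1}. norm (expsum A b \<mu> t) \<le> \<delta>}" for k
    have "\<exists>Z. finite Z \<and> card Z \<le> 4^n \<and> S k \<subseteq> (\<Union>z\<in>Z. {z - \<rho>..z + \<rho>})" if k: "k < T" for k
    proof (rule separated_cover[OF _ \<rho>(1)], rule ccontr)
      fix Z assume Z: "finite Z" "Z \<subseteq> S k" and sep: "\<forall>x\<in>Z. \<forall>y\<in>Z. x < y \<longrightarrow> x + \<rho> \<le> y"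
        and "\<not> card Z \<le> 4^n"
      then have card: "4^n \<le> card Z" by simp
      define p where "p i = sorted_list_of_set Z ! i" for i
      have pZ: "p i \<in> Z" if "i < card Z" for i
        using that Z(1) nth_mem[of i "sorted_list_of_set Z"] by (simp add: p_def)
      have pS: "p i < p (Suc i)" if "Suc i < card Z" for i
        using that strict_sorted_list_of_set[of Z]
        unfolding p_def by (intro sorted_wrt_nth_less[of "(<)"]) auto
      have bnd: "norm (expsum A b \<mu> t) \<le> C1 * \<delta> / \<rho> ^ (2 * n)" if t: "t \<in> {real k..real k+1}" for t
      proof (rule sm[rule_format, where p = p and x = "real k"])
        fix i :: nat assume "i < 4^n"
        then show "p i \<in> {real k..real k+1} \<and> norm (expsum A b \<mu> (p i)) \<le> \<delta>"
          using pZ[of i] Z(2) card by (auto simp: S_def)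
      next
        fix i :: nat assume "Suc i < 4^n"
        then show "p i + \<rho> \<le> p (Suc i)" using pZ[of i] pZ[of "Suc i"] pS[of i] sep card by auto
      qed (use A \<mu> \<rho> \<delta> t in auto)
      \<comment> \<open>A progression of step \<open>- 1 / n\<close> from \<open>k + 1\<close>: its
        first \<open>n\<close> points lie in \<open>[k, k + 1]\<close>, and after
        \<open>n * (k + 1)\<close> steps it reaches \<open>0\<close>.\<close>
      have "norm (expsum A b \<mu> (real k + 1 + real (n * (k+1)) * (- 1 / real n))) \<le>
        (2 * real (n * (k+1)) + 1) ^ card A * (C1 * \<delta> / \<rho> ^ (2 * n))"
      proof (rule expsum_turan)
        fix i assume "i < card A"
        then have "real i / real n \<le> 1" using A by simp
        then show "norm (expsum A b \<mu> (real k + 1 + real i * (- 1 / real n))) \<le> C1 * \<delta> / \<rho> ^ (2 * n)"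
          by (intro bnd) auto
      qed (use A C1 \<delta> \<rho> in auto)
      moreover have "real k + 1 + real (n * (k+1)) * (- 1 / real n) = 0" using n by (simp add: field_simps)
      ultimately have "1 \<le> (2 * real (n * (k+1)) + 1) ^ n * (C1 * \<delta> / \<rho> ^ (2 * n))"
        using one A by simp
      also have "\<dots> \<le> (3 * real n * real T) ^ n * (C1 * \<delta> / \<rho> ^ (2 * n))"
      proof (intro mult_right_mono power_mono)
        have "n * (k+1) \<le> n * T" using k by (intro mult_le_mono2) simp
        moreover have "1 \<le> n * T" using n T by simp
        ultimately have "2 * (n * (k+1)) + 1 \<le> 3 * (n * T)" by linarith
        then have "real (2 * (n * (k+1)) + 1) \<le> real (3 * (n * T))" by (rule of_nat_mono)
        then show "2 * real (n * (k+1)) + 1 \<le> 3 * real n * real T" by simp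
      qed (use C1 \<delta> \<rho> in auto)
      also have "\<dots> = (3 * real n) ^ n * C * C1"
        using T \<rho> by (simp add: \<delta>_def power_mult_distrib)
      also have "\<dots> = C1 / (2 * (C1 + 1))"
        using n by (simp add: C_def)
      also have "\<dots> < 1" using C1 by (simp add: field_simps)
      finally show False by simp
    qed
    then obtain Z where Z: "\<And>k. k < T \<Longrightarrow> finite (Z k) \<and> card (Z k) \<le> 4^n \<and> S k \<subseteq> (\<Union>z\<in>Z k. {z - \<rho>..z + \<rho>})"
      by metis
    have "{t \<in> {0..real T}. norm (expsum A b \<mu> t) \<le> \<delta>} \<subseteq> (\<Union>k<T. S k)"
    proof
      fix t assume t: "t \<in> {t \<in> {0..real T}. norm (expsum A b \<mu> t) \<le> \<delta>}"
      \<comment> \<open>The minimum puts the endpoint \<open>t = T\<close> into the last unit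
        interval.\<close>
      define k where "k = min (nat \<lfloor>t\<rfloor>) (T - 1)"
      have "k < T" using T by (auto simp: k_def)
      moreover have "real k \<le> t" 
        using t of_nat_floor[of t] unfolding k_def by (intro order_trans[OF of_nat_mono[OF min.cobounded1]]) auto
      moreover have "t \<le> real k + 1"
      proof (cases "nat \<lfloor>t\<rfloor> \<le> T - 1")
        case True
        then show ?thesis using t by (simp add: k_def)
      next
        case False
        then show ?thesis using t T by (simp add: k_def)
      qed
      ultimately show "t \<in> (\<Union>k<T. S k)" using t by (auto simp: S_def)
    qed
    also have "\<dots> \<subseteq> (\<Union>z\<in>(\<Union>k<T. Z k). {z - \<rho>..z + \<rho>})" using Z by (simp add: UN_subset_iff) blast
    finally have cov: "{t \<in> {0..real T}. norm (expsum A b \<mu> t) \<le> \<delta>} \<subseteq> (\<Union>z\<in>(\<Union>k<T. Z k). {z - \<rho>..z + \<rho>})" .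
    have "card (\<Union>k<T. Z k) \<le> (\<Sum>k<T. card (Z k))" by (rule card_UN_le) simp
    also have "\<dots> \<le> (\<Sum>k<T. 4^n)" using Z by (intro sum_mono) auto
    finally have "card (\<Union>k<T. Z k) \<le> 4^n * T" by (simp add: mult.commute)
    moreover have "finite (\<Union>k<T. Z k)" using Z by auto
    ultimately show "\<exists>Z. finite Z \<and> card Z \<le> 4^n * T \<and>
       {t \<in> {0..real T}. norm (expsum A b \<mu> t) \<le> C * \<rho> ^ (2*n) / real T ^ n} \<subseteq> (\<Union>z\<in>Z. {z - \<rho>..z + \<rho>})"
      using cov unfolding \<delta>_def by blast
  qed
qed

section \<open>Mean squares of exponential sums\<close>

text \<open>The integral of \<open>(T - y) * cos (b * y)\<close> over \<open>[0, T]\<close>, half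
  the Fourier transform of a triangle. Its nonnegativity allows the off-diagonal terms of a mean
  square to be dropped.\<close>

definition fejer :: "real \<Rightarrow> real \<Rightarrow> real" where
  "fejer T b = (if b = 0 then T\<^sup>2 / 2 else (1 - cos (b * T)) / b\<^sup>2)"

lemma fejer_nonneg: "0 \<le> fejer T b"
  by (simp add: fejer_def)

lemma fejer_2_le: "fejer 2 b \<le> 4 / (1 + b\<^sup>2)"
proof (cases "b = 0")
  case False
  have "1 - cos (b * 2) \<le> 2 * b\<^sup>2" using cos_ge_quadratic[of "b * 2"] by (simp add: power2_eq_square)
  moreover have "1 - cos (b * 2) \<le> 2" by simp
  ultimately have "(1 - cos (b * 2)) * (1 + b\<^sup>2) \<le> 4 * b\<^sup>2"
    using mult_right_mono[of "1 - cos (b * 2)" 2 "b\<^sup>2"] unfolding distrib_left by simp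
  moreover have "0 < 1 + b\<^sup>2" by (simp add: add_pos_nonneg)
  ultimately have "(1 - cos (b * 2)) / b\<^sup>2 \<le> 4 / (1 + b\<^sup>2)"
    using False by (simp add: pos_divide_le_eq pos_le_divide_eq)
  then show ?thesis using False by (simp add: fejer_def)
qed (simp add: fejer_def)

lemma fejer_has_integral:
  assumes "T \<ge> 0"
  shows "((\<lambda>y. (T - y) * cos (b * y)) has_integral fejer T b) {0..T}"
proof (cases "b = 0")
  case True
  have "((\<lambda>y. (T - y) * cos (b * y)) has_integral (T * T - T\<^sup>2/2) - (T * 0 - 0\<^sup>2/2)) {0..T}"
    using True assms
    by (intro fundamental_theorem_of_calculus)
      (auto intro!: derivative_eq_intros simp flip: has_real_derivative_iff_has_vector_derivative)
  then show ?thesis using True by (simp add: fejer_def power2_eq_square)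
next
  case False
  define F where "F y = (T - y) * sin (b * y) / b - cos (b * y) / b\<^sup>2" for y
  have "(F has_real_derivative (T - y) * cos (b * y)) (at y within {0..T})" for y
    using False unfolding F_def
    by (auto intro!: derivative_eq_intros simp: power2_eq_square field_simps)
  then have "((\<lambda>y. (T - y) * cos (b * y)) has_integral F T - F 0) {0..T}"
    using assms
    by (intro fundamental_theorem_of_calculus)
      (auto simp flip: has_real_derivative_iff_has_vector_derivative)
  moreover have "F T - F 0 = fejer T b" using False by (simp add: F_def fejer_def diff_divide_distrib)
  ultimately show ?thesis by simp
qed

definition trigsum :: "'u set \<Rightarrow> ('u \<Rightarrow> real) \<Rightarrow> real \<Rightarrow> complex" where
  "trigsum U \<beta> y = (\<Sum>u\<in>U. cis (\<beta> u * y))"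

lemma continuous_on_trigsum [continuous_intros]: "continuous_on S (trigsum U \<beta>)"
  unfolding trigsum_def[abs_def] by (intro continuous_intros)

lemma norm_trigsum_sq:
  assumes "finite U"
  shows "(norm (trigsum U \<beta> y))\<^sup>2 = (\<Sum>u\<in>U. \<Sum>v\<in>U. cos ((\<beta> u - \<beta> v) * y))"
proof -
  have "complex_of_real ((norm (trigsum U \<beta> y))\<^sup>2) = trigsum U \<beta> y * cnj (trigsum U \<beta> y)"
    by (rule complex_norm_square)
  also have "\<dots> = (\<Sum>u\<in>U. \<Sum>v\<in>U. cis ((\<beta> u - \<beta> v) * y))"
    by (simp add: trigsum_def cnj_sum sum_product cis_cnj cis_mult algebra_simps)
  finally have "Re (complex_of_real ((norm (trigsum U \<beta> y))\<^sup>2)) = Re \<dots>" by simp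
  then show ?thesis by simp
qed

text \<open>The weight \<open>T - y \<le> T\<close> turns every pair of frequencies into a
  nonnegative \<open>fejer\<close> value, and only the diagonal values \<open>T^2 / 2\<close> are
  kept.\<close>

lemma trigsum_mean_square_ge:
  assumes "finite U" "T > 0"
  shows "real (card U) * T / 2 \<le> integral {0..T} (\<lambda>y. (norm (trigsum U \<beta> y))\<^sup>2)"
proof -
  have "((\<lambda>y. \<Sum>u\<in>U. \<Sum>v\<in>U. (T - y) * cos ((\<beta> u - \<beta> v) * y)) has_integral
     (\<Sum>u\<in>U. \<Sum>v\<in>U. fejer T (\<beta> u - \<beta> v))) {0..T}"
    using assms by (intro has_integral_sum fejer_has_integral) auto
  then have I: "((\<lambda>y. (T - y) * (norm (trigsum U \<beta> y))\<^sup>2) has_integral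
     (\<Sum>u\<in>U. \<Sum>v\<in>U. fejer T (\<beta> u - \<beta> v))) {0..T}"
    by (simp add: norm_trigsum_sq assms sum_distrib_left)
  have "(\<Sum>u\<in>U. T\<^sup>2 / 2) \<le> (\<Sum>u\<in>U. \<Sum>v\<in>U. fejer T (\<beta> u - \<beta> v))"
  proof (rule sum_mono)
    fix u assume u: "u \<in> U"
    have "fejer T (\<beta> u - \<beta> u) \<le> (\<Sum>v\<in>U. fejer T (\<beta> u - \<beta> v))"
      by (rule member_le_sum) (use u assms fejer_nonneg in auto)
    then show "T\<^sup>2 / 2 \<le> (\<Sum>v\<in>U. fejer T (\<beta> u - \<beta> v))" by (simp add: fejer_def)
  qed
  also have "\<dots> \<le> integral {0..T} (\<lambda>y. T * (norm (trigsum U \<beta> y))\<^sup>2)"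
    by (rule has_integral_le[OF I integrable_integral])
      (auto intro!: integrable_continuous_interval continuous_intros mult_right_mono)
  also have "\<dots> = T * integral {0..T} (\<lambda>y. (norm (trigsum U \<beta> y))\<^sup>2)" by simp
  finally show ?thesis using assms by (simp add: power2_eq_square)
qed

text \<open>After symmetrisation about \<open>y0\<close>, the weight \<open>2 - y\<close> dominates
  \<open>1\<close> on \<open>[0, 1]\<close> and stays nonnegative up to \<open>2\<close>, so the
  integral is enlarged to one that the decaying \<open>fejer 2\<close> evaluates exactly.\<close>

lemma trigsum_mean_square_le:
  assumes U: "finite U"
  shows "integral {y0 - 1..y0 + 1} (\<lambda>y. (norm (trigsum U \<beta> y))\<^sup>2) \<le>
    (\<Sum>u\<in>U. \<Sum>v\<in>U. 8 / (1 + (\<beta> u - \<beta> v)\<^sup>2))"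
proof -
  define g where "g y = (norm (trigsum U \<beta> (y0 + y)))\<^sup>2" for y
  have gn: "0 \<le> g y" for y by (simp add: g_def)
  have cont [continuous_intros]: "continuous_on S g" for S
    unfolding g_def[abs_def]
    by (intro continuous_intros continuous_on_compose2[OF continuous_on_trigsum[of UNIV]]) auto
  have contm: "continuous_on S (\<lambda>y. g (- y))" for S
    by (intro continuous_on_compose2[OF cont[of UNIV]] continuous_intros) auto
  have intg: "g integrable_on {a..b}" "(\<lambda>y. g (- y)) integrable_on {a..b}" for a b
    by (auto intro!: integrable_continuous_interval cont contm)
  have "integral {y0 - 1..y0 + 1} (\<lambda>y. (norm (trigsum U \<beta> y))\<^sup>2) = integral {-1..1} g"
    using integral_shift_Icc_real[of "-1" 1 "\<lambda>y. (norm (trigsum U \<beta> y))\<^sup>2" y0]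
    by (simp add: g_def[abs_def] o_def add.commute)
  also have "\<dots> = integral {-1..0} g + integral {0..1} g"
    by (rule Henstock_Kurzweil_Integration.integral_combine[symmetric]) (auto intro: intg)
  also have "integral {-1..0} g = integral {0..1} (\<lambda>y. g (- y))"
    using Henstock_Kurzweil_Integration.integral_reflect_real[of 1 0 "\<lambda>y. g (- y)"] by simp
  also have "integral {0..1} (\<lambda>y. g (- y)) + integral {0..1} g = integral {0..1} (\<lambda>y. g (- y) + g y)"
    by (rule integral_add[symmetric]) (auto intro: intg)
  also have "\<dots> \<le> integral {0..1} (\<lambda>y. (2 - y) * (g (- y) + g y))"
  proof (rule integral_le)
    fix y :: real assume "y \<in> {0..1}"
    moreover have "0 \<le> g (- y) + g y" by (simp add: g_def)
    ultimately have "1 * (g (- y) + g y) \<le> (2 - y) * (g (- y) + g y)"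
      by (intro mult_right_mono) auto
    then show "g (- y) + g y \<le> (2 - y) * (g (- y) + g y)" by simp
  qed (auto intro!: integrable_continuous_interval continuous_intros contm)
  also have "\<dots> \<le> integral {0..2} (\<lambda>y. (2 - y) * (g (- y) + g y))"
    by (rule integral_subset_le)
      (auto intro!: integrable_continuous_interval continuous_intros contm mult_nonneg_nonneg add_nonneg_nonneg gn)
  also have "\<dots> = (\<Sum>u\<in>U. \<Sum>v\<in>U. 2 * cos ((\<beta> u - \<beta> v) * y0) * fejer 2 (\<beta> u - \<beta> v))"
  proof (rule integral_unique)
    have "(2 - y) * (g (- y) + g y) =
      (\<Sum>u\<in>U. \<Sum>v\<in>U. 2 * cos ((\<beta> u - \<beta> v) * y0) * ((2 - y) * cos ((\<beta> u - \<beta> v) * y)))" for y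
      unfolding g_def norm_trigsum_sq[OF U] sum.distrib[symmetric] sum_distrib_left
      by (intro sum.cong refl) (simp add: ring_distribs cos_add cos_diff)
    moreover have "((\<lambda>y. \<Sum>u\<in>U. \<Sum>v\<in>U. 2 * cos ((\<beta> u - \<beta> v) * y0) * ((2 - y) * cos ((\<beta> u - \<beta> v) * y)))
      has_integral (\<Sum>u\<in>U. \<Sum>v\<in>U. 2 * cos ((\<beta> u - \<beta> v) * y0) * fejer 2 (\<beta> u - \<beta> v))) {0..2}"
      using U by (intro has_integral_sum has_integral_mult_right fejer_has_integral) auto
    ultimately show "((\<lambda>y. (2 - y) * (g (- y) + g y)) has_integral
      (\<Sum>u\<in>U. \<Sum>v\<in>U. 2 * cos ((\<beta> u - \<beta> v) * y0) * fejer 2 (\<beta> u - \<beta> v))) {0..2}" by simp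
  qed
  also have "\<dots> \<le> (\<Sum>u\<in>U. \<Sum>v\<in>U. 2 * 1 * (4 / (1 + (\<beta> u - \<beta> v)\<^sup>2)))"
    by (intro sum_mono order_trans[OF mult_right_mono[OF mult_left_mono[OF cos_le_one]]
      mult_left_mono[OF fejer_2_le]]) (auto simp: fejer_nonneg)
  finally show ?thesis by simp
qed

section \<open>Counting close pairs of frequencies\<close>

text \<open>An autocorrelation is largest at shift zero: with \<open>n i\<close> elements on level
  \<open>i\<close>, the count is the sum of \<open>n i * n (i + e)\<close>, bounded through
  \<open>2 x y \<le> x^2 + y^2\<close>.\<close>

lemma card_pairs_shift_le:
  fixes k :: "'u \<Rightarrow> int"
  assumes U: "finite U"
  shows "card {(u,v) \<in> U \<times> U. k v = k u + e} \<le> card {(u,v) \<in> U \<times> U. k u = k v}"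
proof -
  define n where "n i = real (card {u \<in> U. k u = i})" for i
  have eq: "real (card {(u,v) \<in> U \<times> U. k v = k u + e}) = (\<Sum>i\<in>k ` U. n i * n (i + e))" for e
  proof -
    have "{(u,v) \<in> U \<times> U. k v = k u + e} = (SIGMA u:U. {v \<in> U. k v = k u + e})" by auto
    then have "real (card {(u,v) \<in> U \<times> U. k v = k u + e}) = (\<Sum>u\<in>U. n (k u + e))"
      using U by (simp add: n_def)
    also have "\<dots> = (\<Sum>i\<in>k ` U. \<Sum>u\<in>{u \<in> U. k u = i}. n (k u + e))"
      using U by (rule sum.image_gen)
    also have "\<dots> = (\<Sum>i\<in>k ` U. n i * n (i + e))" by (simp add: n_def)
    finally show ?thesis .
  qed
  have z: "n i = 0" if "i \<notin> k ` U" for i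
  proof -
    have "{u \<in> U. k u = i} = {}" using that by auto
    then have "card {u \<in> U. k u = i} = 0" by (simp only: card.empty)
    then show ?thesis by (simp add: n_def)
  qed
  have "(\<Sum>i\<in>k ` U. (n (i + e))\<^sup>2) = (\<Sum>i\<in>(\<lambda>i. i + e) ` k ` U. (n i)\<^sup>2)"
    by (simp add: sum.reindex inj_on_def)
  also have "\<dots> \<le> (\<Sum>i\<in>(\<lambda>i. i + e) ` k ` U \<union> k ` U. (n i)\<^sup>2)"
    using U by (intro sum_mono2) auto
  also have "\<dots> = (\<Sum>i\<in>k ` U. (n i)\<^sup>2)"
    using U z by (intro sum.mono_neutral_right) auto
  finally have sh: "(\<Sum>i\<in>k ` U. (n (i + e))\<^sup>2) \<le> (\<Sum>i\<in>k ` U. (n i)\<^sup>2)" .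
  have "2 * (\<Sum>i\<in>k ` U. n i * n (i + e)) \<le> (\<Sum>i\<in>k ` U. (n i)\<^sup>2 + (n (i + e))\<^sup>2)"
    unfolding sum_distrib_left
    by (intro sum_mono) (metis sum_squares_bound mult.assoc)
  also have "\<dots> \<le> 2 * (\<Sum>i\<in>k ` U. n i * n (i + 0))"
    using sh by (simp add: sum.distrib power2_eq_square)
  finally have "real (card {(u,v) \<in> U \<times> U. k v = k u + e}) \<le> real (card {(u,v) \<in> U \<times> U. k v = k u + 0})"
    by (simp only: eq)
  then show ?thesis by (simp add: eq_commute)
qed

lemma sum_inverse_quadratic_le:
  fixes E :: "int set"
  assumes "finite E"
  shows "(\<Sum>e\<in>E. 1 / (1 + (real_of_int e)\<^sup>2)) \<le> 5"
proof -
  \<comment> \<open>The bound is exact at \<open>n = 0\<close>, and its increments are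
    \<open>4 / ((n + 1) * (n + 2))\<close>, which dominate the two new terms.\<close>
  have A: "(\<Sum>e\<in>{- int n..int n}. 1 / (1 + (real_of_int e)\<^sup>2)) \<le> 5 - 4 / (real n + 1)" for n
  proof (induction n)
    case (Suc n)
    have "{- int (Suc n)..int (Suc n)} = insert (- int (Suc n)) (insert (int (Suc n)) {- int n..int n})"
      by auto
    then have "(\<Sum>e\<in>{- int (Suc n)..int (Suc n)}. 1 / (1 + (real_of_int e)\<^sup>2)) =
      2 / (1 + (real n + 1)\<^sup>2) + (\<Sum>e\<in>{- int n..int n}. 1 / (1 + (real_of_int e)\<^sup>2))"
      by (simp add: power2_eq_square algebra_simps)
    also have "\<dots> \<le> 2 / (1 + (real n + 1)\<^sup>2) + (5 - 4 / (real n + 1))" using Suc.IH by simp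
    also have "2 / (1 + (real n + 1)\<^sup>2) \<le> 4 / (real n + 1) - 4 / (real (Suc n) + 1)"
    proof -
      have "(real n + 1) * (real n + 2) \<le> 2 * (1 + (real n + 1)\<^sup>2)"
        by (simp add: power2_eq_square algebra_simps)
      then have "4 / (2 * (1 + (real n + 1)\<^sup>2)) \<le> 4 / ((real n + 1) * (real n + 2))"
        by (intro frac_le) (simp_all add: add_nonneg_pos)
      also have "\<dots> = 4 / (real n + 1) - 4 / (real (Suc n) + 1)" by (simp add: field_simps)
      finally have "4 / (2 * (1 + (real n + 1)\<^sup>2)) \<le> 4 / (real n + 1) - 4 / (real (Suc n) + 1)" .
      moreover have "4 / (2 * z) = 2 / z" for z :: real by simp
      ultimately show ?thesis by (simp only:)
    qed
    finally show ?case by simp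
  qed simp
  obtain n where n: "E \<subseteq> {- int n..int n}"
  proof
    show "E \<subseteq> {- int (nat (Max (insert 0 (abs ` E))))..int (nat (Max (insert 0 (abs ` E))))}"
    proof
      fix e assume "e \<in> E"
      then have "\<bar>e\<bar> \<le> Max (insert 0 (abs ` E))" using assms by (intro Max_ge) auto
      then show "e \<in> {- int (nat (Max (insert 0 (abs ` E))))..int (nat (Max (insert 0 (abs ` E))))}" by auto
    qed
  qed
  have "(\<Sum>e\<in>E. 1 / (1 + (real_of_int e)\<^sup>2)) \<le> (\<Sum>e\<in>{- int n..int n}. 1 / (1 + (real_of_int e)\<^sup>2))"
    using n by (intro sum_mono2) auto
  also have "\<dots> \<le> 5" using A[of n] by (smt (verit) divide_nonneg_nonneg of_nat_0_le_iff)
  finally show ?thesis .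
qed

lemma card_same_floor_le:
  assumes "finite U"
  shows "card {(u,v) \<in> U \<times> U. \<lfloor>\<beta> u\<rfloor> = \<lfloor>\<beta> v\<rfloor>} \<le> card {(u,v) \<in> U \<times> U. \<bar>\<beta> u - \<beta> v\<bar> \<le> (2::real)}"
proof (rule card_mono)
  have "\<bar>x - y\<bar> \<le> 2" if "\<lfloor>x\<rfloor> = \<lfloor>y\<rfloor>" for x y :: real using that by linarith
  then show "{(u,v) \<in> U \<times> U. \<lfloor>\<beta> u\<rfloor> = \<lfloor>\<beta> v\<rfloor>} \<subseteq> {(u,v) \<in> U \<times> U. \<bar>\<beta> u - \<beta> v\<bar> \<le> 2}" by auto
qed (use assms in \<open>auto intro: finite_subset[of _ "U \<times> U"]\<close>)

text \<open>Pairs are grouped by the difference of their integer parts; no group exceeds the one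
  with difference \<open>0\<close>. Replacing the true difference by the integer one costs a factor
  \<open>3\<close>, and the weights then sum to at most \<open>5\<close>.\<close>

lemma sum_pairs_quadratic_decay_le:
  fixes \<beta> :: "'u \<Rightarrow> real"
  assumes U: "finite U"
  shows "(\<Sum>u\<in>U. \<Sum>v\<in>U. 1 / (1 + (\<beta> u - \<beta> v)\<^sup>2)) \<le>
    15 * real (card {(u,v) \<in> U \<times> U. \<bar>\<beta> u - \<beta> v\<bar> \<le> 2})"
proof -
  define h where "h = (\<lambda>(u,v). \<lfloor>\<beta> v\<rfloor> - \<lfloor>\<beta> u\<rfloor>)"
  define D where "D = real (card {(u,v) \<in> U \<times> U. \<lfloor>\<beta> u\<rfloor> = \<lfloor>\<beta> v\<rfloor>})"
  have **: "1 + e \<le> 3 * (1 + d)" if "e \<le> d + (d + 1) + 1" "0 \<le> d" for e d :: real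
    using that by simp
  have "1 / (1 + (x - y)\<^sup>2) \<le> 3 * (1 / (1 + (real_of_int (\<lfloor>y\<rfloor> - \<lfloor>x\<rfloor>))\<^sup>2))" for x y :: real
  proof -
    have "\<bar>real_of_int (\<lfloor>y\<rfloor> - \<lfloor>x\<rfloor>)\<bar> \<le> \<bar>x - y\<bar> + 1" by linarith
    then have "(real_of_int (\<lfloor>y\<rfloor> - \<lfloor>x\<rfloor>))\<^sup>2 \<le> (\<bar>x - y\<bar> + 1)\<^sup>2"
      by (metis abs_ge_zero power2_abs power_mono)
    also have "\<dots> = (x - y)\<^sup>2 + 2 * \<bar>x - y\<bar> + 1" by (simp add: power2_eq_square algebra_simps flip: abs_mult)
    also have "2 * \<bar>x - y\<bar> \<le> (x - y)\<^sup>2 + 1"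
      using sum_squares_bound[of "\<bar>x - y\<bar>" 1] by simp
    finally have "(real_of_int (\<lfloor>y\<rfloor> - \<lfloor>x\<rfloor>))\<^sup>2 \<le> (x - y)\<^sup>2 + ((x - y)\<^sup>2 + 1) + 1" by simp
    then have "1 + (real_of_int (\<lfloor>y\<rfloor> - \<lfloor>x\<rfloor>))\<^sup>2 \<le> 3 * (1 + (x - y)\<^sup>2)"
      by (rule **) simp
    then have "3 / (3 * (1 + (x - y)\<^sup>2)) \<le> 3 / (1 + (real_of_int (\<lfloor>y\<rfloor> - \<lfloor>x\<rfloor>))\<^sup>2)"
      by (intro divide_left_mono) (auto intro!: mult_pos_pos add_pos_nonneg)
    moreover have "3 / (3 * z) = 1 / z" for z :: real by simp
    ultimately show ?thesis by (simp only: times_divide_eq_right mult_1_right)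
  qed
  then have "(\<Sum>u\<in>U. \<Sum>v\<in>U. 1 / (1 + (\<beta> u - \<beta> v)\<^sup>2)) \<le>
    (\<Sum>u\<in>U. \<Sum>v\<in>U. 3 * (1 / (1 + (real_of_int (h (u,v)))\<^sup>2)))"
    by (intro sum_mono) (simp add: h_def)
  also have "\<dots> = 3 * (\<Sum>p\<in>U \<times> U. 1 / (1 + (real_of_int (h p))\<^sup>2))"
    unfolding sum.cartesian_product sum_distrib_left by (simp add: case_prod_beta)
  also have "(\<Sum>p\<in>U \<times> U. 1 / (1 + (real_of_int (h p))\<^sup>2)) =
    (\<Sum>e\<in>h ` (U \<times> U). \<Sum>p\<in>{p \<in> U \<times> U. h p = e}. 1 / (1 + (real_of_int (h p))\<^sup>2))"
    using U by (intro sum.image_gen) auto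
  also have "\<dots> = (\<Sum>e\<in>h ` (U \<times> U). real (card {p \<in> U \<times> U. h p = e}) * (1 / (1 + (real_of_int e)\<^sup>2)))"
    by (intro sum.cong refl) simp
  also have "\<dots> \<le> (\<Sum>e\<in>h ` (U \<times> U). D * (1 / (1 + (real_of_int e)\<^sup>2)))"
  proof (intro sum_mono mult_right_mono)
    fix e
    have "{p \<in> U \<times> U. h p = e} = {(u,v) \<in> U \<times> U. \<lfloor>\<beta> v\<rfloor> = \<lfloor>\<beta> u\<rfloor> + e}" by (auto simp: h_def)
    then show "real (card {p \<in> U \<times> U. h p = e}) \<le> D"
      using card_pairs_shift_le[OF U, of "\<lambda>u. \<lfloor>\<beta> u\<rfloor>" e] by (simp add: D_def)
  qed auto
  also have "\<dots> = D * (\<Sum>e\<in>h ` (U \<times> U). 1 / (1 + (real_of_int e)\<^sup>2))" by (simp add: sum_distrib_left)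
  also have "\<dots> \<le> D * 5"
    using U by (intro mult_left_mono sum_inverse_quadratic_le) (auto simp: D_def)
  finally have "(\<Sum>u\<in>U. \<Sum>v\<in>U. 1 / (1 + (\<beta> u - \<beta> v)\<^sup>2)) \<le> 15 * D" by simp
  also have "D \<le> real (card {(u,v) \<in> U \<times> U. \<bar>\<beta> u - \<beta> v\<bar> \<le> 2})"
    unfolding D_def by (intro of_nat_mono card_same_floor_le U)
  finally show ?thesis by simp
qed

text \<open>The integer parts of a counted pair differ by one of six consecutive values, and each
  such class is no larger than the unshifted one. Uniformity in \<open>s\<close> is what later
  compares the descendants of two different words.\<close>

lemma card_pairs_translate_le:
  fixes \<beta> :: "'u \<Rightarrow> real"
  assumes U: "finite U"
  shows "card {(u,v) \<in> U \<times> U. \<bar>\<beta> u - \<beta> v + s\<bar> \<le> 2} \<le> 6 * card {(u,v) \<in> U \<times> U. \<bar>\<beta> u - \<beta> v\<bar> \<le> 2}"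
proof -
  let ?k = "\<lambda>u. \<lfloor>\<beta> u\<rfloor>"
  have fl: "\<lfloor>y\<rfloor> - \<lfloor>x\<rfloor> \<in> {\<lfloor>s\<rfloor> - 2..\<lfloor>s\<rfloor> + 3}" if "\<bar>x - y + s\<bar> \<le> 2" for x y :: real
    using that by auto linarith+
  have "{(u,v) \<in> U \<times> U. \<bar>\<beta> u - \<beta> v + s\<bar> \<le> 2} \<subseteq>
     (\<Union>e\<in>{\<lfloor>s\<rfloor> - 2..\<lfloor>s\<rfloor> + 3}. {(u,v) \<in> U \<times> U. ?k v = ?k u + e})"
  proof clarify
    fix u v assume uv: "u \<in> U" "v \<in> U" "\<bar>\<beta> u - \<beta> v + s\<bar> \<le> 2"
    then show "(u, v) \<in> (\<Union>e\<in>{\<lfloor>s\<rfloor> - 2..\<lfloor>s\<rfloor> + 3}. {(u,v) \<in> U \<times> U. ?k v = ?k u + e})"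
      using fl[of "\<beta> u" "\<beta> v"] by (intro UN_I[of "?k v - ?k u"]) auto
  qed
  then have "card {(u,v) \<in> U \<times> U. \<bar>\<beta> u - \<beta> v + s\<bar> \<le> 2} \<le>
     card (\<Union>e\<in>{\<lfloor>s\<rfloor> - 2..\<lfloor>s\<rfloor> + 3}. {(u,v) \<in> U \<times> U. ?k v = ?k u + e})"
    using U by (intro card_mono) (auto intro: finite_subset[of _ "U \<times> U"])
  also have "\<dots> \<le> (\<Sum>e\<in>{\<lfloor>s\<rfloor> - 2..\<lfloor>s\<rfloor> + 3}. card {(u,v) \<in> U \<times> U. ?k v = ?k u + e})"
    by (rule card_UN_le) simp
  also have "\<dots> \<le> (\<Sum>e\<in>{\<lfloor>s\<rfloor> - 2..\<lfloor>s\<rfloor> + 3}. card {(u,v) \<in> U \<times> U. \<bar>\<beta> u - \<beta> v\<bar> \<le> 2})"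
    by (intro sum_mono order_trans[OF card_pairs_shift_le[OF U] card_same_floor_le[OF U]])
  also have "\<dots> = 6 * card {(u,v) \<in> U \<times> U. \<bar>\<beta> u - \<beta> v\<bar> \<le> 2}" by simp
  finally show ?thesis .
qed

section \<open>Multiplicities of the projected discs\<close>

definition words :: "nat \<Rightarrow> nat \<Rightarrow> nat list set" where
  "words L n = {w. length w = n \<and> set w \<subseteq> {1..L}}"

text \<open>The centre belonging to a word, as an expansion in base \<open>L\<close> with digits
  \<open>a j\<close>. The type is general so that one formula serves both for centres in the plane
  and for their projections.\<close>

primrec pos :: "nat \<Rightarrow> (nat \<Rightarrow> 'a::real_vector) \<Rightarrow> nat list \<Rightarrow> 'a" where
  "pos L a [] = 0"
| "pos L a (j # w) = a j + (1 / real L) *\<^sub>R pos L a w"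

lemma finite_words [simp]: "finite (words L n)"
  using finite_lists_length_eq[of "{1..L}" n] by (simp add: words_def conj_commute)

lemma card_words: "card (words L n) = L ^ n"
  using card_lists_length_eq[of "{1..L}" n] by (simp add: words_def conj_commute)

lemma words_0 [simp]: "words L 0 = {[]}"
  by (auto simp: words_def)

lemma length_words: "w \<in> words L n \<Longrightarrow> length w = n"
  by (simp add: words_def)

lemma append_words: "u \<in> words L m \<Longrightarrow> v \<in> words L n \<Longrightarrow> u @ v \<in> words L (m + n)"
  by (auto simp: words_def)

lemma take_words: "w \<in> words L n \<Longrightarrow> k \<le> n \<Longrightarrow> take k w \<in> words L k"
  using set_take_subset[of k w] by (auto simp: words_def)

lemma drop_words: "w \<in> words L n \<Longrightarrow> drop k w \<in> words L (n - k)"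
  using set_drop_subset[of k w] by (auto simp: words_def)

lemma sum_words_split:
  assumes "k \<le> n"
  shows "(\<Sum>w\<in>words L n. f w) = (\<Sum>t\<in>words L k. \<Sum>u\<in>words L (n - k). f (t @ u))"
proof -
  have "bij_betw (\<lambda>(t,u). t @ u) (words L k \<times> words L (n - k)) (words L n)"
  proof (rule bij_betwI[where g = "\<lambda>w. (take k w, drop k w)"])
    show "(\<lambda>(t,u). t @ u) \<in> words L k \<times> words L (n - k) \<rightarrow> words L n"
      using assms append_words[of _ L k _ "n - k"] by auto
    show "(\<lambda>w. (take k w, drop k w)) \<in> words L n \<rightarrow> words L k \<times> words L (n - k)"
      using assms by (auto intro: take_words drop_words)
  qed (auto simp: length_words)
  then have "(\<Sum>w\<in>words L n. f w) = (\<Sum>p\<in>words L k \<times> words L (n - k). f (case p of (t,u) \<Rightarrow> t @ u))"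
    by (rule sum.reindex_bij_betw[symmetric])
  also have "\<dots> = (\<Sum>t\<in>words L k. \<Sum>u\<in>words L (n - k). f (t @ u))"
    by (simp add: sum.cartesian_product case_prod_beta)
  finally show ?thesis .
qed

lemma pos_append: "pos L a (u @ v) = pos L a u + (1 / real L ^ length u) *\<^sub>R pos L a v"
  by (induction u) (simp_all add: scaleR_add_right algebra_simps)

text \<open>The system projected in one fixed direction; \<open>a_bound\<close> says that the
  intervals of radius \<open>1 / L\<close> about the \<open>a j\<close> lie in
  \<open>[-1, 1]\<close>.\<close>

locale line_ifs =
  fixes L :: nat and a :: "nat \<Rightarrow> real"
  assumes L: "2 \<le> L" and a_bound: "\<And>j. j \<in> {1..L} \<Longrightarrow> \<bar>a j\<bar> \<le> 1 - 1 / real L"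
begin

abbreviation "W \<equiv> words L"
abbreviation "x \<equiv> pos L a"

text \<open>Distance at most \<open>2 / L^n\<close> means that two closed intervals of radius
  \<open>1 / L^n\<close> meet.\<close>

definition overlap :: "nat list \<Rightarrow> nat" where
  "overlap w = card {v \<in> W (length w). \<bar>x v - x w\<bar> \<le> 2 / real L ^ length w}"

definition pairs :: "nat \<Rightarrow> nat" where
  "pairs n = (\<Sum>w\<in>W n. overlap w)"

lemma Lpos [simp]: "real L > 0" "L > 0" "real L \<noteq> 0" "L \<noteq> 0"
  using L by auto

lemma pos_bound: "w \<in> W n \<Longrightarrow> \<bar>x w\<bar> \<le> 1 - 1 / real L ^ n"
proof (induction n arbitrary: w)
  case (Suc n)
  then obtain j v where w: "w = j # v" and "j \<in> {1..L}" "v \<in> W n"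
    by (cases w) (auto simp: words_def)
  then have b: "\<bar>a j\<bar> \<le> 1 - 1 / real L" "\<bar>x v\<bar> \<le> 1 - 1 / real L ^ n"
    using a_bound Suc.IH by auto
  have "\<bar>x w\<bar> \<le> \<bar>a j\<bar> + \<bar>x v\<bar> / real L"
    unfolding w using abs_triangle_ineq[of "a j" "x v / real L"] by (simp add: abs_divide)
  also have "\<dots> \<le> (1 - 1 / real L) + (1 - 1 / real L ^ n) / real L"
    using b by (intro add_mono divide_right_mono) auto
  also have "\<dots> = 1 - 1 / real L ^ Suc n" by (simp add: field_simps)
  finally show ?case .
qed simp

lemma pos_take:
  assumes "w \<in> W n" "k \<le> n"
  shows "\<bar>x w - x (take k w)\<bar> \<le> 1 / real L ^ k - 1 / real L ^ n"
proof -
  have "x w = x (take k w) + x (drop k w) / real L ^ k"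
    using pos_append[of L a "take k w" "drop k w"] assms by (simp add: length_words)
  then have "\<bar>x w - x (take k w)\<bar> = \<bar>x (drop k w)\<bar> / real L ^ k" by (simp add: abs_divide)
  also have "\<dots> \<le> (1 - 1 / real L ^ (n - k)) / real L ^ k"
    using assms by (intro divide_right_mono pos_bound drop_words) auto
  also have "\<dots> = 1 / real L ^ k - 1 / (real L ^ (n - k) * real L ^ k)" by (simp add: diff_divide_distrib)
  also have "real L ^ (n - k) * real L ^ k = real L ^ n" using assms by (simp flip: power_add)
  finally show ?thesis .
qed

text \<open>Passing to prefixes moves each point by at most \<open>1 / L^k - 1 / L^n\<close>; the
  two moves and \<open>2 / L^n\<close> add up to exactly \<open>2 / L^k\<close>.\<close>

lemma near_take:
  assumes "w \<in> W n" "v \<in> W n" "k \<le> n" "\<bar>x v - x w\<bar> \<le> 2 / real L ^ n"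
  shows "\<bar>x (take k v) - x (take k w)\<bar> \<le> 2 / real L ^ k"
  using pos_take[OF assms(1,3)] pos_take[OF assms(2,3)] assms(4) by linarith

lemma overlap_Nil [simp]: "overlap [] = 1"
proof -
  have "{v. v = [] \<and> \<bar>x v\<bar> \<le> 2} = {[]}" by auto
  then show ?thesis by (simp add: overlap_def)
qed

text \<open>A neighbour of \<open>w\<close> is determined by its last letter and its prefix, which
  is a neighbour of the prefix of \<open>w\<close>. This bounds the multiplicity at a first passage
  above \<open>K\<close>.\<close>

lemma overlap_Suc_le:
  assumes "w \<in> W (Suc n)"
  shows "overlap w \<le> L * overlap (take n w)"
proof -
  let ?A = "{v \<in> W (Suc n). \<bar>x v - x w\<bar> \<le> 2 / real L ^ Suc n}"
  let ?B = "{v \<in> W n. \<bar>x v - x (take n w)\<bar> \<le> 2 / real L ^ n}"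
  have "inj_on (\<lambda>v. (take n v, v ! n)) ?A"
  proof (rule inj_onI)
    fix u v assume "u \<in> ?A" "v \<in> ?A" "(take n u, u ! n) = (take n v, v ! n)"
    moreover from this have "length u = Suc n" "length v = Suc n" by (auto simp: length_words)
    ultimately show "u = v" by (metis Pair_inject lessI order_refl take_Suc_conv_app_nth take_all)
  qed
  moreover have "(\<lambda>v. (take n v, v ! n)) ` ?A \<subseteq> ?B \<times> {1..L}"
  proof clarify
    fix v assume v: "v \<in> W (Suc n)" "\<bar>x v - x w\<bar> \<le> 2 / real L ^ Suc n"
    then have "v ! n \<in> set v" by (simp add: length_words)
    then have "v ! n \<in> {1..L}" using v(1) by (auto simp only: words_def)
    then show "take n v \<in> ?B \<and> v ! n \<in> {1..L}"
      using near_take[OF assms v(1) _ v(2), of n] v take_words[OF v(1), of n] by simp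
  qed
  ultimately have "card ?A \<le> card (?B \<times> {1..L})" by (intro card_inj_on_le) auto
  then show ?thesis
    using assms by (simp add: overlap_def length_words take_words[THEN length_words] mult.commute)
qed

lemma pairs_eq: "pairs n = card {(u,v) \<in> W n \<times> W n. \<bar>real L ^ n * x u - real L ^ n * x v\<bar> \<le> 2}"
proof -
  have "\<bar>real L ^ n * p - real L ^ n * q\<bar> \<le> 2 \<longleftrightarrow> \<bar>q - p\<bar> \<le> 2 / real L ^ n" for p q
  proof -
    have "\<bar>real L ^ n * p - real L ^ n * q\<bar> = real L ^ n * \<bar>q - p\<bar>"
      by (simp add: abs_mult abs_minus_commute flip: right_diff_distrib)
    then show ?thesis by (simp add: field_simps)
  qed
  then have "{(u,v) \<in> W n \<times> W n. \<bar>real L ^ n * x u - real L ^ n * x v\<bar> \<le> 2} =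
    (SIGMA u:W n. {v \<in> W n. \<bar>x v - x u\<bar> \<le> 2 / real L ^ n})" by auto
  then show ?thesis by (simp add: pairs_def overlap_def length_words)
qed

text \<open>Prefixing with \<open>t\<close> and \<open>v\<close> shifts all rescaled differences by
  one constant \<open>s\<close>, so the translation bound applies.\<close>

lemma cross_pairs_le:
  assumes "t \<in> W k" "v \<in> W k"
  shows "(\<Sum>u\<in>W n. card {u' \<in> W n. \<bar>x (v @ u') - x (t @ u)\<bar> \<le> 2 / real L ^ (k + n)}) \<le> 6 * pairs n"
proof -
  define s where "s = real L ^ (k + n) * (x t - x v)"
  have eq: "\<bar>x (v @ u') - x (t @ u)\<bar> \<le> 2 / real L ^ (k + n) \<longleftrightarrow>
    \<bar>real L ^ n * x u - real L ^ n * x u' + s\<bar> \<le> 2" for u u'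
  proof -
    have "real L ^ n * x u - real L ^ n * x u' + s = real L ^ (k + n) * (x (t @ u) - x (v @ u'))"
      using assms by (simp add: s_def pos_append length_words power_add field_simps)
    then have "\<bar>real L ^ n * x u - real L ^ n * x u' + s\<bar> = real L ^ (k + n) * \<bar>x (v @ u') - x (t @ u)\<bar>"
      by (simp add: abs_mult abs_minus_commute)
    then show ?thesis by (simp add: field_simps)
  qed
  have "(\<Sum>u\<in>W n. card {u' \<in> W n. \<bar>x (v @ u') - x (t @ u)\<bar> \<le> 2 / real L ^ (k + n)}) =
    card (SIGMA u:W n. {u' \<in> W n. \<bar>x (v @ u') - x (t @ u)\<bar> \<le> 2 / real L ^ (k + n)})"
    by simp
  also have "(SIGMA u:W n. {u' \<in> W n. \<bar>x (v @ u') - x (t @ u)\<bar> \<le> 2 / real L ^ (k + n)}) =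
    {(u,u') \<in> W n \<times> W n. \<bar>real L ^ n * x u - real L ^ n * x u' + s\<bar> \<le> 2}"
    unfolding eq by auto
  also have "card \<dots> \<le> 6 * pairs n"
    unfolding pairs_eq by (rule card_pairs_translate_le) simp
  finally show ?thesis .
qed

text \<open>A neighbour of \<open>t @ u\<close> has a prefix \<open>v\<close> close to
  \<open>t\<close>. For each of the \<open>overlap t\<close> choices of \<open>v\<close>, the close
  pairs of extensions are bounded uniformly in the relative position of \<open>v\<close> and
  \<open>t\<close>.\<close>

lemma sum_overlap_append_le:
  assumes t: "t \<in> W k"
  shows "(\<Sum>u\<in>W n. overlap (t @ u)) \<le> overlap t * (6 * pairs n)"
proof -
  let ?N = "{v \<in> W k. \<bar>x v - x t\<bar> \<le> 2 / real L ^ k}"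
  let ?c = "\<lambda>u v. card {u' \<in> W n. \<bar>x (v @ u') - x (t @ u)\<bar> \<le> 2 / real L ^ (k + n)}"
  have "overlap (t @ u) \<le> (\<Sum>v\<in>?N. ?c u v)" if u: "u \<in> W n" for u
  proof -
    have tu: "t @ u \<in> W (k + n)" by (rule append_words[OF t u])
    have "{w \<in> W (k + n). \<bar>x w - x (t @ u)\<bar> \<le> 2 / real L ^ (k + n)} \<subseteq>
      (\<Union>v\<in>?N. (@) v ` {u' \<in> W n. \<bar>x (v @ u') - x (t @ u)\<bar> \<le> 2 / real L ^ (k + n)})"
    proof
      fix w assume w: "w \<in> {w \<in> W (k + n). \<bar>x w - x (t @ u)\<bar> \<le> 2 / real L ^ (k + n)}"
      have "take k w \<in> ?N"
        using near_take[OF tu, of w k] w take_words[of w L "k + n" k] t by (auto simp: length_words)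
      moreover have "w = take k w @ drop k w" by simp
      moreover have "drop k w \<in> W n" using drop_words[of w L "k + n" k] w by simp
      ultimately show "w \<in> (\<Union>v\<in>?N. (@) v ` {u' \<in> W n. \<bar>x (v @ u') - x (t @ u)\<bar> \<le> 2 / real L ^ (k + n)})"
        using w by (intro UN_I[of "take k w"] image_eqI[of _ _ "drop k w"]) auto
    qed
    then have "overlap (t @ u) \<le> card (\<Union>v\<in>?N. (@) v ` {u' \<in> W n. \<bar>x (v @ u') - x (t @ u)\<bar> \<le> 2 / real L ^ (k + n)})"
      unfolding overlap_def length_words[OF tu] by (intro card_mono) auto
    also have "\<dots> \<le> (\<Sum>v\<in>?N. card ((@) v ` {u' \<in> W n. \<bar>x (v @ u') - x (t @ u)\<bar> \<le> 2 / real L ^ (k + n)}))"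
      by (rule card_UN_le) simp
    also have "\<dots> \<le> (\<Sum>v\<in>?N. ?c u v)" by (intro sum_mono card_image_le) simp
    finally show ?thesis .
  qed
  then have "(\<Sum>u\<in>W n. overlap (t @ u)) \<le> (\<Sum>u\<in>W n. \<Sum>v\<in>?N. ?c u v)" by (rule sum_mono)
  also have "\<dots> = (\<Sum>v\<in>?N. \<Sum>u\<in>W n. ?c u v)" by (rule sum.swap)
  also have "\<dots> \<le> (\<Sum>v\<in>?N. 6 * pairs n)" using t by (intro sum_mono cross_pairs_le) auto
  also have "\<dots> = overlap t * (6 * pairs n)" using t by (simp add: overlap_def length_words)
  finally show ?thesis .
qed

definition marked :: "real \<Rightarrow> nat \<Rightarrow> nat list set" where
  "marked K N = {w \<in> W N. \<exists>k\<le>N. K \<le> real (overlap (take k w))}"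

text \<open>Minimality of the length makes the extensions of different stopped words disjoint, so
  their proportions add up to at most that of \<open>marked\<close>.\<close>

definition stopped :: "real \<Rightarrow> nat \<Rightarrow> nat list set" where
  "stopped K k = {t \<in> W k. K \<le> real (overlap t) \<and> (\<forall>i<k. real (overlap (take i t)) < K)}"

lemma sum_stopped_le:
  "(\<Sum>k\<le>N. real (card (stopped K k)) * real L ^ (N - k)) \<le> real (card (marked K N))"
proof -
  let ?i = "\<lambda>b. if b then 1 else 0 :: real"
  have "real (card (stopped K k)) * real L ^ (N - k) = (\<Sum>w\<in>W N. ?i (take k w \<in> stopped K k))"
    if k: "k \<le> N" for k
  proof -
    have "(\<Sum>w\<in>W N. ?i (take k w \<in> stopped K k)) =
      (\<Sum>t\<in>W k. \<Sum>u\<in>W (N - k). ?i (take k (t @ u) \<in> stopped K k))"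
      by (rule sum_words_split[OF k])
    also have "\<dots> = (\<Sum>t\<in>W k. real L ^ (N - k) * ?i (t \<in> stopped K k))"
      by (intro sum.cong refl) (simp add: length_words card_words)
    also have "\<dots> = real L ^ (N - k) * (\<Sum>t\<in>W k. ?i (t \<in> stopped K k))"
      by (simp add: sum_distrib_left)
    also have "(\<Sum>t\<in>W k. ?i (t \<in> stopped K k)) = real (card (stopped K k))"
    proof -
      have "W k \<inter> {t. t \<in> stopped K k} = stopped K k" by (auto simp: stopped_def)
      then show ?thesis by (simp add: sum.If_cases)
    qed
    finally show ?thesis by simp
  qed
  then have "(\<Sum>k\<le>N. real (card (stopped K k)) * real L ^ (N - k)) =
    (\<Sum>k\<le>N. \<Sum>w\<in>W N. ?i (take k w \<in> stopped K k))" by simp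
  also have "\<dots> = (\<Sum>w\<in>W N. \<Sum>k\<le>N. ?i (take k w \<in> stopped K k))" by (rule sum.swap)
  also have "\<dots> \<le> (\<Sum>w\<in>W N. ?i (w \<in> marked K N))"
  proof (rule sum_mono)
    fix w assume w: "w \<in> W N"
    show "(\<Sum>k\<le>N. ?i (take k w \<in> stopped K k)) \<le> ?i (w \<in> marked K N)"
    proof (cases "\<exists>k\<le>N. take k w \<in> stopped K k")
      case True
      then obtain k where k: "k \<le> N" "take k w \<in> stopped K k" by blast
      have "take l w \<notin> stopped K l" if "l \<le> N" "l \<noteq> k" for l
      proof
        assume l: "take l w \<in> stopped K l"
        have "take i (take j w) = take i w" if "i < j" for i j using that by simp
        then show False
          using l k \<open>l \<noteq> k\<close> unfolding stopped_def
          by (metis (mono_tags, lifting) linorder_less_linear mem_Collect_eq not_le)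
      qed
      then have "(\<Sum>l\<le>N. ?i (take l w \<in> stopped K l)) = (\<Sum>l\<le>N. ?i (l = k))"
        using k by (intro sum.cong) auto
      also have "\<dots> = 1" using k by simp
      finally show ?thesis using k w by (auto simp: marked_def stopped_def)
    next
      case False
      then show ?thesis by (simp add: sum_nonneg)
    qed
  qed
  also have "\<dots> = real (card (marked K N))"
  proof -
    have "W N \<inter> {t. t \<in> marked K N} = marked K N" by (auto simp: marked_def)
    then show ?thesis by (simp add: sum.If_cases)
  qed
  finally show ?thesis .
qed

lemma ex_stopped:
  assumes "w \<in> W n" "K \<le> real (overlap w)"
  shows "\<exists>k\<le>n. take k w \<in> stopped K k"
proof -
  let ?P = "\<lambda>k. K \<le> real (overlap (take k w))"
  have P: "?P n" using assms by (simp add: length_words)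
  define k where "k = (LEAST k. ?P k)"
  have "?P k" "k \<le> n" using LeastI[of ?P, OF P] Least_le[of ?P, OF P] by (auto simp: k_def)
  moreover have "\<not> ?P i" if "i < k" for i using not_less_Least[of i ?P] that by (simp add: k_def)
  ultimately show ?thesis
    using take_words[OF assms(1), of k] by (intro exI[of _ k]) (auto simp: stopped_def not_le)
qed

text \<open>Words with multiplicity below \<open>K\<close> contribute at most \<open>K\<close> each.
  Any other word has a stopped prefix, whose multiplicity is at most \<open>L * K\<close> because
  one generation earlier it was below \<open>K\<close>; the extensions are counted by the induction
  hypothesis for the remaining length. The hypothesis on \<open>marked\<close> makes stopped words
  so rare that this part is again at most \<open>K * L ^ n\<close>.\<close>

theorem pairs_le_of_marked_le:
  assumes K: "1 < K" and m: "12 * real L * K * real (card (marked K N)) \<le> real L ^ N"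
  shows "n \<le> N \<Longrightarrow> real (pairs n) \<le> 2 * K * real L ^ n"
proof (induction n rule: less_induct)
  case (less n)
  let ?i = "\<lambda>b. if b then 1 else 0 :: real"
  \<comment> \<open>The empty word has multiplicity \<open>1 < K\<close>; hence
    \<open>k \<ge> 1\<close> below, and the induction hypothesis applies to
    \<open>n - k < n\<close>.\<close>
  have s0: "stopped K 0 = {}" using K by (auto simp: stopped_def)
  have "real (overlap w) \<le> K + (\<Sum>k\<in>{1..n}. ?i (take k w \<in> stopped K k) * real (overlap w))" if w: "w \<in> W n" for w
  proof (cases "K \<le> real (overlap w)")
    case True
    then obtain k where k: "k \<le> n" "take k w \<in> stopped K k" using ex_stopped w by blast
    then have "k \<noteq> 0" using s0 by (metis empty_iff)
    then have "?i (take k w \<in> stopped K k) * real (overlap w) \<le> (\<Sum>k\<in>{1..n}. ?i (take k w \<in> stopped K k) * real (overlap w))"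
      using k by (intro member_le_sum) auto
    then show ?thesis using k K by simp
  next
    case False
    moreover have "0 \<le> (\<Sum>k\<in>{1..n}. ?i (take k w \<in> stopped K k) * real (overlap w))" by (simp add: sum_nonneg)
    ultimately show ?thesis by simp
  qed
  then have "real (pairs n) \<le> (\<Sum>w\<in>W n. K + (\<Sum>k\<in>{1..n}. ?i (take k w \<in> stopped K k) * real (overlap w)))"
    unfolding pairs_def of_nat_sum by (rule sum_mono)
  also have "\<dots> = K * real L ^ n + (\<Sum>k\<in>{1..n}. \<Sum>w\<in>W n. ?i (take k w \<in> stopped K k) * real (overlap w))"
    by (simp add: sum.distrib card_words sum.swap[of _ _ "W n"])
  also have "(\<Sum>k\<in>{1..n}. \<Sum>w\<in>W n. ?i (take k w \<in> stopped K k) * real (overlap w)) \<le>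
    (\<Sum>k\<in>{1..n}. real (card (stopped K k)) * (12 * real L * K\<^sup>2 * real L ^ (n - k)))"
  proof (rule sum_mono)
    fix k assume k: "k \<in> {1..n}"
    have "(\<Sum>w\<in>W n. ?i (take k w \<in> stopped K k) * real (overlap w)) =
      (\<Sum>t\<in>W k. \<Sum>u\<in>W (n - k). ?i (take k (t @ u) \<in> stopped K k) * real (overlap (t @ u)))"
      using k by (intro sum_words_split) auto
    also have "\<dots> = (\<Sum>t\<in>W k. if t \<in> stopped K k then real (\<Sum>u\<in>W (n - k). overlap (t @ u)) else 0)"
      by (intro sum.cong refl) (simp add: length_words)
    also have "\<dots> = (\<Sum>t\<in>stopped K k. real (\<Sum>u\<in>W (n - k). overlap (t @ u)))"
    proof -
      have "W k \<inter> {t. t \<in> stopped K k} = stopped K k" by (auto simp: stopped_def)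
      then show ?thesis by (simp add: sum.If_cases)
    qed
    also have "\<dots> \<le> (\<Sum>t\<in>stopped K k. 12 * real L * K\<^sup>2 * real L ^ (n - k))"
    proof (rule sum_mono)
      fix t assume t: "t \<in> stopped K k"
      then have tW: "t \<in> W k" by (simp add: stopped_def)
      obtain k' where k': "k = Suc k'" using k by (cases k) auto
      have "real (overlap (take k' t)) \<le> K" using t k' by (auto simp: stopped_def intro: less_imp_le)
      then have "real L * real (overlap (take k' t)) \<le> real L * K" by simp
      moreover have "real (overlap t) \<le> real L * real (overlap (take k' t))"
        using overlap_Suc_le[of t k'] tW k' by (metis of_nat_le_iff of_nat_mult)
      ultimately have mt: "real (overlap t) \<le> real L * K" by linarith
      have IH: "real (pairs (n - k)) \<le> 2 * K * real L ^ (n - k)" using less k by auto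
      have "real (\<Sum>u\<in>W (n - k). overlap (t @ u)) \<le> real (overlap t * (6 * pairs (n - k)))"
        by (intro of_nat_mono sum_overlap_append_le[OF tW])
      also have "\<dots> = real (overlap t) * (6 * real (pairs (n - k)))" by simp
      also have "\<dots> \<le> (real L * K) * (6 * (2 * K * real L ^ (n - k)))"
        using mt IH K by (intro mult_mono) auto
      finally show "real (\<Sum>u\<in>W (n - k). overlap (t @ u)) \<le> 12 * real L * K\<^sup>2 * real L ^ (n - k)"
        by (simp add: power2_eq_square mult_ac)
    qed
    finally show "(\<Sum>w\<in>W n. ?i (take k w \<in> stopped K k) * real (overlap w)) \<le>
      real (card (stopped K k)) * (12 * real L * K\<^sup>2 * real L ^ (n - k))" by simp
  qed
  also have "(\<Sum>k\<in>{1..n}. real (card (stopped K k)) * (12 * real L * K\<^sup>2 * real L ^ (n - k))) \<le>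
    K * real L ^ n"
  proof -
    have "(\<Sum>k\<in>{1..n}. real (card (stopped K k)) * (12 * real L * K\<^sup>2 * real L ^ (n - k))) * real L ^ (N - n)
      = 12 * real L * K\<^sup>2 * (\<Sum>k\<in>{1..n}. real (card (stopped K k)) * real L ^ (N - k))"
      unfolding sum_distrib_right sum_distrib_left
    proof (intro sum.cong refl)
      fix k assume "k \<in> {1..n}"
      then have "real L ^ (N - k) = real L ^ (n - k) * real L ^ (N - n)"
        using less.prems by (simp flip: power_add)
      then show "real (card (stopped K k)) * (12 * real L * K\<^sup>2 * real L ^ (n - k)) * real L ^ (N - n) =
        12 * real L * K\<^sup>2 * (real (card (stopped K k)) * real L ^ (N - k))" by simp
    qed
    also have "(\<Sum>k\<in>{1..n}. real (card (stopped K k)) * real L ^ (N - k)) \<le>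
      (\<Sum>k\<le>N. real (card (stopped K k)) * real L ^ (N - k))"
      using less.prems by (intro sum_mono2) auto
    also note sum_stopped_le
    also have "12 * real L * K\<^sup>2 * real (card (marked K N)) \<le> K * real L ^ N"
      using mult_left_mono[OF m, of K] K by (simp add: power2_eq_square mult_ac)
    also have "\<dots> = (K * real L ^ n) * real L ^ (N - n)" using less.prems by (simp flip: power_add)
    finally show ?thesis using K by (simp add: mult_left_mono)
  qed
  finally show ?case by simp
qed

end

section \<open>Shrinking of the projection caused by overlaps\<close>

text \<open>A Vitali selection: short words, which stand for long intervals, are taken first, and
  everything in conflict with a chosen word is discarded.\<close>

lemma greedy_selection:
  fixes len :: "'t \<Rightarrow> nat"
  assumes "finite T" and sym: "\<And>s t. R s t \<Longrightarrow> R t s" and refl: "\<And>t. R t t"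
  shows "\<exists>S\<subseteq>T. (\<forall>s\<in>S. \<forall>t\<in>S. s \<noteq> t \<longrightarrow> \<not> R s t) \<and> (\<forall>t\<in>T. \<exists>s\<in>S. len s \<le> len t \<and> R t s)"
  using assms(1)
proof (induction T rule: finite_psubset_induct)
  case (psubset T)
  show ?case
  proof (cases "T = {}")
    case False
    then obtain t0 where t0: "t0 \<in> T" "\<And>t. t \<in> T \<Longrightarrow> len t0 \<le> len t"
      using ex_has_least_nat[of "\<lambda>t. t \<in> T" _ len] by blast
    define T' where "T' = {t \<in> T. \<not> R t t0}"
    have "T' \<subset> T" using t0(1) refl by (auto simp: T'_def)
    then obtain S where S: "S \<subseteq> T'" "\<forall>s\<in>S. \<forall>t\<in>S. s \<noteq> t \<longrightarrow> \<not> R s t"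
      "\<forall>t\<in>T'. \<exists>s\<in>S. len s \<le> len t \<and> R t s"
      using psubset.IH[OF \<open>T' \<subset> T\<close>] by (elim exE conjE) (rule that)
    have "insert t0 S \<subseteq> T" using S t0 by (auto simp: T'_def)
    moreover have "\<forall>s\<in>insert t0 S. \<forall>t\<in>insert t0 S. s \<noteq> t \<longrightarrow> \<not> R s t"
      using S sym by (auto simp: T'_def)
    moreover have "\<forall>t\<in>T. \<exists>s\<in>insert t0 S. len s \<le> len t \<and> R t s"
      using S(3) t0(2) by (auto simp: T'_def)
    ultimately show ?thesis by (intro exI[of _ "insert t0 S"] conjI)
  qed auto
qed

context line_ifs
begin

definition shadow :: "nat \<Rightarrow> real set" where
  "shadow n = (\<Union>w\<in>W n. {x w - 1 / real L ^ n..x w + 1 / real L ^ n})"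

abbreviation "shadow_length n \<equiv> measure lebesgue (shadow n)"

lemma shadow_lmeasurable [simp]: "shadow n \<in> lmeasurable"
  unfolding shadow_def by (intro lmeasurable_compact compact_UN) auto

lemma shadow_subset: "shadow n \<subseteq> {-1..1}"
proof
  fix y assume "y \<in> shadow n"
  then obtain w where "w \<in> W n" "x w - 1 / real L ^ n \<le> y" "y \<le> x w + 1 / real L ^ n"
    by (auto simp: shadow_def)
  with pos_bound[of w n] show "y \<in> {-1..1}" by (auto simp: abs_le_iff)
qed

lemma shadow_length_le_2: "shadow_length n \<le> 2"
proof -
  have "shadow_length n \<le> measure lebesgue {-1..1::real}"
    by (intro measure_mono_fmeasurable shadow_subset fmeasurableD shadow_lmeasurable) auto
  then show ?thesis by simp
qed

lemma shadow_add:
  "shadow (N + n) = (\<Union>w\<in>W N. (\<lambda>y. (1 / real L ^ N) *\<^sub>R y + x w) ` shadow n)"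
proof -
  have im: "(\<lambda>y. (1 / real L ^ N) *\<^sub>R y + x w) ` {x v - 1 / real L ^ n..x v + 1 / real L ^ n} =
    {x (w @ v) - 1 / real L ^ (N + n)..x (w @ v) + 1 / real L ^ (N + n)}" if "w \<in> W N" for w v
  proof -
    have "(\<lambda>y. (1 / real L ^ N) *\<^sub>R y + x w) ` {x v - 1 / real L ^ n..x v + 1 / real L ^ n} =
      (\<lambda>y. (1 / real L ^ N) * y + x w) ` {x v - 1 / real L ^ n..x v + 1 / real L ^ n}" by simp
    also have "\<dots> = {(1 / real L ^ N) * (x v - 1 / real L ^ n) + x w..(1 / real L ^ N) * (x v + 1 / real L ^ n) + x w}"
      by (subst image_affinity_atLeastAtMost) auto
    finally show ?thesis
      using that by (simp add: pos_append length_words power_add algebra_simps add_divide_distrib diff_divide_distrib)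
  qed
  have W: "W (N + n) = (\<Union>w\<in>W N. (@) w ` W n)"
  proof (intro equalityI subsetI)
    fix w assume "w \<in> W (N + n)"
    then have "take N w \<in> W N" "drop N w \<in> W n" "w = take N w @ drop N w"
      using take_words[of w L "N + n" N] drop_words[of w L "N + n" N] by auto
    then show "w \<in> (\<Union>w\<in>W N. (@) w ` W n)" by blast
  qed (auto intro: append_words)
  show ?thesis
    unfolding shadow_def W image_UN using im by auto
qed

lemma measure_shadow_image:
  "measure lebesgue ((\<lambda>y. (1 / real L ^ N) *\<^sub>R y + x w) ` shadow n) = shadow_length n / real L ^ N"
  using measure_lebesgue_affine[of "1 / real L ^ N" "x w" "shadow n"] by simp

lemma shadow_image_lmeasurable:
  "(\<lambda>y. (1 / real L ^ N) *\<^sub>R y + x w) ` shadow n \<in> lmeasurable"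
  unfolding shadow_def
  by (intro lmeasurable_compact compact_continuous_image continuous_intros compact_UN) auto

text \<open>Every selected word \<open>s\<close> has at least \<open>K\<close> neighbours of the same length, all of whose
  descendants project into an interval of length \<open>O(L^{-|s|})\<close>: there the projection wastes
  a factor \<open>K\<close>.\<close>

lemma shadow_length_step:
  assumes K: "1 < K"
  shows "\<exists>\<mu>. real (card (marked K N)) / real L ^ N \<le> \<mu> \<and> \<mu> \<le> 1 \<and>
    (\<forall>n. shadow_length (N + n) \<le> 16 * \<mu> / K + (1 - \<mu>) * shadow_length n)"
proof -
  define T where "T = {t \<in> (\<Union>k\<le>N. W k). K \<le> real (overlap t)}"
  \<comment> \<open>Conflict means that the intervals of radius \<open>3 / L^length\<close> meet.
    All points \<open>x w\<close> with \<open>w\<close> in the family \<open>V s\<close> below lie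
    within this radius of \<open>x s\<close>, so families of words without conflict are
    disjoint.\<close>
  define R where "R s t \<longleftrightarrow> \<bar>x s - x t\<bar> \<le> 3 / real L ^ length s + 3 / real L ^ length t" for s t
  have "finite T" by (simp add: T_def)
  moreover have "R s t \<Longrightarrow> R t s" for s t by (simp add: R_def abs_minus_commute)
  moreover have "R t t" for t by (simp add: R_def)
  ultimately obtain S where S: "S \<subseteq> T" "\<And>s t. s \<in> S \<Longrightarrow> t \<in> S \<Longrightarrow> s \<noteq> t \<Longrightarrow> \<not> R s t"
    "\<And>t. t \<in> T \<Longrightarrow> \<exists>s\<in>S. length s \<le> length t \<and> R t s"
    using greedy_selection[of T R length] by metis
  have finS: "finite S" using S(1) \<open>finite T\<close> by (rule finite_subset)
  have SW: "s \<in> W (length s)" "length s \<le> N" "K \<le> real (overlap s)" if "s \<in> S" for s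
    using that S(1) by (auto simp: T_def length_words)
  \<comment> \<open>Put \<open>p = 1 / L^k\<close> and \<open>q = 1 / L^l\<close>. A marked prefix
    of length \<open>k\<close> conflicts with a selected \<open>s\<close> of length
    \<open>l \<le> k\<close>, so its own prefix of length \<open>l\<close> is within
    \<open>3 * p + 3 * q + (q - p) \<le> 7 * q\<close> of \<open>x s\<close>. The radius
    \<open>8\<close> in \<open>U\<close> leaves room for the descendants.\<close>
  define M where "M = {w \<in> W N. \<exists>s\<in>S. \<bar>x (take (length s) w) - x s\<bar> \<le> 7 / real L ^ length s}"
  define U where "U = (\<Union>s\<in>S. {x s - 8 / real L ^ length s..x s + 8 / real L ^ length s})"
  define \<mu> where "\<mu> = real (card M) / real L ^ N"
  have MW: "M \<subseteq> W N" by (auto simp: M_def)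
  have finM: "finite M" by (rule finite_subset[OF MW]) simp
  have "marked K N \<subseteq> M"
  proof
    fix w assume "w \<in> marked K N"
    then obtain k where k: "k \<le> N" "K \<le> real (overlap (take k w))" and w: "w \<in> W N"
      by (auto simp: marked_def)
    have tk: "take k w \<in> W k" by (rule take_words[OF w k(1)])
    then have "take k w \<in> T" using k by (auto simp: T_def)
    then obtain s where s: "s \<in> S" "length s \<le> length (take k w)" "R (take k w) s" using S(3) by blast
    have lk: "length (take k w) = k" using tk by (rule length_words)
    define l where "l = length s"
    have l: "l \<le> k" using s lk by (simp add: l_def)
    define p q where "p = 1 / real L ^ k" and "q = 1 / real L ^ l"
    have "\<bar>x (take k w) - x (take l (take k w))\<bar> \<le> q - p"
      unfolding p_def q_def by (rule pos_take[OF tk l])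
    then have "\<bar>x (take k w) - x (take l w)\<bar> \<le> q - p" using l by simp
    moreover have "\<bar>x (take k w) - x s\<bar> \<le> 3 * p + 3 * q"
      using s(3) lk by (simp add: R_def l_def p_def q_def)
    moreover have "p \<le> q" "0 \<le> p"
      unfolding p_def q_def using l L by (auto intro!: divide_left_mono power_increasing)
    ultimately have "\<bar>x (take l w) - x s\<bar> \<le> 7 * q" by linarith
    then have "\<bar>x (take l w) - x s\<bar> \<le> 7 / real L ^ l" by (simp add: q_def)
    then show "w \<in> M" using w s(1) by (auto simp: M_def l_def)
  qed
  then have m1: "real (card (marked K N)) / real L ^ N \<le> \<mu>"
    unfolding \<mu>_def by (intro divide_right_mono of_nat_mono card_mono finM) auto
  have "real (card M) \<le> real (card (W N))" using MW by (intro of_nat_mono card_mono) auto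
  then have m2: "\<mu> \<le> 1" unfolding \<mu>_def by (simp add: card_words)
  define V where "V s = {w \<in> W N. \<bar>x (take (length s) w) - x s\<bar> \<le> 2 / real L ^ length s}" for s
  have cardV: "K * real L ^ (N - length s) \<le> real (card (V s))" if s: "s \<in> S" for s
  proof -
    let ?B = "{v \<in> W (length s). \<bar>x v - x s\<bar> \<le> 2 / real L ^ length s}"
    have "inj_on (\<lambda>(v,u). v @ u) (?B \<times> W (N - length s))"
      by (rule inj_onI) (auto simp: length_words)
    moreover have "(\<lambda>(v,u). v @ u) ` (?B \<times> W (N - length s)) \<subseteq> V s"
      using SW(2)[OF s] append_words[of _ L "length s" _ "N - length s"]
      by (auto simp: V_def length_words)
    moreover have "finite (V s)" by (simp add: V_def)
    ultimately have "card (?B \<times> W (N - length s)) \<le> card (V s)" by (rule card_inj_on_le)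
    then have "real (card ?B) * real L ^ (N - length s) \<le> real (card (V s))"
      by (simp add: card_cartesian_product card_words flip: of_nat_mult of_nat_power)
    moreover have "K * real L ^ (N - length s) \<le> real (card ?B) * real L ^ (N - length s)"
      using SW(3)[OF s] by (intro mult_right_mono) (auto simp: overlap_def)
    ultimately show ?thesis by linarith
  qed
  have disj: "V s \<inter> V t = {}" if st: "s \<in> S" "t \<in> S" "s \<noteq> t" for s t
  proof (rule ccontr)
    assume "V s \<inter> V t \<noteq> {}"
    then obtain w where w: "w \<in> V s" "w \<in> V t" by auto
    have near: "\<bar>x w - x r\<bar> \<le> 3 / real L ^ length r" if "w \<in> V r" "length r \<le> N" for r
    proof -
      have "\<bar>x w - x (take (length r) w)\<bar> \<le> 1 / real L ^ length r - 1 / real L ^ N"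
        using that by (intro pos_take) (auto simp: V_def)
      moreover have "\<bar>x (take (length r) w) - x r\<bar> \<le> 2 / real L ^ length r" using that by (simp add: V_def)
      moreover have "3 / real L ^ length r = 1 / real L ^ length r + 2 / real L ^ length r" by (simp flip: add_divide_distrib)
      moreover have "0 \<le> 1 / real L ^ N" by simp
      ultimately show ?thesis by linarith
    qed
    have "\<bar>x w - x s\<bar> \<le> 3 / real L ^ length s" "\<bar>x w - x t\<bar> \<le> 3 / real L ^ length t"
      using near w SW st by auto
    then have "R s t" unfolding R_def by linarith
    then show False using S(2) st by blast
  qed
  have VM: "V s \<subseteq> M" if "s \<in> S" for s
  proof
    fix w assume "w \<in> V s"
    moreover have "2 / real L ^ length s \<le> 7 / real L ^ length s" by (intro divide_right_mono) auto
    ultimately show "w \<in> M" using that by (force simp: V_def M_def)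
  qed
  \<comment> \<open>Each of the disjoint families \<open>V s\<close> holds at least a proportion
    \<open>K / L^length s\<close> of the words of length \<open>N\<close>. So the selected intervals
    have total length at most \<open>O(\<mu> / K)\<close>.\<close>
  have "K * (\<Sum>s\<in>S. real L ^ (N - length s)) \<le> (\<Sum>s\<in>S. real (card (V s)))"
    unfolding sum_distrib_left by (intro sum_mono cardV)
  also have "\<dots> = real (card (\<Union>s\<in>S. V s))"
    using finS disj by (subst card_UN_disjoint) (auto simp: V_def)
  also have "\<dots> \<le> real (card M)" using VM finM by (intro of_nat_mono card_mono) auto
  finally have KM: "K * (\<Sum>s\<in>S. real L ^ (N - length s)) \<le> real (card M)" .
  have Ulm: "U \<in> lmeasurable" unfolding U_def using finS by (intro lmeasurable_compact compact_UN) auto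
  have "measure lebesgue U \<le> (\<Sum>s\<in>S. measure lebesgue {x s - 8 / real L ^ length s..x s + 8 / real L ^ length s})"
    unfolding U_def by (rule measure_UNION_le[OF finS]) auto
  also have "\<dots> = (\<Sum>s\<in>S. 16 / real L ^ length s)" by (intro sum.cong refl) simp
  also have "\<dots> = 16 * (\<Sum>s\<in>S. real L ^ (N - length s)) / real L ^ N"
    unfolding sum_distrib_left sum_divide_distrib
    by (intro sum.cong refl) (simp add: SW(2) power_diff)
  also have "\<dots> \<le> 16 * (real (card M) / K) / real L ^ N"
    using KM K by (intro divide_right_mono mult_left_mono) (simp_all add: pos_le_divide_eq mult.commute)
  also have "\<dots> = 16 * \<mu> / K" by (simp add: \<mu>_def)
  finally have Um: "measure lebesgue U \<le> 16 * \<mu> / K" .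
  have step: "shadow_length (N + n) \<le> 16 * \<mu> / K + (1 - \<mu>) * shadow_length n" for n
  proof -
    let ?I = "\<lambda>w. (\<lambda>y. (1 / real L ^ N) *\<^sub>R y + x w) ` shadow n"
    have "?I w \<subseteq> U" if wM: "w \<in> M" for w
    proof
      fix z assume z: "z \<in> ?I w"
      obtain s where s: "s \<in> S" "\<bar>x (take (length s) w) - x s\<bar> \<le> 7 / real L ^ length s" and w: "w \<in> W N"
        using wM by (auto simp: M_def)
      obtain y where y: "z = (1 / real L ^ N) *\<^sub>R y + x w" "\<bar>y\<bar> \<le> 1"
        using z shadow_subset[of n] by (auto simp: abs_le_iff)
      have "\<bar>z - x w\<bar> = \<bar>y\<bar> / real L ^ N" using y(1) by (simp add: abs_divide)
      also have "\<dots> \<le> 1 / real L ^ N" using y(2) by (intro divide_right_mono) auto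
      finally have "\<bar>z - x w\<bar> \<le> 1 / real L ^ N" .
      moreover have "\<bar>x w - x (take (length s) w)\<bar> \<le> 1 / real L ^ length s - 1 / real L ^ N"
        using w SW(2)[OF s(1)] by (rule pos_take)
      moreover have "8 / real L ^ length s = 1 / real L ^ length s + 7 / real L ^ length s" by (simp flip: add_divide_distrib)
      ultimately have "\<bar>z - x s\<bar> \<le> 8 / real L ^ length s" using s(2) by linarith
      then show "z \<in> U" using s(1) by (auto simp: U_def abs_le_iff intro!: bexI[of _ s])
    qed
    then have sub: "shadow (N + n) \<subseteq> U \<union> (\<Union>w\<in>W N - M. ?I w)"
      unfolding shadow_add by blast
    have lm: "(\<Union>w\<in>W N - M. ?I w) \<in> lmeasurable"
      by (intro fmeasurable.finite_UN) (simp_all add: shadow_image_lmeasurable del: real_scaleR_def)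
    have "shadow_length (N + n) \<le> measure lebesgue (U \<union> (\<Union>w\<in>W N - M. ?I w))"
      using sub Ulm lm by (intro measure_mono_fmeasurable fmeasurable.Un) (auto intro: fmeasurableD)
    also have "\<dots> \<le> measure lebesgue U + measure lebesgue (\<Union>w\<in>W N - M. ?I w)"
      using Ulm lm by (intro measure_Un_le) (auto intro: fmeasurableD)
    also have "measure lebesgue (\<Union>w\<in>W N - M. ?I w) \<le> (\<Sum>w\<in>W N - M. measure lebesgue (?I w))"
      by (rule measure_UNION_le) (simp_all add: fmeasurableD shadow_image_lmeasurable del: real_scaleR_def)
    also have "\<dots> = real (card (W N - M)) * (shadow_length n / real L ^ N)"
      by (simp add: measure_shadow_image del: real_scaleR_def)
    also have "real (card (W N - M)) = real L ^ N - real (card M)"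
      using MW finM card_mono[of "W N" M] by (simp add: card_Diff_subset card_words of_nat_diff)
    also have "(real L ^ N - real (card M)) * (shadow_length n / real L ^ N) = (1 - \<mu>) * shadow_length n"
      by (simp add: \<mu>_def field_simps)
    finally show ?thesis using Um by simp
  qed
  show ?thesis using m1 m2 step by blast
qed

text \<open>Each of \<open>M\<close> rounds averages the length with the value
  \<open>16 / K\<close>, so the excess, at first at most \<open>2\<close>, decays by \<open>(1 -
  \<mu>) ^ M \<le> exp (- \<mu> * M) \<le> exp (- K) \<le> 1 / K\<close>. Together this gives
  \<open>16 + 2 = 18\<close>.\<close>

theorem shadow_length_le_of_marked_ge:
  assumes K: "1 < K" and m: "real L ^ N \<le> 12 * real L * K * real (card (marked K N))"
    and M: "12 * real L * K\<^sup>2 \<le> real M"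
  shows "shadow_length (N * M) \<le> 18 / K"
proof -
  obtain \<mu> where \<mu>: "real (card (marked K N)) / real L ^ N \<le> \<mu>" "\<mu> \<le> 1"
    "\<And>n. shadow_length (N + n) \<le> 16 * \<mu> / K + (1 - \<mu>) * shadow_length n"
    using shadow_length_step[OF K, of N] by blast
  have "1 / (12 * real L * K) \<le> real (card (marked K N)) / real L ^ N"
    using m K by (simp add: field_simps)
  then have \<mu>_ge: "1 / (12 * real L * K) \<le> \<mu>" using \<mu>(1) by linarith
  have "shadow_length (N * i) \<le> 16 / K + 2 * (1 - \<mu>) ^ i" for i
  proof (induction i)
    case 0
    have "0 \<le> 16 / K" using K by simp
    then show ?case using shadow_length_le_2[of 0] unfolding mult_0_right power_0 by linarith
  next
    case (Suc i)
    have "shadow_length (N * Suc i) \<le> 16 * \<mu> / K + (1 - \<mu>) * shadow_length (N * i)"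
      using \<mu>(3)[of "N * i"] by simp
    also have "\<dots> \<le> 16 * \<mu> / K + (1 - \<mu>) * (16 / K + 2 * (1 - \<mu>) ^ i)"
      using Suc \<mu>(2) by (intro add_left_mono mult_left_mono) auto
    also have "\<dots> = 16 / K + 2 * (1 - \<mu>) ^ Suc i"
    proof -
      have "16 * \<mu> / K = \<mu> * (16 / K)" by simp
      moreover have "\<mu> * k + (1 - \<mu>) * (k + 2 * c) = k + 2 * ((1 - \<mu>) * c)" for k c
        by (simp add: algebra_simps)
      ultimately show ?thesis by (simp only: power_Suc)
    qed
    finally show ?case .
  qed
  from this[of M] have "shadow_length (N * M) \<le> 16 / K + 2 * (1 - \<mu>) ^ M" .
  also have "(1 - \<mu>) ^ M \<le> exp (- \<mu>) ^ M"
    using \<mu>(2) exp_ge_add_one_self[of "- \<mu>"] by (intro power_mono) auto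
  also have "\<dots> = exp (- (real M * \<mu>))" by (simp flip: exp_of_nat_mult)
  also have "\<dots> \<le> exp (- K)"
  proof -
    have "K = (12 * real L * K\<^sup>2) * (1 / (12 * real L * K))" using K by (simp add: power2_eq_square)
    also have "\<dots> \<le> real M * \<mu>" using M \<mu>_ge K by (intro mult_mono) auto
    finally show ?thesis by simp
  qed
  also have "\<dots> \<le> 1 / K"
  proof -
    have "K \<le> exp K" using exp_ge_add_one_self[of K] by linarith
    then show ?thesis using K by (simp add: exp_minus field_simps)
  qed
  finally show ?thesis by simp
qed

end

section \<open>The Fourier transform on one scale\<close>

lemma integral_stretch_continuous:
  fixes g :: "real \<Rightarrow> real"
  assumes "\<And>S. continuous_on S g" "m > 0" "p \<le> q"
  shows "integral {p..q} (\<lambda>y. g (m * y)) = integral {m * p..m * q} g / m"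
proof -
  have "(g has_integral integral {m * p..m * q} g) {m * p..m * q}"
    by (intro integrable_integral integrable_continuous_interval assms)
  from has_integral_stretch_real[OF this, of m] assms(2)
  have "((\<lambda>y. g (m * y)) has_integral integral {m * p..m * q} g / m) ((\<lambda>y. y / m) ` {m * p..m * q})"
    by simp
  also have "(\<lambda>y. y / m) ` {m * p..m * q} = {p..q}"
    using image_divide_atLeastAtMost[OF assms(2), of "m * p" "m * q"] assms(2) by simp
  finally show ?thesis by (rule integral_unique)
qed

lemma integral_consecutive:
  fixes f :: "real \<Rightarrow> real" and p :: "nat \<Rightarrow> real"
  assumes "\<And>S. continuous_on S f" "\<And>i. p i \<le> p (Suc i)"
  shows "(\<Sum>i<n. integral {p i..p (Suc i)} f) = integral {p 0..p n} f"
proof (induction n)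
  case (Suc n)
  have "p 0 \<le> p n" using assms(2) by (simp add: lift_Suc_mono_le)
  then have "integral {p 0..p n} f + integral {p n..p (Suc n)} f = integral {p 0..p (Suc n)} f"
    by (intro Henstock_Kurzweil_Integration.integral_combine integrable_continuous_interval assms)
  with Suc show ?case by simp
qed simp

context line_ifs
begin

text \<open>The characteristic function of the uniform distribution on the projected centres
  \<open>a j\<close>.\<close>

definition phi :: "real \<Rightarrow> complex" where
  "phi t = expsum {1..L} (\<lambda>_. 1 / of_nat L) a t"

definition Phi :: "nat \<Rightarrow> real \<Rightarrow> complex" where
  "Phi n y = (\<Prod>i=1..n. phi (real L ^ i * y))"

lemma continuous_on_phi [continuous_intros]:
  "continuous_on S f \<Longrightarrow> continuous_on S (\<lambda>y. phi (f y))"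
  unfolding phi_def expsum_def by (intro continuous_intros)

lemma continuous_on_Phi [continuous_intros]:
  "continuous_on S f \<Longrightarrow> continuous_on S (\<lambda>y. Phi n (f y))"
  unfolding Phi_def by (intro continuous_intros)

lemma Phi_0 [simp]: "Phi 0 y = 1"
  by (simp add: Phi_def)

lemma Phi_add: "Phi (l + n) y = Phi l y * Phi n (real L ^ l * y)"
  by (induction n) (simp_all add: Phi_def power_add mult_ac)

lemma abs_a_le_1: "j \<in> {1..L} \<Longrightarrow> \<bar>a j\<bar> \<le> 1"
  using a_bound[of j] by (smt (verit) Lpos(1) divide_nonneg_pos)

lemma phi_0: "phi 0 = 1"
  by (simp add: phi_def expsum_def)

lemma norm_phi_le_1: "norm (phi t) \<le> 1"
proof -
  have "norm (phi t) \<le> (\<Sum>j\<in>{1..L}. norm (1 / of_nat L * cis (a j * t)))"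
    unfolding phi_def expsum_def by (rule norm_sum)
  also have "\<dots> = 1" by (simp add: norm_divide)
  finally show ?thesis .
qed

lemma norm_phi_ge: "1 - t\<^sup>2 / 2 \<le> norm (phi t)"
proof -
  have "1 - t\<^sup>2 / 2 = (\<Sum>j\<in>{1..L}. (1 - t\<^sup>2 / 2) / real L)" by simp
  also have "\<dots> \<le> (\<Sum>j\<in>{1..L}. cos (a j * t) / real L)"
  proof (intro sum_mono divide_right_mono)
    fix j assume "j \<in> {1..L}"
    then have "(a j)\<^sup>2 \<le> 1" using abs_a_le_1 by (simp add: abs_square_le_1)
    then have "(a j)\<^sup>2 * t\<^sup>2 \<le> 1 * t\<^sup>2" by (rule mult_right_mono) simp
    then show "1 - t\<^sup>2 / 2 \<le> cos (a j * t)"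
      using cos_ge_quadratic[of "a j * t"] by (simp add: power_mult_distrib)
  qed simp
  also have "\<dots> = Re (phi t)"
  proof -
    have "phi t = (\<Sum>j\<in>{1..L}. complex_of_real (1 / real L) * cis (a j * t))"
      by (simp add: phi_def expsum_def)
    then show ?thesis by (simp only: Re_sum Re_complex_of_real mult.commute Re_complex_div_eq_0) simp
  qed
  also have "\<dots> \<le> norm (phi t)" by (rule complex_Re_le_cmod)
  finally show ?thesis .
qed

text \<open>The constant \<open>c = 2 / 3\<close> solves \<open>1 / 2 + c / 4 = c\<close>, which is
  what the induction asks for when \<open>L^2 \<ge> 4\<close>.\<close>

lemma prod_phi_tail_ge:
  "\<bar>u\<bar> \<le> 1 \<Longrightarrow> 1 - 2 / 3 * u\<^sup>2 \<le> (\<Prod>j<d. norm (phi (u / real L ^ j)))"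
proof (induction d arbitrary: u)
  case (Suc d)
  have L4: "4 \<le> (real L)\<^sup>2" using L power_mono[of 2 "real L" 2] by simp
  have u2: "u\<^sup>2 \<le> 1" using Suc.prems by (simp add: abs_square_le_1)
  have "(\<Prod>j<Suc d. norm (phi (u / real L ^ j))) =
    norm (phi u) * (\<Prod>j<d. norm (phi (u / real L / real L ^ j)))"
    by (subst prod.lessThan_Suc_shift) (simp add: mult.commute)
  also have "\<dots> \<ge> (1 - u\<^sup>2 / 2) * (1 - 2 / 3 * (u / real L)\<^sup>2)"
  proof (intro mult_mono norm_phi_ge Suc.IH)
    show "\<bar>u / real L\<bar> \<le> 1" using Suc.prems L by (simp add: abs_divide)
    have "(u / real L)\<^sup>2 \<le> 1 / 4"
      unfolding power_divide using u2 L4 by (intro frac_le) auto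
    then show "0 \<le> 1 - 2 / 3 * (u / real L)\<^sup>2" by simp
  qed simp
  moreover have "(1 - u\<^sup>2 / 2) * (1 - 2 / 3 * (u\<^sup>2 / 4)) \<le> (1 - u\<^sup>2 / 2) * (1 - 2 / 3 * (u / real L)\<^sup>2)"
    unfolding power_divide using u2 L4 by (intro mult_left_mono diff_left_mono divide_left_mono) auto
  moreover have "1 - 2 / 3 * u\<^sup>2 \<le> (1 - u\<^sup>2 / 2) * (1 - 2 / 3 * (u\<^sup>2 / 4))"
  proof -
    have "1 - 2 / 3 * s \<le> (1 - s / 2) * (1 - 2 / 3 * (s / 4))" if "0 \<le> s" for s :: real
      using mult_nonneg_nonneg[OF that that] by (simp add: algebra_simps)
    then show ?thesis by simp
  qed
  ultimately show ?case by linarith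
qed simp

text \<open>The letters of a word vary independently, so the sum factors. Scaling the centres by
  \<open>L ^ n\<close> makes overlap the same as distance at most \<open>2\<close> between
  frequencies.\<close>

lemma trigsum_eq_Phi:
  "trigsum (W n) (\<lambda>w. real L ^ n * x w) y = of_nat (L ^ n) * Phi n y"
proof (induction n)
  case (Suc n)
  have W1: "W 1 = (\<lambda>j. [j]) ` {1..L}" by (auto simp: words_def length_Suc_conv)
  have split: "cis (real L ^ Suc n * x (j # w) * y) = cis (a j * (real L ^ Suc n * y)) * cis (real L ^ n * x w * y)" for j w
    by (simp add: cis_mult algebra_simps)
  have "trigsum (W (Suc n)) (\<lambda>w. real L ^ Suc n * x w) y =
    (\<Sum>t\<in>W 1. \<Sum>w\<in>W n. cis (real L ^ Suc n * x (t @ w) * y))"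
    unfolding trigsum_def using sum_words_split[of 1 "Suc n" "\<lambda>w. cis (real L ^ Suc n * x w * y)" L] by simp
  also have "\<dots> = (\<Sum>j\<in>{1..L}. \<Sum>w\<in>W n. cis (real L ^ Suc n * x (j # w) * y))"
    unfolding W1 by (subst sum.reindex) (auto simp: inj_on_def)
  also have "\<dots> = (\<Sum>j\<in>{1..L}. cis (a j * (real L ^ Suc n * y))) * trigsum (W n) (\<lambda>w. real L ^ n * x w) y"
    unfolding split trigsum_def sum_product ..
  also have "(\<Sum>j\<in>{1..L}. cis (a j * (real L ^ Suc n * y))) = of_nat L * phi (real L ^ Suc n * y)"
    by (simp add: phi_def expsum_def sum_distrib_left)
  also have "\<dots> * trigsum (W n) (\<lambda>w. real L ^ n * x w) y = of_nat (L ^ Suc n) * Phi (Suc n) y"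
    unfolding Suc by (simp add: Phi_def mult_ac)
  finally show ?case .
qed (simp add: trigsum_def)

lemma norm_trigsum_eq:
  "(norm (trigsum (W n) (\<lambda>w. real L ^ n * x w) y))\<^sup>2 = (real L ^ n)\<^sup>2 * (norm (Phi n y))\<^sup>2"
  unfolding trigsum_eq_Phi norm_mult power_mult_distrib by (simp add: norm_power)

lemma Phi_mean_square_ge:
  assumes "R > 0"
  shows "R / 2 / real L ^ n \<le> integral {0..R} (\<lambda>y. (norm (Phi n y))\<^sup>2)"
proof -
  have "real L ^ n * R / 2 \<le> (real L ^ n)\<^sup>2 * integral {0..R} (\<lambda>y. (norm (Phi n y))\<^sup>2)"
    using trigsum_mean_square_ge[of "W n" R "\<lambda>w. real L ^ n * x w"] assms
    by (simp add: norm_trigsum_eq card_words)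
  then show ?thesis by (simp add: power2_eq_square field_simps)
qed

lemma Phi_mean_square_le:
  "integral {y0 - 1..y0 + 1} (\<lambda>y. (norm (Phi n y))\<^sup>2) \<le> 120 * real (pairs n) / (real L ^ n)\<^sup>2"
proof -
  have "(real L ^ n)\<^sup>2 * integral {y0 - 1..y0 + 1} (\<lambda>y. (norm (Phi n y))\<^sup>2) \<le>
    (\<Sum>u\<in>W n. \<Sum>v\<in>W n. 8 / (1 + (real L ^ n * x u - real L ^ n * x v)\<^sup>2))"
    using trigsum_mean_square_le[of "W n" y0 "\<lambda>w. real L ^ n * x w"] by (simp add: norm_trigsum_eq)
  also have "\<dots> = 8 * (\<Sum>u\<in>W n. \<Sum>v\<in>W n. 1 / (1 + (real L ^ n * x u - real L ^ n * x v)\<^sup>2))"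
    by (simp add: sum_distrib_left)
  also have "\<dots> \<le> 8 * (15 * real (pairs n))"
    unfolding pairs_eq by (intro mult_left_mono sum_pairs_quadratic_decay_le) auto
  finally show ?thesis by (simp add: field_simps)
qed

lemma Phi_mean_square_le':
  assumes "real (pairs n) \<le> 2 * K * real L ^ n"
  shows "integral {y0 - 1..y0 + 1} (\<lambda>y. (norm (Phi n y))\<^sup>2) \<le> 240 * K / real L ^ n"
proof -
  have "120 * real (pairs n) / (real L ^ n)\<^sup>2 \<le> 120 * (2 * K * real L ^ n) / (real L ^ n)\<^sup>2"
    using assms by (intro divide_right_mono) auto
  also have "\<dots> = 240 * K / real L ^ n" by (simp add: power2_eq_square)
  finally show ?thesis using Phi_mean_square_le[of y0 n] by linarith
qed

text \<open>Rescaling by \<open>L^d\<close> isolates the last \<open>s\<close> factors, which become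
  \<open>Phi s y\<close>; the first \<open>d\<close> factors are evaluated at \<open>y / L^j\<close>
  with \<open>j < d\<close>.\<close>

lemma Phi_rescaled:
  "Phi (s + d) (y / real L ^ d) = Phi s y * (\<Prod>j<d. phi (y / real L ^ j))"
proof (induction d)
  case (Suc d)
  have "Phi (s + Suc d) (y / real L ^ Suc d) = Phi (1 + (s + d)) (y / real L ^ Suc d)" by simp
  also have "\<dots> = phi (real L * (y / real L ^ Suc d)) * Phi (s + d) (real L * (y / real L ^ Suc d))"
    unfolding Phi_add by (simp add: Phi_def)
  also have "real L * (y / real L ^ Suc d) = y / real L ^ d" by simp
  finally show ?case using Suc by simp
qed simp


lemma Phi_mean_square_short_le:
  assumes "real (pairs n) \<le> 2 * K * real L ^ n"
  shows "integral {c - 1 / real L ^ l..c + 1 / real L ^ l} (\<lambda>y. (norm (Phi n (real L ^ l * y)))\<^sup>2)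
    \<le> 240 * K / real L ^ (l + n)"
proof -
  have "integral {c - 1 / real L ^ l..c + 1 / real L ^ l} (\<lambda>y. (norm (Phi n (real L ^ l * y)))\<^sup>2) =
    integral {real L ^ l * (c - 1 / real L ^ l)..real L ^ l * (c + 1 / real L ^ l)} (\<lambda>y. (norm (Phi n y))\<^sup>2) / real L ^ l"
    by (rule integral_stretch_continuous) (auto intro!: continuous_intros)
  also have "real L ^ l * (c - 1 / real L ^ l) = real L ^ l * c - 1" by (simp add: right_diff_distrib)
  also have "real L ^ l * (c + 1 / real L ^ l) = real L ^ l * c + 1" by (simp add: distrib_left)
  also have "integral {real L ^ l * c - 1..real L ^ l * c + 1} (\<lambda>y. (norm (Phi n y))\<^sup>2) / real L ^ l \<le>
    (240 * K / real L ^ n) / real L ^ l"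
    by (intro divide_right_mono Phi_mean_square_le' assms) simp
  finally show ?thesis by (simp add: power_add mult.commute)
qed

text \<open>On \<open>[1, L^m]\<close> the mass of \<open>|Phi s|^2\<close> is at least of order \<open>L^(m - s)\<close>, and the short
  intervals around the small values of the next \<open>m\<close> factors carry little of it because
  there \<open>Phi s\<close> contains the uniformly small product \<open>Phi l\<close>.\<close>

lemma Phi_chunk_ge:
  assumes K: "0 < K" and pr: "\<And>n. n \<le> N \<Longrightarrow> real (pairs n) \<le> 2 * K * real L ^ n"
    and s: "l \<le> s" "s + m \<le> N"
    and \<kappa>: "\<And>y. y \<in> {1..real L ^ m} \<Longrightarrow> norm (Phi l y) \<le> \<kappa>"
    and \<delta>: "0 < \<delta>"
    and Z: "finite Z" "real (card Z) \<le> B * real L ^ m"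
      "{t \<in> {0..real L ^ m}. norm (phi t) \<le> \<delta>} \<subseteq> (\<Union>z\<in>Z. {z - 1 / real L ^ (l + m)..z + 1 / real L ^ (l + m)})"
    and big: "1920 * K \<le> real L ^ m" and small: "1920 * K * real m * B * \<kappa>\<^sup>2 \<le> 1"
  shows "\<delta> ^ (2 * m) * real L ^ m / (36 * real L ^ N) \<le>
    integral {1 / real L ^ (N - s)..real L ^ m / real L ^ (N - s)} (\<lambda>y. (norm (Phi N y))\<^sup>2)"
proof -
  define R where "R = real L ^ m"
  have R1: "1 \<le> R" unfolding R_def using L by (intro one_le_power) auto
  define d where "d = N - s"
  have sd: "s + d = N" and dm: "m \<le> d" using s by (auto simp: d_def)
  \<comment> \<open>The interval around \<open>z\<close> magnified by \<open>L^j\<close>: since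
    \<open>j < m\<close>, the radius \<open>1 / L^(l + m)\<close> grows to at most
    \<open>1 / L^l\<close>.\<close>
  define I where "I = (\<lambda>(j, z). {real L ^ j * z - 1 / real L ^ l..real L ^ j * z + 1 / real L ^ l})"
  \<comment> \<open>\<open>G\<close> bounds \<open>|Phi s|^2\<close> on these intervals,
    \<open>H\<close> bounds it elsewhere. The \<open>9\<close> in \<open>H\<close> is the square of
    the factor \<open>3\<close> lost in the tail.\<close>
  define G where "G y = \<kappa>\<^sup>2 * (norm (Phi (s - l) (real L ^ l * y)))\<^sup>2" for y
  define H where "H y = 9 / \<delta> ^ (2 * m) * (norm (Phi N (y / real L ^ d)))\<^sup>2" for y
  define J where "J = {..<m} \<times> Z"
  have finJ: "finite J" using Z by (simp add: J_def)
  have contG: "continuous_on S G" and contH: "continuous_on S H" for S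
    unfolding G_def H_def using \<delta> by (auto intro!: continuous_intros)
  have G0: "0 \<le> G y" and H0: "0 \<le> H y" for y using \<delta> by (auto simp: G_def H_def)
  have pw: "(norm (Phi s y))\<^sup>2 \<le> H y + (\<Sum>p\<in>J. if y \<in> I p then G y else 0)" if y: "y \<in> {1..R}" for y
  proof (cases "\<exists>p\<in>J. y \<in> I p")
    case True
    then obtain p where p: "p \<in> J" "y \<in> I p" by blast
    have "Phi s y = Phi l y * Phi (s - l) (real L ^ l * y)" using Phi_add[of l "s - l" y] s by simp
    moreover have "(norm (Phi l y))\<^sup>2 \<le> \<kappa>\<^sup>2" using \<kappa>[of y] y by (intro power_mono) (auto simp: R_def)
    ultimately have "(norm (Phi s y))\<^sup>2 \<le> G y"
      by (simp add: G_def norm_mult power_mult_distrib mult_right_mono)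
    also have "G y = (if y \<in> I p then G y else 0)" using p by simp
    also have "\<dots> \<le> (\<Sum>p\<in>J. if y \<in> I p then G y else 0)"
      by (rule member_le_sum) (use p finJ G0 in auto)
    finally show ?thesis using H0[of y] by simp
  next
    case False
    have phi_ge: "\<delta> \<le> norm (phi (y / real L ^ j))" if j: "j < m" for j
    proof (rule ccontr)
      assume "\<not> \<delta> \<le> norm (phi (y / real L ^ j))"
      moreover have "0 \<le> y / real L ^ j" using y by simp
      moreover have "y / real L ^ j \<le> real L ^ m"
      proof -
        have "y / real L ^ j \<le> y / 1"
          using y L by (intro divide_left_mono) auto
        then show ?thesis using y by (simp add: R_def)
      qed
      ultimately have "y / real L ^ j \<in> (\<Union>z\<in>Z. {z - 1 / real L ^ (l + m)..z + 1 / real L ^ (l + m)})"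
        using Z(3) by fastforce
      then obtain z where z: "z \<in> Z" "\<bar>y / real L ^ j - z\<bar> \<le> 1 / real L ^ (l + m)"
        by (auto simp: abs_le_iff)
      have "\<bar>y - real L ^ j * z\<bar> = real L ^ j * \<bar>y / real L ^ j - z\<bar>"
      proof -
        have "y - real L ^ j * z = real L ^ j * (y / real L ^ j - z)" by (simp add: right_diff_distrib)
        then show ?thesis by (simp only: abs_mult) simp
      qed
      also have "\<dots> \<le> real L ^ j * (1 / real L ^ (l + m))" using z by (intro mult_left_mono) auto
      also have "\<dots> \<le> real L ^ m * (1 / real L ^ (l + m))"
        using j L by (intro mult_right_mono power_increasing) auto
      also have "\<dots> = 1 / real L ^ l" by (simp add: power_add)
      finally have "y \<in> I (j, z)" by (auto simp: I_def abs_le_iff)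
      moreover have "(j, z) \<in> J" using z j by (simp add: J_def)
      ultimately show False using False by blast
    qed
    have "\<delta> ^ m = (\<Prod>j<m. \<delta>)" by simp
    also have "\<dots> \<le> (\<Prod>j<m. norm (phi (y / real L ^ j)))" using phi_ge \<delta> by (intro prod_mono) auto
    finally have P2: "\<delta> ^ m \<le> (\<Prod>j<m. norm (phi (y / real L ^ j)))" .
    \<comment> \<open>The factors with \<open>j \<ge> m\<close> have arguments
      \<open>u / L^i\<close> with \<open>\<bar>u\<bar> \<le> 1\<close>, where the tail bound leaves
      at least \<open>1 - 2 / 3\<close>.\<close>
    define u where "u = y / real L ^ m"
    have u: "\<bar>u\<bar> \<le> 1" using y by (simp add: u_def R_def)
    have "u\<^sup>2 \<le> 1" using u by (simp add: abs_square_le_1)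
    then have tail: "1 / 3 \<le> (\<Prod>j<d - m. norm (phi (u / real L ^ j)))"
      using prod_phi_tail_ge[OF u, of "d - m"] by simp
    have "(\<Prod>j<d. norm (phi (y / real L ^ j))) =
      (\<Prod>j<m. norm (phi (y / real L ^ j))) * (\<Prod>j=m..<d. norm (phi (y / real L ^ j)))"
      using dm by (metis prod.atLeastLessThan_concat lessThan_atLeast0 zero_le)
    also have "(\<Prod>j=m..<d. norm (phi (y / real L ^ j))) = (\<Prod>j<d - m. norm (phi (u / real L ^ j)))"
      using prod.shift_bounds_nat_ivl[of "\<lambda>j. norm (phi (y / real L ^ j))" 0 m "d - m"] dm
      by (simp add: u_def power_add mult.commute lessThan_atLeast0)
    finally have "\<delta> ^ m * (1 / 3) \<le> (\<Prod>j<d. norm (phi (y / real L ^ j)))"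
      using P2 tail \<delta> by (simp only: mult_mono zero_le_power order_less_imp_le prod_nonneg norm_ge_zero zero_le_divide_1_iff zero_le_numeral)
    then have "norm (Phi s y) * (\<delta> ^ m * (1 / 3)) \<le> norm (Phi N (y / real L ^ d))"
      unfolding Phi_rescaled[of s d y, unfolded sd] norm_mult prod_norm[symmetric]
      by (intro mult_left_mono) auto
    then have "(norm (Phi s y) * (\<delta> ^ m * (1 / 3)))\<^sup>2 \<le> (norm (Phi N (y / real L ^ d)))\<^sup>2"
      using \<delta> by (intro power_mono) auto
    then have "(norm (Phi s y))\<^sup>2 * (\<delta> ^ (2 * m) / 9) \<le> (norm (Phi N (y / real L ^ d)))\<^sup>2"
      by (simp add: power_mult_distrib power_divide mult.commute flip: power_mult)
    then have "(norm (Phi s y))\<^sup>2 \<le> H y" using \<delta> by (simp add: H_def field_simps)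
    moreover have "0 \<le> (\<Sum>p\<in>J. if y \<in> I p then G y else 0)" using G0 by (intro sum_nonneg) auto
    ultimately show ?thesis by simp
  qed
  have intI: "(\<lambda>y. if y \<in> I p then G y else 0) integrable_on {1..R}" for p
  proof -
    have "I p \<inter> {1..R} = {max (real L ^ fst p * snd p - 1 / real L ^ l) 1..min (real L ^ fst p * snd p + 1 / real L ^ l) R}"
      by (auto simp: I_def case_prod_beta)
    then show ?thesis
      unfolding integrable_restrict_Int by (simp only:) (intro integrable_continuous_interval contG)
  qed
  have bad: "integral {1..R} (\<lambda>y. if y \<in> I p then G y else 0) \<le> \<kappa>\<^sup>2 * (240 * K / real L ^ s)" for p
  proof -
    let ?c = "real L ^ fst p * snd p"
    have "integral {1..R} (\<lambda>y. if y \<in> I p then G y else 0) = integral (I p \<inter> {1..R}) G"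
      by (rule integral_restrict_Int)
    also have "\<dots> \<le> integral (I p) G"
    proof (rule integral_subset_le)
      show "G integrable_on I p \<inter> {1..R}" using intI by (simp only: integrable_restrict_Int)
      show "G integrable_on I p" unfolding I_def case_prod_beta by (intro integrable_continuous_interval contG)
    qed (use G0 in auto)
    also have "\<dots> = \<kappa>\<^sup>2 * integral {?c - 1 / real L ^ l..?c + 1 / real L ^ l} (\<lambda>y. (norm (Phi (s - l) (real L ^ l * y)))\<^sup>2)"
      by (simp add: I_def case_prod_beta G_def[abs_def])
    also have "\<dots> \<le> \<kappa>\<^sup>2 * (240 * K / real L ^ (l + (s - l)))"
      using s by (intro mult_left_mono Phi_mean_square_short_le pr) auto
    finally show ?thesis using s by simp
  qed
  let ?f = "\<lambda>y. (norm (Phi s y))\<^sup>2"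
  have contf: "?f integrable_on {p..q}" for p q by (intro integrable_continuous_interval continuous_intros)
  \<comment> \<open>In units of \<open>R / L^s\<close>: the mass on \<open>[0, R]\<close> is at
    least a half, of which at most an eighth sits on \<open>[0, 1]\<close> and at most an eighth
    near the magnified small values, as \<open>1920 = 8 * 240\<close>. A quarter is left for
    \<open>H\<close>.\<close>
  have "R / 2 / real L ^ s \<le> integral {0..R} ?f" using R1 by (intro Phi_mean_square_ge) simp
  also have "\<dots> = integral {0..1} ?f + integral {1..R} ?f"
    using R1 contf by (intro Henstock_Kurzweil_Integration.integral_combine[symmetric]) auto
  also have "integral {0..1} ?f \<le> integral {0 - 1..0 + 1} ?f"
    by (intro integral_subset_le contf) auto
  also have "\<dots> \<le> 240 * K / real L ^ s" using s by (intro Phi_mean_square_le' pr) auto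
  also have "integral {1..R} ?f \<le> integral {1..R} (\<lambda>y. H y + (\<Sum>p\<in>J. if y \<in> I p then G y else 0))"
    using pw finJ intI 
    by (intro integral_le contf integrable_add[OF integrable_continuous_interval[OF contH] integrable_sum]) auto
  also have "\<dots> = integral {1..R} H + (\<Sum>p\<in>J. integral {1..R} (\<lambda>y. if y \<in> I p then G y else 0))"
    using integral_add[OF integrable_continuous_interval[OF contH] integrable_sum[OF finJ intI]]
      integral_sum[OF finJ intI] by simp
  also have "(\<Sum>p\<in>J. integral {1..R} (\<lambda>y. if y \<in> I p then G y else 0)) \<le> (\<Sum>p\<in>J. \<kappa>\<^sup>2 * (240 * K / real L ^ s))"
    by (intro sum_mono bad)
  also have "\<dots> = real m * real (card Z) * (\<kappa>\<^sup>2 * (240 * K / real L ^ s))"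
    by (simp add: J_def card_cartesian_product)
  also have "\<dots> \<le> real m * (B * R) * (\<kappa>\<^sup>2 * (240 * K / real L ^ s))"
    using Z(2) K by (intro mult_right_mono mult_left_mono) (auto simp: R_def)
  also have "\<dots> = (1920 * K * real m * B * \<kappa>\<^sup>2) * (R / 8 / real L ^ s)" by simp
  also have "\<dots> \<le> 1 * (R / 8 / real L ^ s)" using small R1 by (intro mult_right_mono) auto
  also have "240 * K / real L ^ s \<le> R / 8 / real L ^ s"
    using big by (intro divide_right_mono) (auto simp: R_def)
  finally have "R / 2 / real L ^ s \<le> R / 8 / real L ^ s + (integral {1..R} H + 1 * (R / 8 / real L ^ s))" by simp
  then have "R / 4 / real L ^ s \<le> integral {1..R} H" by (simp add: field_simps)
  also have "\<dots> = 9 / \<delta> ^ (2 * m) * integral {1..R} (\<lambda>y. (norm (Phi N (y / real L ^ d)))\<^sup>2)"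
    by (simp add: H_def[abs_def])
  also have "integral {1..R} (\<lambda>y. (norm (Phi N (y / real L ^ d)))\<^sup>2) =
    integral {1..R} (\<lambda>y. (norm (Phi N ((1 / real L ^ d) * y)))\<^sup>2)" by simp
  also have "\<dots> = integral {(1 / real L ^ d) * 1..(1 / real L ^ d) * R} (\<lambda>y. (norm (Phi N y))\<^sup>2) / (1 / real L ^ d)"
    using R1 by (intro integral_stretch_continuous) (auto intro!: continuous_intros)
  finally have main: "R / 4 / real L ^ s \<le> 9 / \<delta> ^ (2 * m) *
    (integral {1 / real L ^ d..R / real L ^ d} (\<lambda>y. (norm (Phi N y))\<^sup>2) * real L ^ d)" by simp
  define Q where "Q = integral {1 / real L ^ d..R / real L ^ d} (\<lambda>y. (norm (Phi N y))\<^sup>2)"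
  have "R / 4 \<le> 9 / \<delta> ^ (2 * m) * Q * (real L ^ d * real L ^ s)"
    using main by (simp add: Q_def[symmetric] field_simps)
  also have "real L ^ d * real L ^ s = real L ^ N" using sd by (simp add: add.commute flip: power_add)
  finally have "\<delta> ^ (2 * m) * R / (36 * real L ^ N) \<le> Q" using \<delta> by (simp add: field_simps)
  then show ?thesis by (simp add: Q_def R_def d_def)
qed

text \<open>The \<open>J\<close> ranges lie end to end inside \<open>[0, 1]\<close>, where
  \<open>|Phi N|^2\<close> has total mass at most \<open>240 * K / L^N\<close>; comparison with the
  mass of each range gives \<open>8640 = 36 * 240\<close>. The offset \<open>4\<close> in
  \<open>N\<close> ensures that every range has \<open>4 * m \<le> s\<close>.\<close>

theorem chunk_count_le:
  assumes K: "0 < K" and m: "1 \<le> m" and N: "N = m * (J + 4)"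
    and pr: "\<And>n. n \<le> N \<Longrightarrow> real (pairs n) \<le> 2 * K * real L ^ n"
    and \<kappa>: "\<And>y. y \<in> {1..real L ^ m} \<Longrightarrow> norm (Phi (4 * m) y) \<le> \<kappa>"
    and \<delta>: "0 < \<delta>"
    and Z: "finite Z" "real (card Z) \<le> B * real L ^ m"
      "{t \<in> {0..real L ^ m}. norm (phi t) \<le> \<delta>} \<subseteq> (\<Union>z\<in>Z. {z - 1 / real L ^ (5 * m)..z + 1 / real L ^ (5 * m)})"
    and big: "1920 * K \<le> real L ^ m" and small: "1920 * K * real m * B * \<kappa>\<^sup>2 \<le> 1"
  shows "real J * (\<delta> ^ (2 * m) * real L ^ m) \<le> 8640 * K"
proof -
  define p where "p i = real L ^ (m * (i + 4)) / real L ^ N" for i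
  let ?f = "\<lambda>y. (norm (Phi N y))\<^sup>2"
  have "\<delta> ^ (2 * m) * real L ^ m / (36 * real L ^ N) \<le> integral {p i..p (Suc i)} ?f" if i: "i < J" for i
  proof -
    let ?s = "m * (i + 4)"
    have s: "?s + m \<le> N"
    proof -
      have "?s + m = m * (i + 5)" by (simp add: algebra_simps)
      also have "\<dots> \<le> N" unfolding N using i by (intro mult_le_mono2) simp
      finally show ?thesis .
    qed
    have "\<delta> ^ (2 * m) * real L ^ m / (36 * real L ^ N) \<le>
      integral {1 / real L ^ (N - ?s)..real L ^ m / real L ^ (N - ?s)} ?f"
      by (rule Phi_chunk_ge[where l = "4 * m" and \<kappa> = \<kappa> and Z = Z and B = B, OF K pr _ s \<kappa> \<delta> Z(1,2) _ big small])
        (use Z(3) in \<open>simp_all add: algebra_simps\<close>)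
    moreover have e: "1 / real L ^ (N - ?s) = p i"
      using s by (simp add: p_def power_diff)
    moreover have "real L ^ m / real L ^ (N - ?s) = p (Suc i)"
    proof -
      have "real L ^ m / real L ^ (N - ?s) = real L ^ m * p i" unfolding e[symmetric] by simp
      also have "m * (Suc i + 4) = m + m * (i + 4)" by (simp add: algebra_simps)
      then have "real L ^ m * p i = p (Suc i)" unfolding p_def by (simp only: power_add times_divide_eq_right)
      finally show ?thesis .
    qed
    ultimately show ?thesis by simp
  qed
  then have "(\<Sum>i<J. \<delta> ^ (2 * m) * real L ^ m / (36 * real L ^ N)) \<le> (\<Sum>i<J. integral {p i..p (Suc i)} ?f)"
    by (intro sum_mono) auto
  also have "\<dots> = integral {p 0..p J} ?f"
    using L by (intro integral_consecutive) (auto intro!: continuous_intros divide_right_mono power_increasing simp: p_def)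
  also have "\<dots> \<le> integral {0 - 1..0 + 1} ?f"
  proof (intro integral_subset_le integrable_continuous_interval continuous_intros)
    have "p J = 1" by (simp add: p_def N)
    moreover have "0 \<le> p 0" by (simp add: p_def)
    ultimately show "{p 0..p J} \<subseteq> {0 - 1..0 + 1}" by auto
  qed auto
  also have "\<dots> \<le> 240 * K / real L ^ N" by (intro Phi_mean_square_le' pr) simp
  finally show ?thesis by (simp add: field_simps)
qed

end

section \<open>Exceptional directions\<close>

text \<open>Integers obtained by appending \<open>l\<close> digits in base \<open>L\<close> to a
  start of size at most \<open>R\<close>, with at most \<open>r\<close> nonzero digits. Digits run
  over \<open>{- L..L}\<close> because they arise from rounding.\<close>

fun reach :: "nat \<Rightarrow> nat \<Rightarrow> nat \<Rightarrow> nat \<Rightarrow> int set" where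
  "reach L R 0 r = {- int R..int R}"
| "reach L R (Suc l) r = (\<lambda>k. int L * k) ` reach L R l r \<union>
     (if r = 0 then {} else (\<lambda>(k, e). int L * k + e) ` (reach L R l (r - 1) \<times> {- int L..int L}))"

lemma finite_reach [simp]: "finite (reach L R l r)"
  by (induction l arbitrary: r) auto

text \<open>A Chernoff type count: weighting each allowed nonzero digit by \<open>q\<close> turns
  the two-term recursion into multiplication by \<open>1 + (2 * L + 1) * q\<close>, without binomial
  coefficients.\<close>

lemma card_reach_le:
  assumes q: "0 < q" "q \<le> 1"
  shows "real (card (reach L R l r)) * q ^ r \<le> (2 * real R + 1) * (1 + (2 * real L + 1) * q) ^ l"
proof (induction l arbitrary: r)
  case 0
  have "real (card (reach L R 0 r)) * q ^ r \<le> real (card (reach L R 0 r)) * 1"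
    using q by (intro mult_left_mono power_le_one) auto
  then show ?case by simp
next
  case (Suc l)
  let ?A = "(2 * real R + 1) * (1 + (2 * real L + 1) * q) ^ l"
  have c0: "card ((\<lambda>k. int L * k) ` reach L R l r) \<le> card (reach L R l r)"
    by (rule card_image_le) simp
  show ?case
  proof (cases r)
    case 0
    then have "real (card (reach L R (Suc l) r)) * q ^ r \<le> real (card (reach L R l r)) * q ^ r"
      using c0 by simp
    also have "\<dots> \<le> ?A * 1" using Suc by simp
    also have "\<dots> \<le> ?A * (1 + (2 * real L + 1) * q)" using q by (intro mult_left_mono) auto
    finally show ?thesis by (simp add: mult_ac)
  next
    case (Suc r')
    have "card ((\<lambda>(k, e). int L * k + e) ` (reach L R l r' \<times> {- int L..int L})) \<le>
      card (reach L R l r' \<times> {- int L..int L})"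
      by (rule card_image_le) simp
    also have "\<dots> = card (reach L R l r') * (2 * L + 1)" 
      by (simp add: card_cartesian_product nat_add_distrib nat_mult_distrib)
    finally have "card (reach L R (Suc l) r) \<le> card (reach L R l r) + card (reach L R l r') * (2 * L + 1)"
      using Suc c0 by (auto intro!: order_trans[OF card_Un_le] add_mono)
    then have "real (card (reach L R (Suc l) r)) \<le> real (card (reach L R l r) + card (reach L R l r') * (2 * L + 1))"
      by (rule of_nat_mono)
    then have "real (card (reach L R (Suc l) r)) \<le>
      real (card (reach L R l r)) + real (card (reach L R l r')) * (2 * real L + 1)"
      by (simp only: of_nat_add of_nat_mult of_nat_1 of_nat_numeral)
    then have "real (card (reach L R (Suc l) r)) * q ^ r \<le>
      (real (card (reach L R l r)) + real (card (reach L R l r')) * (2 * real L + 1)) * q ^ r"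
      using q by (intro mult_right_mono) auto
    also have "\<dots> = real (card (reach L R l r)) * q ^ r + (2 * real L + 1) * q * (real (card (reach L R l r')) * q ^ r')"
      using Suc by (simp add: algebra_simps)
    also have "\<dots> \<le> ?A + (2 * real L + 1) * q * ?A"
      using q by (intro add_mono mult_left_mono Suc.IH) auto
    finally show ?thesis by (simp add: algebra_simps)
  qed
qed

text \<open>Consecutive values \<open>round (L^i * u)\<close> are related by
  \<open>k' = L * k + e\<close>. The rounding errors give
  \<open>\<bar>e\<bar> \<le> L / 2 + 1 / 2 \<le> L\<close>, and \<open>e = 0\<close> except at the
  counted indices.\<close>

lemma round_in_reach:
  assumes L: "1 \<le> L" and u: "\<bar>u\<bar> \<le> real R"
  shows "card {i. i < l \<and> round (real L ^ Suc i * u) \<noteq> int L * round (real L ^ i * u)} \<le> r \<Longrightarrow>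
    round (real L ^ l * u) \<in> reach L R l r"
proof (induction l arbitrary: r)
  case 0
  have "round (- real R) \<le> round u" "round u \<le> round (real R)" using u by (intro round_mono; simp)+
  moreover have "round (- real R) = - int R" using round_of_int[where 'a = real, of "- int R"] by simp
  ultimately show ?case by simp
next
  case (Suc l)
  let ?k = "\<lambda>i. round (real L ^ i * u)"
  let ?S = "\<lambda>l. {i. i < l \<and> ?k (Suc i) \<noteq> int L * ?k i}"
  show ?case
  proof (cases "?k (Suc l) = int L * ?k l")
    case True
    then have "?S (Suc l) = ?S l" by (auto simp: less_Suc_eq)
    then have "?k l \<in> reach L R l r" using Suc by simp
    then show ?thesis using True by auto
  next
    case False
    then have "?S (Suc l) = insert l (?S l)" by (auto simp: less_Suc_eq)
    then have c: "Suc (card (?S l)) \<le> r" using Suc.prems by simp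
    then obtain r' where r: "r = Suc r'" by (cases r) auto
    have "?k l \<in> reach L R l r'" using Suc.IH c r by simp
    moreover have "?k (Suc l) - int L * ?k l \<in> {- int L..int L}"
    proof -
      define v where "v = real L ^ l * u"
      have v: "real L ^ Suc l * u = real L * v" by (simp add: v_def mult_ac)
      have "\<bar>real L * (real_of_int (round v) - v)\<bar> \<le> real L * (1/2)"
        unfolding abs_mult using of_int_round_abs_le[of v] by (intro mult_mono) auto
      moreover have "\<bar>real_of_int (round (real L * v)) - real L * v\<bar> \<le> 1/2" by (rule of_int_round_abs_le)
      ultimately have "\<bar>real_of_int (round (real L * v)) - real L * real_of_int (round v)\<bar> \<le> real L / 2 + 1 / 2"
        unfolding right_diff_distrib by linarith
      also have "\<dots> \<le> real L" using L by simp
      finally have "\<bar>real_of_int (round (real L * v) - int L * round v)\<bar> \<le> real_of_int (int L)" by simp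
      then have "\<bar>round (real L * v) - int L * round v\<bar> \<le> int L" by linarith
      then show ?thesis unfolding v v_def[symmetric] by auto
    qed
    ultimately show ?thesis
      unfolding r by (auto intro!: image_eqI[of _ _ "(?k l, ?k (Suc l) - int L * ?k l)"])
  qed
qed

text \<open>The threshold is chosen so that \<open>L / (L + 1) + 1 / (L + 1) = 1\<close>: two
  consecutive errors below it force a zero digit.\<close>

definition far_index :: "nat \<Rightarrow> nat \<Rightarrow> real \<Rightarrow> nat set" where
  "far_index L l u = {i \<in> {1..l}. 1 / (real L + 1) \<le> \<bar>real_of_int (round (real L ^ i * u)) - real L ^ i * u\<bar>}"

text \<open>A nonzero digit at step \<open>i\<close> makes \<open>i\<close> or \<open>i + 1\<close>
  far, so each far index accounts for at most two digits. The extra \<open>1\<close> is step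
  \<open>0\<close>, since index \<open>0\<close> lies outside \<open>far_index\<close>.\<close>

lemma round_in_reach_of_far:
  assumes L: "1 \<le> L" and u: "\<bar>u\<bar> \<le> real R" and r: "card (far_index L l u) \<le> r"
  shows "round (real L ^ l * u) \<in> reach L R l (2 * r + 1)"
proof (rule round_in_reach[OF L u])
  let ?k = "\<lambda>i. round (real L ^ i * u)"
  let ?D = "\<lambda>i. \<bar>real_of_int (?k i) - real L ^ i * u\<bar>"
  have step: "?k (Suc i) = int L * ?k i"
    if "?D i < 1 / (real L + 1)" "?D (Suc i) < 1 / (real L + 1)" for i
  proof -
    have "\<bar>real L * (real_of_int (?k i) - real L ^ i * u)\<bar> \<le> real L * (1 / (real L + 1))"
      unfolding abs_mult using that by (intro mult_mono) auto
    moreover have "real L * (real_of_int (?k i) - real L ^ i * u) = real L * real_of_int (?k i) - real L ^ Suc i * u"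
      by (simp add: algebra_simps)
    moreover have "real L * (1 / (real L + 1)) + 1 / (real L + 1) = 1" by (simp add: field_simps)
    ultimately have "\<bar>real_of_int (?k (Suc i)) - real L * real_of_int (?k i)\<bar> < 1"
      using that(2) by linarith
    then have "\<bar>real_of_int (?k (Suc i) - int L * ?k i)\<bar> < 1" by simp
    then show ?thesis by linarith
  qed
  have "{i. i < l \<and> ?k (Suc i) \<noteq> int L * ?k i} \<subseteq>
    insert 0 (far_index L l u \<union> (\<lambda>i. i - 1) ` far_index L l u)"
  proof
    fix i assume i: "i \<in> {i. i < l \<and> ?k (Suc i) \<noteq> int L * ?k i}"
    then have "1 / (real L + 1) \<le> ?D i \<or> 1 / (real L + 1) \<le> ?D (Suc i)"
      using step[of i] unfolding mem_Collect_eq not_le[symmetric] by blast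
    then show "i \<in> insert 0 (far_index L l u \<union> (\<lambda>i. i - 1) ` far_index L l u)"
    proof
      assume "1 / (real L + 1) \<le> ?D i"
      then show ?thesis using i by (auto simp: far_index_def)
    next
      assume "1 / (real L + 1) \<le> ?D (Suc i)"
      then have "Suc i \<in> far_index L l u" using i by (auto simp: far_index_def)
      then have "Suc i - 1 \<in> (\<lambda>i. i - 1) ` far_index L l u" by (rule imageI)
      then show ?thesis by simp
    qed
  qed
  then have "card {i. i < l \<and> ?k (Suc i) \<noteq> int L * ?k i} \<le>
    card (insert 0 (far_index L l u \<union> (\<lambda>i. i - 1) ` far_index L l u))"
    by (intro card_mono) (auto simp: far_index_def)
  also have "\<dots> \<le> Suc (card (far_index L l u \<union> (\<lambda>i. i - 1) ` far_index L l u))"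
    by (intro card_insert_le_m1) (auto simp: far_index_def card_insert_if)
  also have "\<dots> \<le> Suc (card (far_index L l u) + card ((\<lambda>i. i - 1) ` far_index L l u))"
    by (simp add: card_Un_le)
  also have "\<dots> \<le> Suc (card (far_index L l u) + card (far_index L l u))"
    by (simp add: card_image_le far_index_def)
  finally show "card {i. i < l \<and> ?k (Suc i) \<noteq> int L * ?k i} \<le> 2 * r + 1" using r by linarith
qed

text \<open>The loss in \<open>phi\<close> caused by two of the \<open>L\<close> unit vectors whose
  phases differ by at least \<open>2 * pi / (L + 1)\<close> modulo \<open>2 * pi\<close>: they add
  up to at most \<open>2 * cos (pi / (L + 1))\<close>, the others to at most
  \<open>L - 2\<close>.\<close>

definition phi_gap :: "nat \<Rightarrow> real" where
  "phi_gap L = 2 * (1 - cos (pi / (real L + 1))) / real L"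

text \<open>Two unit vectors at angle \<open>2 * pi * f\<close> have a sum of length
  \<open>2 * cos (pi * f)\<close>, where \<open>f\<close> is the distance from \<open>u\<close> to
  the nearest integer.\<close>

lemma norm_cis_add_le:
  assumes "\<epsilon> \<le> \<bar>real_of_int (round u) - u\<bar>" "0 \<le> \<epsilon>"
  shows "norm (cis \<alpha> + cis (\<alpha> - 2 * pi * u)) \<le> 2 * cos (pi * \<epsilon>)"
proof -
  define f where "f = \<bar>u - real_of_int (round u)\<bar>"
  have f: "\<epsilon> \<le> f" "f \<le> 1/2" using assms(1) of_int_round_abs_le[of u] by (auto simp: f_def abs_minus_commute)
  have "cos (2 * pi * u) = cos (2 * pi * (u - real_of_int (round u)) + 2 * pi * real_of_int (round u))"
    by (simp add: algebra_simps)
  also have "\<dots> = cos (2 * pi * (u - real_of_int (round u)))"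
    by (simp add: cos_add)
  also have "\<dots> = cos \<bar>2 * pi * (u - real_of_int (round u))\<bar>" by simp
  also have "\<bar>2 * pi * (u - real_of_int (round u))\<bar> = 2 * (pi * f)" by (simp add: f_def abs_mult)
  finally have c: "cos (2 * pi * u) = 2 * (cos (pi * f))\<^sup>2 - 1" by (simp add: cos_double_cos)
  have "complex_of_real ((norm (cis \<alpha> + cis (\<alpha> - 2 * pi * u)))\<^sup>2) =
    (cis \<alpha> + cis (\<alpha> - 2 * pi * u)) * cnj (cis \<alpha> + cis (\<alpha> - 2 * pi * u))"
    by (rule complex_norm_square)
  also have "\<dots> = 2 + cis (2 * pi * u) + cis (- (2 * pi * u))"
    by (simp add: cis_cnj ring_distribs cis_mult)
  finally have "Re (complex_of_real ((norm (cis \<alpha> + cis (\<alpha> - 2 * pi * u)))\<^sup>2)) =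
    Re (2 + cis (2 * pi * u) + cis (- (2 * pi * u)))" by simp
  then have "(norm (cis \<alpha> + cis (\<alpha> - 2 * pi * u)))\<^sup>2 = 2 + 2 * cos (2 * pi * u)" by simp
  also have "\<dots> = (2 * cos (pi * f))\<^sup>2" unfolding c by (simp add: power2_eq_square)
  finally have "(norm (cis \<alpha> + cis (\<alpha> - 2 * pi * u)))\<^sup>2 = (2 * cos (pi * f))\<^sup>2" .
  moreover have "0 \<le> cos (pi * f)" 

  proof (rule cos_ge_zero)
    have "0 \<le> pi * f" using f assms(2) by (intro mult_nonneg_nonneg) auto
    then show "- (pi / 2) \<le> pi * f" using pi_gt_zero by linarith
    show "pi * f \<le> pi / 2" using f mult_left_mono[of f "1/2" pi] by simp
  qed
  ultimately have "norm (cis \<alpha> + cis (\<alpha> - 2 * pi * u)) = 2 * cos (pi * f)"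
    by (metis power2_eq_iff_nonneg norm_ge_zero mult_nonneg_nonneg zero_le_numeral)
  also have "\<dots> \<le> 2 * cos (pi * \<epsilon>)"
  proof -
    have "pi * f \<le> pi * 1" using f by (intro mult_left_mono) auto
    then show ?thesis using f assms(2) by (intro mult_left_mono cos_monotone_0_pi_le) auto
  qed
  finally show ?thesis .
qed

lemma phi_gap_bounds:
  assumes "2 \<le> L" shows "0 < phi_gap L" "phi_gap L < 1"
proof -
  have "pi / (real L + 1) \<le> pi / 3" using assms by (intro divide_left_mono) auto
  then have le: "pi / (real L + 1) \<le> pi / 3" .
  have "cos (pi / (real L + 1)) < cos 0" 
  proof (rule cos_monotone_0_pi)
    show "pi / (real L + 1) \<le> pi" using le pi_gt_zero by linarith
  qed auto
  then show "0 < phi_gap L" using assms by (simp add: phi_gap_def)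
  have "cos (pi / 3) \<le> cos (pi / (real L + 1))" using le by (intro cos_monotone_0_pi_le) auto
  then have "2 * (1 - cos (pi / (real L + 1))) \<le> 1" by (simp add: cos_60)
  then show "phi_gap L < 1" using assms by (simp add: phi_gap_def divide_less_eq)
qed

context line_ifs
begin

lemma norm_phi_le_of_far:
  assumes pq: "p \<in> {1..L}" "q \<in> {1..L}" "p \<noteq> q"
    and far: "1 / (real L + 1) \<le> \<bar>real_of_int (round u) - u\<bar>" and u: "u = t * (a p - a q) / (2 * pi)"
  shows "norm (phi t) \<le> 1 - phi_gap L"
proof -
  have "(\<Sum>j\<in>{1..L}. cis (a j * t)) = cis (a p * t) + (cis (a q * t) + (\<Sum>j\<in>{1..L} - {p} - {q}. cis (a j * t)))"
    using pq by (subst sum.remove[of _ p]; simp) (subst sum.remove[of _ q]; simp)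
  moreover have "a q * t = a p * t - 2 * pi * u" unfolding u by (simp add: field_simps)
  ultimately have "norm (\<Sum>j\<in>{1..L}. cis (a j * t)) \<le>
    norm (cis (a p * t) + cis (a p * t - 2 * pi * u)) + norm (\<Sum>j\<in>{1..L} - {p} - {q}. cis (a j * t))"
    using norm_triangle_ineq by (simp only: add.assoc[symmetric])
  also have "norm (cis (a p * t) + cis (a p * t - 2 * pi * u)) \<le> 2 * cos (pi * (1 / (real L + 1)))"
    by (rule norm_cis_add_le[OF far]) simp
  also have "norm (\<Sum>j\<in>{1..L} - {p} - {q}. cis (a j * t)) \<le> (\<Sum>j\<in>{1..L} - {p} - {q}. norm (cis (a j * t)))"
    by (rule norm_sum)
  also have "\<dots> = real L - 2" using pq L by (simp add: of_nat_diff)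
  finally have "norm (\<Sum>j\<in>{1..L}. cis (a j * t)) \<le> 2 * cos (pi / (real L + 1)) + (real L - 2)" by simp
  moreover have "norm (phi t) = norm (\<Sum>j\<in>{1..L}. cis (a j * t)) / real L"
    by (simp add: phi_def expsum_def norm_divide flip: sum_divide_distrib)
  ultimately have "norm (phi t) \<le> (2 * cos (pi / (real L + 1)) + (real L - 2)) / real L"
    by (simp add: divide_right_mono)
  also have "\<dots> = 1 - phi_gap L" by (simp add: phi_gap_def field_simps)
  finally show ?thesis .
qed

lemma norm_Phi_le_of_far:
  assumes pq: "p \<in> {1..L}" "q \<in> {1..L}" "p \<noteq> q" and u: "u = y * (a p - a q) / (2 * pi)"
  shows "norm (Phi l y) \<le> (1 - phi_gap L) ^ card (far_index L l u)"
proof -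
  have fi: "far_index L l u \<subseteq> {1..l}" by (auto simp: far_index_def)
  have "norm (Phi l y) = (\<Prod>i\<in>{1..l}. norm (phi (real L ^ i * y)))" by (simp add: Phi_def prod_norm)
  also have "\<dots> \<le> (\<Prod>i\<in>{1..l}. if i \<in> far_index L l u then 1 - phi_gap L else 1)"
  proof (intro prod_mono conjI)
    fix i assume "i \<in> {1..l}"
    show "norm (phi (real L ^ i * y)) \<le> (if i \<in> far_index L l u then 1 - phi_gap L else 1)"
    proof (cases "i \<in> far_index L l u")
      case True
      then show ?thesis
        using norm_phi_le_of_far[OF pq, of "real L ^ i * u" "real L ^ i * y"] u by (simp add: far_index_def)
    qed (simp add: norm_phi_le_1)
  qed simp
  also have "\<dots> = (1 - phi_gap L) ^ card (far_index L l u)"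
    using fi by (simp add: prod.If_cases Int_absorb1)
  finally show ?thesis .
qed

end

section \<open>Measure of the directions nearly orthogonal to a vector\<close>

lemma sin_ge_third:
  fixes t :: real
  assumes "0 \<le> t" "t \<le> 2"
  shows "t / 3 \<le> sin t"
proof -
  define g where "g t = sin t - t + t ^ 3 / 6" for t :: real
  have "g 0 \<le> g t"
  proof (rule DERIV_nonneg_imp_nondecreasing[OF assms(1)])
    fix x :: real
    have "(g has_real_derivative cos x - 1 + x\<^sup>2 / 2) (at x)"
      unfolding g_def[abs_def] by (auto intro!: derivative_eq_intros)
    moreover have "0 \<le> cos x - 1 + x\<^sup>2 / 2" using cos_ge_quadratic[of x] by simp
    ultimately show "\<exists>y. (g has_real_derivative y) (at x) \<and> 0 \<le> y" by blast
  qed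
  then have "t - t ^ 3 / 6 \<le> sin t" by (simp add: g_def)
  moreover have "t ^ 3 \<le> 4 * t"
  proof -
    have "t * t\<^sup>2 \<le> t * 2\<^sup>2" using assms by (intro mult_left_mono power_mono) auto
    then show ?thesis by (simp add: power2_eq_square power3_eq_cube)
  qed
  ultimately show ?thesis by simp
qed

lemma abs_sin_ge_third: "\<bar>t\<bar> \<le> pi / 2 \<Longrightarrow> \<bar>t\<bar> / 3 \<le> \<bar>sin (t::real)\<bar>"
  using sin_ge_third[of "\<bar>t\<bar>"] pi_half_less_two by (cases "0 \<le> t") auto

definition thin_angles :: "complex \<Rightarrow> real set" where
  "thin_angles q = {\<theta> \<in> {0..pi}. \<bar>q \<bullet> cis \<theta>\<bar> \<le> 2}"

lemma thin_angles_lmeasurable [simp]: "thin_angles q \<in> lmeasurable"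
proof (rule lmeasurable_compact)
  have "compact ({0..pi} \<inter> {\<theta>. \<bar>q \<bullet> cis \<theta>\<bar> \<le> 2})"
    by (intro compact_Int_closed closed_Collect_le continuous_intros) auto
  then show "compact (thin_angles q)" by (simp add: thin_angles_def Int_def)
qed

text \<open>On the range \<open>[- pi, 2 * pi]\<close> of \<open>\<theta> - Arg q\<close> the cosine
  has three zeros, and the lower bound for the sine keeps the angle within \<open>6 / norm q\<close>
  of one of them: three intervals of length \<open>12 / norm q\<close>.\<close>

lemma measure_thin_angles_le:
  assumes q: "q \<noteq> 0"
  shows "measure lebesgue (thin_angles q) \<le> 36 / norm q"
proof -
  define \<alpha> where "\<alpha> = Arg q"
  define \<tau> where "\<tau> = 6 / norm q"
  have \<tau>: "0 \<le> \<tau>" by (simp add: \<tau>_def)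
  have \<alpha>: "- pi < \<alpha>" "\<alpha> \<le> pi" using Arg_bounded[of q] by (auto simp: \<alpha>_def)
  have "q = rcis (norm q) \<alpha>" by (simp add: \<alpha>_def rcis_cmod_Arg)
  then have "Re q = norm q * cos \<alpha>" "Im q = norm q * sin \<alpha>" by (metis Re_rcis, metis Im_rcis)
  then have inn: "q \<bullet> cis \<theta> = norm q * cos (\<theta> - \<alpha>)" for \<theta>
    by (simp add: inner_complex_def cos_diff algebra_simps)
  define Zs where "Zs = {- (pi / 2), pi / 2, 3 * pi / 2}"
  have "thin_angles q \<subseteq> (\<Union>z\<in>Zs. {\<alpha> + z - \<tau>..\<alpha> + z + \<tau>})"
  proof
    fix \<theta> assume "\<theta> \<in> thin_angles q"
    then have \<theta>: "0 \<le> \<theta>" "\<theta> \<le> pi" and "norm q * \<bar>cos (\<theta> - \<alpha>)\<bar> \<le> 2"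
      by (auto simp: thin_angles_def inn abs_mult)
    then have c: "\<bar>cos (\<theta> - \<alpha>)\<bar> \<le> 2 / norm q" using q by (simp add: field_simps)
    have "\<exists>z\<in>Zs. \<bar>\<theta> - \<alpha> - z\<bar> \<le> pi / 2"
    proof -
      have "- pi \<le> \<theta> - \<alpha>" "\<theta> - \<alpha> \<le> 2 * pi" using \<theta> \<alpha> by linarith+
      then have "\<bar>\<theta> - \<alpha> - (- (pi / 2))\<bar> \<le> pi / 2 \<or> \<bar>\<theta> - \<alpha> - pi / 2\<bar> \<le> pi / 2 \<or> \<bar>\<theta> - \<alpha> - 3 * pi / 2\<bar> \<le> pi / 2"
      proof (cases "\<theta> - \<alpha> \<le> 0")
        case True
        then show ?thesis using \<open>- pi \<le> \<theta> - \<alpha>\<close> by (intro disjI1) linarith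
      next
        case False
        show ?thesis
        proof (cases "\<theta> - \<alpha> \<le> pi")
          case True
          then show ?thesis using False by (intro disjI2 disjI1) linarith
        next
          case False
          then show ?thesis using \<open>\<theta> - \<alpha> \<le> 2 * pi\<close> False
            by (intro disjI2) linarith
        qed
      qed
      then show ?thesis by (auto simp: Zs_def)
    qed
    then obtain z where z: "z \<in> Zs" "\<bar>\<theta> - \<alpha> - z\<bar> \<le> pi / 2" by blast
    have "\<bar>cos (s + z)\<bar> = \<bar>sin s\<bar>" for s
    proof -
      have "3 * pi / 2 = pi + pi / 2" by simp
      then have "cos (3 * pi / 2) = 0" "sin (3 * pi / 2) = - 1" by (simp_all only: cos_add sin_add) simp_all
      then have "cos z = 0 \<and> \<bar>sin z\<bar> = 1"
        using z(1) unfolding Zs_def insert_iff empty_iff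
        by (elim disjE) (simp_all only: cos_minus sin_minus cos_pi_half sin_pi_half abs_minus_cancel abs_one simp_thms)
      then show ?thesis by (simp add: cos_add abs_mult)
    qed
    from this[of "\<theta> - \<alpha> - z"] have "\<bar>cos (\<theta> - \<alpha>)\<bar> = \<bar>sin (\<theta> - \<alpha> - z)\<bar>" by simp
    then have "\<bar>\<theta> - \<alpha> - z\<bar> / 3 \<le> 2 / norm q" using abs_sin_ge_third[OF z(2)] c by simp
    then have "\<bar>\<theta> - \<alpha> - z\<bar> \<le> \<tau>" by (simp add: \<tau>_def field_simps)
    then show "\<theta> \<in> (\<Union>z\<in>Zs. {\<alpha> + z - \<tau>..\<alpha> + z + \<tau>})"
      using z(1) by (intro UN_I[of z]) (auto simp: abs_le_iff)
  qed
  then have "measure lebesgue (thin_angles q) \<le> measure lebesgue (\<Union>z\<in>Zs. {\<alpha> + z - \<tau>..\<alpha> + z + \<tau>})"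
    by (intro measure_mono_fmeasurable fmeasurable.finite_UN) (auto simp: Zs_def fmeasurableD)
  also have "\<dots> \<le> (\<Sum>z\<in>Zs. measure lebesgue {\<alpha> + z - \<tau>..\<alpha> + z + \<tau>})"
    by (rule measure_UNION_le) (auto simp: Zs_def)
  also have "\<dots> = real (card Zs) * (2 * \<tau>)" using \<tau> by simp
  also have "\<dots> \<le> 3 * (2 * \<tau>)"
  proof -
    have "card Zs \<le> 3" unfolding Zs_def by (auto intro!: card_insert_le_m1)
    then show ?thesis using \<tau> by (intro mult_right_mono) auto
  qed
  finally show ?thesis by (simp add: \<tau>_def)
qed

text \<open>\<open>k\<close> and \<open>k'\<close> stand for the rounded values of a common multiple
  of \<open>d \<bullet> cis \<theta>\<close> and \<open>d' \<bullet> cis \<theta>\<close>; without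
  rounding, \<open>k' * d - k * d'\<close> would be orthogonal to
  \<open>cis \<theta>\<close>.\<close>

definition bad_angles :: "complex \<Rightarrow> complex \<Rightarrow> int set \<Rightarrow> real \<Rightarrow> real set" where
  "bad_angles d d' G Q = (\<Union>(k, k') \<in> {(k, k') \<in> G \<times> G. Q \<le> norm (of_int k' * d - of_int k * d')}.
     thin_angles (of_int k' * d - of_int k * d'))"

lemma bad_angles_lmeasurable: "finite G \<Longrightarrow> bad_angles d d' G Q \<in> lmeasurable"
  unfolding bad_angles_def
  by (intro fmeasurable.finite_UN) (auto intro: finite_subset[of _ "G \<times> G"])

lemma measure_bad_angles_le:
  assumes G: "finite G" and Q: "0 < Q"
  shows "measure lebesgue (bad_angles d d' G Q) \<le> (real (card G))\<^sup>2 * (36 / Q)"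
proof -
  let ?I = "{(k, k') \<in> G \<times> G. Q \<le> norm (of_int k' * d - of_int k * d')}"
  have fin: "finite ?I" using G by (auto intro: finite_subset[of _ "G \<times> G"])
  have "measure lebesgue (bad_angles d d' G Q) \<le>
    (\<Sum>p\<in>?I. measure lebesgue (case p of (k, k') \<Rightarrow> thin_angles (of_int k' * d - of_int k * d')))"
    unfolding bad_angles_def
    by (rule measure_UNION_le[OF fin]) (auto simp: fmeasurableD)
  also have "\<dots> \<le> (\<Sum>p\<in>?I. 36 / Q)"
  proof (rule sum_mono)
    fix p assume "p \<in> ?I"
    then obtain k k' where p: "p = (k, k')" and ge: "Q \<le> norm (of_int k' * d - of_int k * d')" by auto
    have "measure lebesgue (thin_angles (of_int k' * d - of_int k * d')) \<le> 36 / norm (of_int k' * d - of_int k * d')"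
      using ge Q by (intro measure_thin_angles_le) auto
    also have "\<dots> \<le> 36 / Q" using ge Q by (intro frac_le) auto
    finally show "measure lebesgue (case p of (k, k') \<Rightarrow> thin_angles (of_int k' * d - of_int k * d')) \<le> 36 / Q"
      by (simp add: p)
  qed
  also have "\<dots> = real (card ?I) * (36 / Q)" by simp
  also have "\<dots> \<le> real (card (G \<times> G)) * (36 / Q)"
    using G Q by (intro mult_right_mono of_nat_mono card_mono) auto
  finally show ?thesis by (simp add: card_cartesian_product power2_eq_square)
qed

text \<open>The combination of \<open>d\<close> and \<open>d'\<close> orthogonal to
  \<open>cis \<theta>\<close> has length \<open>\<bar>Im (cnj d * d')\<bar>\<close>, the same for
  every \<open>\<theta>\<close>. So independence of \<open>d\<close> and \<open>d'\<close> keeps it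
  long in all directions.\<close>

lemma inner_cis_skew:
  "complex_of_real (d' \<bullet> cis \<theta>) * d - complex_of_real (d \<bullet> cis \<theta>) * d' =
    complex_of_real (Im (cnj d * d')) * (- \<i> * cis \<theta>)"
  by (simp add: complex_eq_iff inner_complex_def algebra_simps)

text \<open>If \<open>|Phi l y|\<close> is not small then both \<open>y (d \<bullet> cis \<theta>) / 2\<pi>\<close> and \<open>y (d' \<bullet> cis \<theta>) / 2\<pi>\<close>
  have almost only trivial digits in base \<open>L\<close>. Their approximants \<open>k / L^l\<close>, \<open>k' / L^l\<close> determine
  \<open>\<theta>\<close> up to \<open>O(L^{-l})\<close>, because \<open>k' d - k d'\<close> is nearly orthogonal to \<open>cis \<theta>\<close>.\<close>

lemma bad_angle_of_Phi_large:
  fixes c :: "nat \<Rightarrow> complex"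
  assumes ifs: "line_ifs L (\<lambda>j. c j \<bullet> cis \<theta>)"
    and I: "p \<in> {1..L}" "q \<in> {1..L}" "p' \<in> {1..L}" "q' \<in> {1..L}"
    and d: "d = c p - c q" "d' = c p' - c q'" "norm d \<le> 2" "norm d' \<le> 2"
    and \<Delta>: "Im (cnj d * d') \<noteq> 0"
    and \<theta>: "\<theta> \<in> {0..pi}" and y: "y \<in> {1..real L ^ m}"
    and big: "(1 - phi_gap L) ^ Suc r < norm (line_ifs.Phi L (\<lambda>j. c j \<bullet> cis \<theta>) l y)"
  shows "\<theta> \<in> bad_angles d d' (reach L (L ^ m) l (2 * r + 1)) (real L ^ l * \<bar>Im (cnj d * d')\<bar> / (2 * pi) - 2)"
proof -
  interpret line_ifs L "\<lambda>j. c j \<bullet> cis \<theta>" by (rule ifs)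
  define u u' where "u = y * (d \<bullet> cis \<theta>) / (2 * pi)" and "u' = y * (d' \<bullet> cis \<theta>) / (2 * pi)"
  have gap: "0 \<le> 1 - phi_gap L" "1 - phi_gap L \<le> 1" using phi_gap_bounds[OF L] by auto
  have inner_le: "\<bar>z \<bullet> cis \<theta>\<bar> \<le> 2" if "norm z \<le> 2" for z
    using Cauchy_Schwarz_ineq2[of z "cis \<theta>"] that by simp
  have abs_le: "\<bar>y * (z \<bullet> cis \<theta>) / (2 * pi)\<bar> \<le> real (L ^ m)" if "norm z \<le> 2" for z
  proof -
    have "\<bar>y * (z \<bullet> cis \<theta>) / (2 * pi)\<bar> = \<bar>y\<bar> * (\<bar>z \<bullet> cis \<theta>\<bar> / (2 * pi))" by (simp add: abs_mult)
    also have "\<bar>z \<bullet> cis \<theta>\<bar> / (2 * pi) \<le> 1"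
      using inner_le[OF that] pi_gt3 by (simp add: divide_le_eq)
    then have "\<bar>y\<bar> * (\<bar>z \<bullet> cis \<theta>\<bar> / (2 * pi)) \<le> \<bar>y\<bar> * 1" by (rule mult_left_mono) simp
    finally show ?thesis using y by simp
  qed
  have far: "card (far_index L l v) \<le> r"
    if "i \<in> {1..L}" "j \<in> {1..L}" "i \<noteq> j" "v = y * (c i \<bullet> cis \<theta> - c j \<bullet> cis \<theta>) / (2 * pi)" for i j v
  proof (rule ccontr)
    assume "\<not> card (far_index L l v) \<le> r"
    then have "(1 - phi_gap L) ^ card (far_index L l v) \<le> (1 - phi_gap L) ^ Suc r"
      using gap by (intro power_decreasing) auto
    then show False using norm_Phi_le_of_far[OF that, of l] big by linarith
  qed
  have "p \<noteq> q" "p' \<noteq> q'" using \<Delta> d by auto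
  then have far_u: "card (far_index L l u) \<le> r" "card (far_index L l u') \<le> r"
    using far[OF I(1,2), of u] far[OF I(3,4), of u'] by (simp_all add: u_def u'_def d(1,2) inner_diff_left)
  have uR: "\<bar>u\<bar> \<le> real (L ^ m)" "\<bar>u'\<bar> \<le> real (L ^ m)"
    unfolding u_def u'_def by (intro abs_le d(3,4))+
  define k k' where "k = round (real L ^ l * u)" and "k' = round (real L ^ l * u')"
  have L1: "1 \<le> L" using L by simp
  have kG: "k \<in> reach L (L ^ m) l (2 * r + 1)" "k' \<in> reach L (L ^ m) l (2 * r + 1)"
    unfolding k_def k'_def
    by (rule round_in_reach_of_far[OF L1 uR(1) far_u(1)], rule round_in_reach_of_far[OF L1 uR(2) far_u(2)])
  define e e' where "e = real_of_int k - real L ^ l * u" and "e' = real_of_int k' - real L ^ l * u'"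
  have e: "\<bar>e\<bar> \<le> 1/2" "\<bar>e'\<bar> \<le> 1/2" unfolding e_def e'_def k_def k'_def by (rule of_int_round_abs_le)+
  define w where "w = of_int k' * d - of_int k * d'"
  define A where "A = real L ^ l * y / (2 * pi)"
  have kk: "real_of_int k = A * (d \<bullet> cis \<theta>) + e" "real_of_int k' = A * (d' \<bullet> cis \<theta>) + e'"
    by (simp_all add: e_def e'_def u_def u'_def A_def)
  have "w = complex_of_real (real_of_int k') * d - complex_of_real (real_of_int k) * d'" by (simp add: w_def)
  also have "\<dots> = complex_of_real A * (complex_of_real (d' \<bullet> cis \<theta>) * d - complex_of_real (d \<bullet> cis \<theta>) * d')
      + (complex_of_real e' * d - complex_of_real e * d')"
    unfolding kk by (simp add: algebra_simps)
  also have "\<dots> = complex_of_real A * (complex_of_real (Im (cnj d * d')) * (- \<i> * cis \<theta>))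
      + (complex_of_real e' * d - complex_of_real e * d')"
    unfolding inner_cis_skew ..
  finally have w: "w = complex_of_real A * (complex_of_real (Im (cnj d * d')) * (- \<i> * cis \<theta>))
      + (complex_of_real e' * d - complex_of_real e * d')" .
  have small: "norm (complex_of_real e' * d - complex_of_real e * d') \<le> 2"
  proof -
    have "norm (complex_of_real e' * d - complex_of_real e * d') \<le> \<bar>e'\<bar> * norm d + \<bar>e\<bar> * norm d'"
      by (metis norm_triangle_ineq4 norm_mult norm_of_real)
    also have "\<dots> \<le> 1/2 * 2 + 1/2 * 2" using e d by (intro add_mono mult_mono) auto
    finally show ?thesis by simp
  qed
  \<comment> \<open>Only \<open>y \<ge> 1\<close> enters, so the lower bound for \<open>w\<close> is
    uniform in the unknown frequency.\<close>
  have "real L ^ l / (2 * pi) \<le> A"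
    unfolding A_def using y by (intro divide_right_mono) (auto simp: mult_le_cancel_left1)
  then have "real L ^ l / (2 * pi) * \<bar>Im (cnj d * d')\<bar> \<le> A * \<bar>Im (cnj d * d')\<bar>" by (rule mult_right_mono) simp
  moreover have A0: "0 \<le> A" using y by (simp add: A_def)
  moreover have "norm (complex_of_real A * (complex_of_real (Im (cnj d * d')) * (- \<i> * cis \<theta>))) = \<bar>A\<bar> * \<bar>Im (cnj d * d')\<bar>"
    by (simp only: norm_mult norm_of_real norm_minus_cancel norm_ii norm_cis mult_1_right)
  moreover have "norm (complex_of_real A * (complex_of_real (Im (cnj d * d')) * (- \<i> * cis \<theta>))) - 2 \<le> norm w"
    unfolding w using small norm_diff_ineq by (smt (verit))
  ultimately have Q: "real L ^ l * \<bar>Im (cnj d * d')\<bar> / (2 * pi) - 2 \<le> norm w" by simp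
  have "w \<bullet> cis \<theta> = real_of_int k' * (d \<bullet> cis \<theta>) - real_of_int k * (d' \<bullet> cis \<theta>)"
    by (simp add: w_def inner_complex_def algebra_simps)
  also have "\<dots> = e' * (d \<bullet> cis \<theta>) - e * (d' \<bullet> cis \<theta>)" unfolding kk by (simp add: algebra_simps)
  finally have "\<bar>w \<bullet> cis \<theta>\<bar> \<le> \<bar>e'\<bar> * \<bar>d \<bullet> cis \<theta>\<bar> + \<bar>e\<bar> * \<bar>d' \<bullet> cis \<theta>\<bar>"
    by (metis abs_triangle_ineq4 abs_mult)
  also have "\<dots> \<le> 1/2 * 2 + 1/2 * 2" using e d inner_le by (intro add_mono mult_mono) auto
  finally have "\<theta> \<in> thin_angles w" using \<theta> by (simp add: thin_angles_def)
  then show ?thesis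
    unfolding bad_angles_def using kG Q by (auto simp: w_def intro!: bexI[of _ "(k, k')"])
qed

section \<open>Assembling the estimate\<close>

context line_ifs
begin

lemma shadow_antimono: "m \<le> n \<Longrightarrow> shadow n \<subseteq> shadow m"
proof -
  assume "m \<le> n"
  then obtain k where n: "n = m + k" using le_Suc_ex by blast
  show ?thesis
  proof
    fix z assume "z \<in> shadow n"
    then obtain w y where w: "w \<in> W m" and z: "z = y / real L ^ m + x w" and "y \<in> shadow k"
      unfolding n shadow_add by auto
    then have "\<bar>y / real L ^ m\<bar> \<le> 1 / real L ^ m"
      using shadow_subset[of k] by (auto simp: abs_divide abs_le_iff intro!: divide_right_mono)
    then have "x w - 1 / real L ^ m \<le> z" "z \<le> x w + 1 / real L ^ m" unfolding z by linarith+
    then show "z \<in> shadow m" unfolding shadow_def using w by (intro UN_I[of w]) auto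
  qed
qed

lemma shadow_length_antimono: "m \<le> n \<Longrightarrow> shadow_length n \<le> shadow_length m"
  by (intro measure_mono_fmeasurable shadow_antimono) (auto intro: fmeasurableD)

end

lemma inner_pos: "pos L c w \<bullet> v = pos L (\<lambda>j. c j \<bullet> v) w"
  by (induction w) (simp_all add: inner_add_left)

lemma word_map_eq: "word_map L c w z = z / of_nat L ^ length w + pos L c w"
  by (induction w) (simp_all add: word_map_def disc_map_def add_divide_distrib scaleR_conv_of_real)

lemma projection_subset_shadow:
  assumes "line_ifs L (\<lambda>j. c j \<bullet> cis \<theta>)"
  shows "{t. t *\<^sub>R cis \<theta> \<in> proj_line \<theta> ` cantor_stage L c n} \<subseteq> line_ifs.shadow L (\<lambda>j. c j \<bullet> cis \<theta>) n"
proof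
  interpret line_ifs L "\<lambda>j. c j \<bullet> cis \<theta>" by (rule assms)
  fix t assume "t \<in> {t. t *\<^sub>R cis \<theta> \<in> proj_line \<theta> ` cantor_stage L c n}"
  then obtain z where z: "z \<in> cantor_stage L c n" and "t *\<^sub>R cis \<theta> = (z \<bullet> cis \<theta>) *\<^sub>R cis \<theta>"
    by (auto simp: proj_line_def)
  then have t: "t = z \<bullet> cis \<theta>" by simp
  obtain w v where w: "w \<in> W n" and v: "norm v \<le> 1" and "z = v / of_nat L ^ n + pos L c w"
    using z by (auto simp: cantor_stage_def words_def word_map_eq)
  then have "t = (v \<bullet> cis \<theta>) / real L ^ n + x w"
  proof -
    have "v / of_nat L ^ n = (1 / real L ^ n) *\<^sub>R v" by (simp add: scaleR_conv_of_real)
    then show ?thesis unfolding t \<open>z = _\<close> by (simp add: inner_add_left inner_pos)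
  qed
  moreover have "\<bar>v \<bullet> cis \<theta>\<bar> \<le> 1" using Cauchy_Schwarz_ineq2[of v "cis \<theta>"] v by simp
  then have "\<bar>(v \<bullet> cis \<theta>) / real L ^ n\<bar> \<le> 1 / real L ^ n"
    unfolding abs_divide by (simp add: divide_right_mono)
  ultimately have "x w - 1 / real L ^ n \<le> t" "t \<le> x w + 1 / real L ^ n" by linarith+
  then show "t \<in> shadow n" unfolding shadow_def using w by (intro UN_I[of w]) auto
qed

text \<open>If all these determinants vanish, \<open>cnj d * (y - a)\<close> is real for a fixed
  nonzero \<open>d = x - a\<close>, and each \<open>y - a\<close> is a real multiple of
  \<open>d\<close>.\<close>

lemma not_collinear_imp_basis:
  fixes S :: "complex set"
  assumes nc: "\<not> collinear S" and a: "a \<in> S"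
  shows "\<exists>x\<in>S. \<exists>y\<in>S. Im (cnj (x - a) * (y - a)) \<noteq> 0"
proof (rule ccontr)
  assume "\<not> ?thesis"
  then have z: "Im (cnj (x - a) * (y - a)) = 0" if "x \<in> S" "y \<in> S" for x y using that by blast
  have "collinear S"
  proof (cases "\<exists>x\<in>S. x \<noteq> a")
    case True
    then obtain x where x: "x \<in> S" "x \<noteq> a" by blast
    define d where "d = x - a"
    have d: "d \<noteq> 0" using x by (simp add: d_def)
    have mult: "\<exists>t. y - a = t *\<^sub>R d" if y: "y \<in> S" for y
    proof -
      have "cnj d * (y - a) = of_real (Re (cnj d * (y - a)))"
        using z[OF x(1) y] by (simp add: complex_eq_iff d_def)
      then have "d * cnj d * (y - a) = of_real (Re (cnj d * (y - a))) * d" by (metis mult.assoc mult.commute)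
      then have "of_real ((norm d)\<^sup>2) * (y - a) = of_real (Re (cnj d * (y - a))) * d"
        by (simp only: complex_norm_square)
      then have "y - a = of_real (Re (cnj d * (y - a)) / (norm d)\<^sup>2) * d"
        using d by (simp add: field_simps)
      then show ?thesis by (metis scaleR_conv_of_real)
    qed
    show ?thesis unfolding collinear_def
    proof (intro exI[of _ d] ballI)
      fix y y' assume "y \<in> S" "y' \<in> S"
      then obtain t t' where t: "y - a = t *\<^sub>R d" "y' - a = t' *\<^sub>R d" using mult by meson
      have "y - y' = (y - a) - (y' - a)" by simp
      also have "\<dots> = (t - t') *\<^sub>R d" unfolding t by (simp add: scaleR_diff_left)
      finally show "\<exists>t. y - y' = t *\<^sub>R d" by blast
    qed
  next
    case False
    then have "S \<subseteq> {a}" by auto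
    then show ?thesis by (meson collinear_sing collinear_subset)
  qed
  with nc show False by blast
qed

text \<open>On \<open>X\<close> the trivial length \<open>2\<close> is used, which
  \<open>2 \<le> pi\<close> absorbs into the normalisation.\<close>

lemma Fav_le:
  assumes ifs: "\<And>\<theta>. line_ifs L (\<lambda>j. c j \<bullet> cis \<theta>)"
    and X: "X \<in> lmeasurable" "measure lebesgue X \<le> \<epsilon>" and \<eta>: "0 \<le> \<eta>"
    and good: "\<And>\<theta>. \<theta> \<in> {0..pi} - X \<Longrightarrow> measure lebesgue (line_ifs.shadow L (\<lambda>j. c j \<bullet> cis \<theta>) n) \<le> \<eta>"
  shows "Fav (cantor_stage L c n) \<le> ennreal (\<epsilon> + \<eta>)"
proof -
  have \<epsilon>: "0 \<le> \<epsilon>" using X(2) measure_nonneg[of lebesgue X] by linarith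
  have pt: "line_measure \<theta> (proj_line \<theta> ` cantor_stage L c n) * indicator {0..pi} \<theta> \<le>
    2 * indicator X \<theta> + ennreal \<eta> * indicator {0..pi} \<theta>" for \<theta>
  proof (cases "\<theta> \<in> {0..pi}")
    case True
    interpret line_ifs L "\<lambda>j. c j \<bullet> cis \<theta>" by (rule ifs)
    have "line_measure \<theta> (proj_line \<theta> ` cantor_stage L c n) \<le> emeasure lebesgue (shadow n)"
      unfolding line_measure_def using projection_subset_shadow[OF ifs]
      by (intro emeasure_mono) (auto intro: fmeasurableD)
    also have "\<dots> = ennreal (shadow_length n)"
      by (rule emeasure_eq_measure2) simp
    finally have le: "line_measure \<theta> (proj_line \<theta> ` cantor_stage L c n) \<le> ennreal (shadow_length n)" .
    show ?thesis
    proof (cases "\<theta> \<in> X")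
      case True
      have "ennreal (shadow_length n) \<le> 2"
        using shadow_length_le_2[of n] by (metis ennreal_leI ennreal_numeral zero_le_numeral)
      with le have "line_measure \<theta> (proj_line \<theta> ` cantor_stage L c n) \<le> 2" by (rule order_trans)
      then show ?thesis using True \<open>\<theta> \<in> {0..pi}\<close> by (simp add: add_increasing2)
    next
      case False
      then have "ennreal (shadow_length n) \<le> ennreal \<eta>" using good True by (intro ennreal_leI) auto
      with le have "line_measure \<theta> (proj_line \<theta> ` cantor_stage L c n) \<le> ennreal \<eta>" by (rule order_trans)
      then show ?thesis using False True by simp
    qed
  qed simp
  have "(\<integral>\<^sup>+ \<theta>\<in>{0..pi}. line_measure \<theta> (proj_line \<theta> ` cantor_stage L c n) \<partial>lebesgue) \<le>
    (\<integral>\<^sup>+ \<theta>. 2 * indicator X \<theta> + ennreal \<eta> * indicator {0..pi} \<theta> \<partial>lebesgue)"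
    by (intro nn_integral_mono pt)
  also have "\<dots> = 2 * emeasure lebesgue X + ennreal \<eta> * emeasure lebesgue {0..pi}"
  proof -
    have "X \<in> sets lebesgue" "{0..pi} \<in> sets lebesgue" using X(1) by (auto intro: fmeasurableD)
    then show ?thesis
      by (subst nn_integral_add)
        (auto simp: nn_integral_cmult_indicator
          intro!: borel_measurable_times_ennreal borel_measurable_const borel_measurable_indicator)
  qed
  also have "emeasure lebesgue X = ennreal (measure lebesgue X)" using X(1) by (rule emeasure_eq_measure2)
  also have "emeasure lebesgue {0..pi} = ennreal pi" by simp
  also have "2 * ennreal (measure lebesgue X) + ennreal \<eta> * ennreal pi = ennreal (2 * measure lebesgue X + \<eta> * pi)"
    using \<eta> by (simp add: ennreal_plus ennreal_mult)
  also have "\<dots> \<le> ennreal (pi * (\<epsilon> + \<eta>))"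
  proof (rule ennreal_leI)
    have "2 * measure lebesgue X \<le> pi * \<epsilon>"
      using X(2) pi_gt3 measure_nonneg[of lebesgue X] by (intro mult_mono) auto
    then show "2 * measure lebesgue X + \<eta> * pi \<le> pi * (\<epsilon> + \<eta>)" by (simp add: algebra_simps)
  qed
  finally have "Fav (cantor_stage L c n) \<le> ennreal (1 / pi) * ennreal (pi * (\<epsilon> + \<eta>))"
    unfolding Fav_def by (rule mult_left_mono) simp
  also have "\<dots> = ennreal (\<epsilon> + \<eta>)"
    using \<epsilon> \<eta> by (simp flip: ennreal_mult)
  finally show ?thesis .
qed

text \<open>The dichotomy for one direction outside the exceptional set: many overlapping discs shrink
  the projection, few overlapping discs contradict the lower bounds on all \<open>J\<close> chunks.\<close>

lemma (in line_ifs) shadow_length_le_of_small_Phi: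
  assumes K: "1 < K" and m: "1 \<le> m" and N: "N = m * (J + 4)"
    and M: "12 * real L * K\<^sup>2 \<le> real M"
    and \<kappa>: "\<And>y. y \<in> {1..real L ^ m} \<Longrightarrow> norm (Phi (4 * m) y) \<le> \<kappa>"
    and \<delta>: "0 < \<delta>"
    and Z: "finite Z" "real (card Z) \<le> B * real L ^ m"
      "{t \<in> {0..real L ^ m}. norm (phi t) \<le> \<delta>} \<subseteq> (\<Union>z\<in>Z. {z - 1 / real L ^ (5 * m)..z + 1 / real L ^ (5 * m)})"
    and big: "1920 * K \<le> real L ^ m" and small: "1920 * K * real m * B * \<kappa>\<^sup>2 \<le> 1"
    and J: "8640 * K < real J * \<delta> ^ (2 * m)"
  shows "shadow_length (N * M) \<le> 18 / K"
proof (rule shadow_length_le_of_marked_ge[OF K _ M], rule ccontr)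
  assume "\<not> real L ^ N \<le> 12 * real L * K * real (card (marked K N))"
  then have "real (pairs n) \<le> 2 * K * real L ^ n" if "n \<le> N" for n
    using pairs_le_of_marked_le[OF K _ that] by simp
  then have "real J * (\<delta> ^ (2 * m) * real L ^ m) \<le> 8640 * K"
    using K by (intro chunk_count_le[where \<kappa> = \<kappa> and Z = Z and B = B, OF _ m N _ \<kappa> \<delta> Z big small]) auto
  moreover have "real J * \<delta> ^ (2 * m) * 1 \<le> real J * \<delta> ^ (2 * m) * real L ^ m"
    using L \<delta> by (intro mult_left_mono) auto
  ultimately show False using J by (simp add: mult.assoc)
qed

section \<open>Choice of the parameters\<close>

lemma power_le_power_square:
  fixes a :: real
  assumes "1 \<le> a" "k \<le> m" "1 \<le> m"
  shows "a ^ k \<le> a ^ (m\<^sup>2)"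
  using assms by (intro power_increasing) (auto simp: power2_eq_square intro: order_trans)

text \<open>Everything is governed by one integer \<open>r\<close>, the permitted number of far
  indices. It fixes \<open>\<kappa> = g ^ Suc r\<close>, and \<open>m = h * r\<close> with a
  constant \<open>h\<close> so large that \<open>r\<close> stray digits are few compared with
  \<open>m\<close>.\<close>

lemma Fav_cantor_stage_le:
  fixes L :: nat and c :: "nat \<Rightarrow> complex"
  assumes ifs: "\<And>\<theta>. line_ifs L (\<lambda>j. c j \<bullet> cis \<theta>)"
    and I: "p \<in> {1..L}" "q \<in> {1..L}" "p' \<in> {1..L}" "q' \<in> {1..L}"
    and cn: "\<And>j. j \<in> {1..L} \<Longrightarrow> norm (c j) \<le> 1"
    and \<Delta>0: "Im (cnj (c p - c q) * (c p' - c q')) \<noteq> 0"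
  shows "\<exists>B D C (r0::nat). 1 < B \<and> 1 < D \<and> 0 \<le> C \<and>
    (\<forall>r\<ge>r0. \<forall>n. D ^ (r\<^sup>2) \<le> real n \<longrightarrow> Fav (cantor_stage L c n) \<le> ennreal (C / B ^ r))"
proof -
  have L: "2 \<le> L" using ifs[of 0] by (rule line_ifs.L)
  define d d' where "d = c p - c q" and "d' = c p' - c q'"
  define \<Delta> where "\<Delta> = \<bar>Im (cnj d * d')\<bar>"
  have \<Delta>: "0 < \<Delta>" using \<Delta>0 by (simp add: \<Delta>_def d_def d'_def)
  have d2: "norm d \<le> 2" "norm d' \<le> 2"
    using norm_triangle_ineq4[of "c p" "c q"] norm_triangle_ineq4[of "c p'" "c q'"] I[THEN cn]
    unfolding d_def d'_def by linarith+
  define g where "g = 1 - phi_gap L"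
  have g: "0 < g" "g < 1" using phi_gap_bounds[OF L] by (auto simp: g_def)
  \<comment> \<open>Makes \<open>1 + (2 * L + 1) * q0 = 33 / 32\<close>, whose 16th power is below
    \<open>2\<close>; so \<open>4 * m\<close> steps contribute at most \<open>2 ^ m\<close> to
    \<open>(card G) ^ 4\<close>.\<close>
  define q0 where "q0 = 1 / (32 * (2 * real L + 1))"
  have q0: "0 < q0" "q0 \<le> 1" by (auto simp: q0_def divide_le_eq)
  \<comment> \<open>For \<open>r \<ge> 1\<close>, \<open>4 * (2 * r + 1) \<le> 12 * r\<close>; with
    this \<open>h\<close> the weights of the stray digits contribute at most
    \<open>L ^ (h * r) = L ^ m\<close> to \<open>(card G) ^ 4\<close>.\<close>
  obtain h0 where h0: "(1 / q0) ^ 12 < real L ^ h0" using real_arch_pow[of "real L"] L by auto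
  define h where "h = Suc h0"
  have h: "(1 / q0) ^ 12 \<le> real L ^ h"
  proof -
    have "real L ^ h0 \<le> real L ^ h" unfolding h_def using L by (intro power_increasing) auto
    then show ?thesis using h0 by linarith
  qed
  have h1: "1 \<le> h" by (simp add: h_def)
  \<comment> \<open>\<open>b ^ h \<le> 1 / g\<close> lets \<open>K\<close> use up one factor
    \<open>g ^ r\<close> of \<open>\<kappa>^2\<close>; the other absorbs \<open>m\<close>.
    \<open>b \<le> 4/3\<close> gives
    \<open>1920 * K \<le> (3/2) ^ m * (4/3) ^ m = 2 ^ m\<close>.\<close>
  define b where "b = min (4/3) (root h (1 / g))"
  have b: "1 < b" "b \<le> 4/3" "b ^ h \<le> 1 / g"
  proof -
    have "1 < root h (1 / g)" using g h1 by (subst real_root_gt_1_iff) auto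
    then show "1 < b" by (simp add: b_def)
    show "b \<le> 4/3" by (simp add: b_def)
    have "b ^ h \<le> root h (1 / g) ^ h" using \<open>1 < b\<close> by (intro power_mono) (auto simp: b_def)
    also have "\<dots> = 1 / g" using g h1 by (intro real_root_pow_pos) auto
    finally show "b ^ h \<le> 1 / g" .
  qed
  have L1: "1 \<le> L" using L by simp
  obtain CS where CS: "0 < CS" and cover: "\<forall>(A::nat set) \<mu> \<beta> \<rho> (T::nat). finite A \<longrightarrow> card A = L \<longrightarrow>
     (\<forall>j\<in>A. \<bar>\<mu> j\<bar> \<le> 1) \<longrightarrow> expsum A \<beta> \<mu> 0 = 1 \<longrightarrow> 0 < \<rho> \<longrightarrow> \<rho> \<le> 1 \<longrightarrow> 1 \<le> T \<longrightarrow>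
     (\<exists>Z. finite Z \<and> card Z \<le> 4^L * T \<and>
       {t \<in> {0..real T}. norm (expsum A \<beta> \<mu> t) \<le> CS * \<rho> ^ (2*L) / real T ^ L} \<subseteq> (\<Union>z\<in>Z. {z - \<rho>..z + \<rho>}))"
    using expsum_sublevel_cover[where 'i = nat, OF L1] by (elim exE conjE) (rule that)
  \<comment> \<open>Serves \<open>1 / \<delta> \<le> E ^ m\<close>: the exponent
    \<open>11 * L\<close> consists of \<open>10 * L\<close> from the radius \<open>L^-5m\<close> and
    \<open>L\<close> from the length \<open>L^m\<close>.\<close>
  define E where "E = real L ^ (11 * L) * max 1 (1 / CS)"
  have E: "1 \<le> E" unfolding E_def using L by (intro mult_ge1_I one_le_power) auto
  \<comment> \<open>\<open>F ^ (m^2)\<close> bounds \<open>N * M\<close>: its factors come from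
    \<open>m\<close>, from \<open>J + 4\<close> with \<open>17292 = 2 * (8640 + 6)\<close>, and from
    \<open>M\<close>.\<close>
  define F where "F = 2 * (17292 * E\<^sup>2) * (52 * real L)"
  have F: "1 < F"
  proof -
    have "1 \<le> E\<^sup>2" using E by simp
    then have "1 * 1 < (2 * (17292 * E\<^sup>2)) * (52 * real L)" using L by (intro mult_less_le_imp_less) auto
    then show ?thesis by (simp add: F_def)
  qed
  have ev1: "eventually (\<lambda>r. 1920 * 4 ^ L * real h * (real r * g ^ r) \<le> 1) sequentially"
  proof -
    have "(\<lambda>r. real r * g ^ r) \<longlonglongrightarrow> 0" using g powser_times_n_limit_0[of g] by simp
    then have "(\<lambda>r. 1920 * 4 ^ L * real h * (real r * g ^ r)) \<longlonglongrightarrow> 1920 * 4 ^ L * real h * 0"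
      by (intro tendsto_intros)
    then have "eventually (\<lambda>r. 1920 * 4 ^ L * real h * (real r * g ^ r) < 1) sequentially"
      by (intro order_tendstoD) auto
    then show ?thesis by (rule eventually_mono) simp
  qed
  have pow_ev: "eventually (\<lambda>r. y \<le> z ^ r) sequentially" if z: "1 < z" for y z :: real
  proof -
    obtain n where n: "y < z ^ n" using real_arch_pow[OF z] by blast
    have "y \<le> z ^ r" if "n \<le> r" for r
      using n z that by (intro order_trans[OF less_imp_le[OF n] power_increasing]) auto
    then show ?thesis by (auto simp: eventually_sequentially)
  qed
  have "eventually (\<lambda>r. 1 \<le> r \<and> 1920 * 4 ^ L * real h * (real r * g ^ r) \<le> 1 \<and>
      1920 \<le> (3/2::real) ^ r \<and> 8 * pi / \<Delta> \<le> 2 ^ r) sequentially"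
    by (intro eventually_conj ev1 pow_ev eventually_ge_at_top) auto
  then obtain r0 where r0: "\<And>r. r0 \<le> r \<Longrightarrow> 1 \<le> r \<and> 1920 * 4 ^ L * real h * (real r * g ^ r) \<le> 1 \<and>
      1920 \<le> (3/2::real) ^ r \<and> 8 * pi / \<Delta> \<le> 2 ^ r"
    unfolding eventually_sequentially by blast
  define C where "C = 1296 * pi / \<Delta> + 18"
  have C: "0 \<le> C" using \<Delta> by (simp add: C_def)
  have main: "Fav (cantor_stage L c n) \<le> ennreal (C / (b ^ h) ^ r)"
    if r: "r0 \<le> r" and n: "(F ^ (h\<^sup>2)) ^ (r\<^sup>2) \<le> real n" for r n
  proof -
    define m where "m = h * r"
    have r1: "1 \<le> r" and e1: "1920 * 4 ^ L * real h * (real r * g ^ r) \<le> 1"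
      and e2: "1920 \<le> (3/2::real) ^ r" and e3: "8 * pi / \<Delta> \<le> 2 ^ r" using r0[OF r] by auto
    have m1: "1 \<le> m" "r \<le> m" using h1 r1 by (auto simp: m_def)
    define K where "K = b ^ m"
    have K: "1 < K" unfolding K_def using b m1 by (intro one_less_power) auto
    have Kr: "K = (b ^ h) ^ r" by (simp add: K_def m_def power_mult)
    have big: "1920 * K \<le> real L ^ m"
    proof -
      have "1920 * K \<le> (3/2) ^ m * (4/3) ^ m"
        unfolding K_def using b e2 m1
        by (intro mult_mono power_mono order_trans[OF e2 power_increasing]) auto
      also have "\<dots> = 2 ^ m" by (simp flip: power_mult_distrib)
      also have "\<dots> \<le> real L ^ m" using L by (intro power_mono) auto
      finally show ?thesis .
    qed
    have KL: "K \<le> real L ^ m" using big K by linarith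
    define \<kappa> where "\<kappa> = g ^ Suc r"
    have small: "1920 * K * real m * 4 ^ L * \<kappa>\<^sup>2 \<le> 1"
    proof -
      have "\<kappa>\<^sup>2 = g ^ (2 * Suc r)" unfolding \<kappa>_def by (simp only: power_mult[symmetric] mult.commute)
      also have "\<dots> \<le> g ^ (r + r)" using g by (intro power_decreasing) auto
      finally have k2: "\<kappa>\<^sup>2 \<le> g ^ r * g ^ r" by (simp add: power_add)
      have "K \<le> (1 / g) ^ r" unfolding Kr using b by (intro power_mono) auto
      then have Kg: "K * g ^ r \<le> 1" using g by (simp add: power_divide field_simps)
      have "1920 * K * real m * 4 ^ L * \<kappa>\<^sup>2 \<le> 1920 * K * real m * 4 ^ L * (g ^ r * g ^ r)"
        using k2 K by (intro mult_left_mono) auto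
      also have "\<dots> = (1920 * 4 ^ L * real h * (real r * g ^ r)) * (K * g ^ r)" by (simp add: m_def)
      also have "\<dots> \<le> 1 * 1" using e1 Kg K g by (intro mult_mono) auto
      finally show ?thesis by simp
    qed
    define \<delta> where "\<delta> = CS * (1 / real L ^ (5 * m)) ^ (2 * L) / real (L ^ m) ^ L"
    have \<delta>: "0 < \<delta>" using CS L by (simp add: \<delta>_def)
    have \<delta>E: "1 / \<delta> \<le> E ^ m"
    proof -
      have "1 / \<delta> = (1 / CS) * (real L ^ (5 * m * (2 * L)) * real L ^ (m * L))"
      proof -
        have "1 / (s * (1 / A) ^ k / D) = (1 / s) * (A ^ k * D)" for s A D :: real and k
          by (simp add: power_one_over)
        then show ?thesis by (simp only: \<delta>_def of_nat_power flip: power_mult)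
      qed
      also have "real L ^ (5 * m * (2 * L)) * real L ^ (m * L) = (real L ^ (11 * L)) ^ m"
        by (simp add: algebra_simps flip: power_add power_mult)
      also have "(1 / CS) * (real L ^ (11 * L)) ^ m \<le> max 1 (1 / CS) ^ m * (real L ^ (11 * L)) ^ m"
      proof (rule mult_right_mono)
        have "1 / CS \<le> max 1 (1 / CS)" by simp
        also have "\<dots> \<le> max 1 (1 / CS) ^ m" using m1 power_increasing[of 1 m "max 1 (1 / CS)"] by simp
        finally show "1 / CS \<le> max 1 (1 / CS) ^ m" .
      qed simp
      also have "\<dots> = E ^ m" by (simp add: E_def power_mult_distrib mult.commute)
      finally show ?thesis .
    qed
    define J where "J = nat \<lceil>8640 * K / \<delta> ^ (2 * m)\<rceil> + 1"
    have J: "8640 * K < real J * \<delta> ^ (2 * m)"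
    proof -
      have "8640 * K / \<delta> ^ (2 * m) < real J" unfolding J_def by linarith
      then show ?thesis using \<delta> by (simp add: divide_less_eq)
    qed
    define N where "N = m * (J + 4)"
    define M where "M = nat \<lceil>12 * real L * K\<^sup>2\<rceil>"
    have M: "12 * real L * K\<^sup>2 \<le> real M" by (simp add: M_def real_nat_ceiling_ge)
    have NM: "N * M \<le> n"
    proof -
      have K2: "K \<le> 2 ^ m" unfolding K_def using b by (intro power_mono) auto
      have "1 / \<delta> ^ (2 * m) = (1 / \<delta>) ^ (2 * m)" by (simp add: power_one_over)
      also have "\<dots> \<le> (E ^ m) ^ (2 * m)" using \<delta>E \<delta> by (intro power_mono) auto
      also have "\<dots> = (E\<^sup>2) ^ (m\<^sup>2)"
      proof -
        have "m * (2 * m) = 2 * m\<^sup>2" by (simp add: power2_eq_square)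
        then show ?thesis by (simp only: power_mult[symmetric])
      qed
      finally have dE: "1 / \<delta> ^ (2 * m) \<le> (E\<^sup>2) ^ (m\<^sup>2)" .
      have E2: "1 \<le> (E\<^sup>2) ^ (m\<^sup>2)" using E by (intro one_le_power) auto
      have two: "(1::real) \<le> 2 ^ (m\<^sup>2)" by (intro one_le_power) simp
      have "8640 * K * (1 / \<delta> ^ (2 * m)) \<le> 8640 * 2 ^ (m\<^sup>2) * (E\<^sup>2) ^ (m\<^sup>2)"
      proof (intro mult_mono dE)
        have "(2::real) ^ m \<le> 2 ^ (m\<^sup>2)" using m1 by (intro power_le_power_square) auto
        with K2 show "K \<le> 2 ^ (m\<^sup>2)" by linarith
      qed (use K \<delta> in auto)
      then have "8640 * K / \<delta> ^ (2 * m) \<le> 8640 * (2 ^ (m\<^sup>2) * (E\<^sup>2) ^ (m\<^sup>2))" by simp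
      moreover have "real J + 4 \<le> 8640 * K / \<delta> ^ (2 * m) + 6"
      proof -
        have "0 \<le> 8640 * K / \<delta> ^ (2 * m)" using K \<delta> by simp
        then show ?thesis unfolding J_def by linarith
      qed
      moreover have "1 \<le> 2 ^ (m\<^sup>2) * (E\<^sup>2) ^ (m\<^sup>2)" using mult_mono[OF two E2] by simp
      ultimately have "real J + 4 \<le> 8646 * (2 ^ (m\<^sup>2) * (E\<^sup>2) ^ (m\<^sup>2))" by linarith
      also have "\<dots> = 8646 * (2 * E\<^sup>2) ^ (m\<^sup>2)" by (simp add: power_mult_distrib)
      also have "\<dots> \<le> 8646 ^ (m\<^sup>2) * (2 * E\<^sup>2) ^ (m\<^sup>2)"
        using power_le_power_square[of 8646 1 m] m1 by (intro mult_right_mono) auto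
      also have "\<dots> = (8646 * (2 * E\<^sup>2)) ^ (m\<^sup>2)" by (rule power_mult_distrib[symmetric])
      also have "8646 * (2 * E\<^sup>2) = 17292 * E\<^sup>2" by simp
      finally have J4: "real J + 4 \<le> (17292 * E\<^sup>2) ^ (m\<^sup>2)" .
      have "real m \<le> 2 ^ m" by simp
      also have "\<dots> \<le> 2 ^ (m\<^sup>2)" using m1 by (intro power_le_power_square) auto
      finally have "real N \<le> 2 ^ (m\<^sup>2) * (17292 * E\<^sup>2) ^ (m\<^sup>2)"
        unfolding N_def of_nat_mult of_nat_add using J4 by (intro mult_mono) auto
      moreover have "real M \<le> (52 * real L) ^ (m\<^sup>2)"
      proof -
        have "K\<^sup>2 \<le> (2 ^ m)\<^sup>2" using K2 K by (intro power_mono) auto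
        also have "(2 ^ m)\<^sup>2 = (2\<^sup>2 :: real) ^ m" by (simp only: power_mult[symmetric] mult.commute)
        also have "(2\<^sup>2 :: real) = 4" by simp
        also have "(4::real) ^ m \<le> 4 ^ (m\<^sup>2)" using m1 by (intro power_le_power_square) auto
        finally have K4: "K\<^sup>2 \<le> 4 ^ (m\<^sup>2)" .
        have "1 \<le> real L * K\<^sup>2" using mult_mono[of 1 "real L" 1 "K\<^sup>2"] L K by (simp add: one_le_power)
        then have "real M \<le> 13 * (real L * K\<^sup>2)" unfolding M_def by linarith
        also have "\<dots> \<le> 13 * (real L * 4 ^ (m\<^sup>2))" using K4 by (intro mult_left_mono) auto
        also have "\<dots> = (13 * real L) ^ 1 * 4 ^ (m\<^sup>2)" by simp
        also have "\<dots> \<le> (13 * real L) ^ (m\<^sup>2) * 4 ^ (m\<^sup>2)"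
          using L m1 by (intro mult_right_mono power_le_power_square) auto
        also have "\<dots> = (13 * real L * 4) ^ (m\<^sup>2)" by (rule power_mult_distrib[symmetric])
        also have "13 * real L * 4 = 52 * real L" by simp
        finally show ?thesis .
      qed
      ultimately have "real (N * M) \<le> 2 ^ (m\<^sup>2) * (17292 * E\<^sup>2) ^ (m\<^sup>2) * (52 * real L) ^ (m\<^sup>2)"
        unfolding of_nat_mult by (intro mult_mono) auto
      also have "\<dots> = F ^ (m\<^sup>2)" by (simp only: F_def power_mult_distrib)
      also have "\<dots> = (F ^ (h\<^sup>2)) ^ (r\<^sup>2)" by (simp only: m_def power_mult_distrib power_mult)
      finally show ?thesis using n by linarith
    qed
    define G where "G = reach L (L ^ m) (4 * m) (2 * r + 1)"
    define Q where "Q = real L ^ (4 * m) * \<Delta> / (2 * pi) - 2"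
    define X where "X = bad_angles d d' G Q"
    have finG: "finite G" by (simp add: G_def)
    have Q_ge: "real L ^ (4 * m) * \<Delta> / (4 * pi) \<le> Q"
    proof -
      have "8 * pi / \<Delta> \<le> 2 ^ (4 * m)"
        using m1 by (intro order_trans[OF e3] power_increasing) auto
      also have "\<dots> \<le> real L ^ (4 * m)" using L by (intro power_mono) auto
      finally have "8 * pi \<le> real L ^ (4 * m) * \<Delta>" using \<Delta> by (simp add: divide_le_eq)
      then have "2 \<le> real L ^ (4 * m) * \<Delta> / (4 * pi)" by (simp add: le_divide_eq)
      moreover have "real L ^ (4 * m) * \<Delta> / (2 * pi) = 2 * (real L ^ (4 * m) * \<Delta> / (4 * pi))" by simp
      ultimately show ?thesis unfolding Q_def by linarith
    qed
    have Qpos: "0 < real L ^ (4 * m) * \<Delta> / (4 * pi)" using L \<Delta> by simp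
    have cardG: "(real (card G))\<^sup>2 \<le> 9 * real L ^ (3 * m)"
    proof -
      define s where "s = (33/32::real) ^ (4 * m) * (1 / q0) ^ (2 * r + 1)"
      have s0: "0 \<le> s" using q0 by (simp add: s_def)
      have Lm: "1 \<le> real L ^ m" using L by (intro one_le_power) auto
      have "real (card G) * q0 ^ (2 * r + 1) \<le> (2 * real (L ^ m) + 1) * (1 + (2 * real L + 1) * q0) ^ (4 * m)"
        unfolding G_def by (rule card_reach_le[OF q0])
      also have "1 + (2 * real L + 1) * q0 = 33/32" by (simp add: q0_def field_simps)
      finally have "real (card G) * q0 ^ (2 * r + 1) \<le> (2 * real (L ^ m) + 1) * (33/32) ^ (4 * m)" .
      then have "real (card G) \<le> (2 * real (L ^ m) + 1) * (33/32) ^ (4 * m) / q0 ^ (2 * r + 1)"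
        using q0 by (subst pos_le_divide_eq) auto
      also have "\<dots> = (2 * real L ^ m + 1) * s" by (simp add: s_def power_one_over)
      also have "\<dots> \<le> (3 * real L ^ m) * s" using Lm s0 by (intro mult_right_mono) auto
      finally have "(real (card G))\<^sup>2 \<le> (3 * real L ^ m * s)\<^sup>2" by (intro power_mono) auto
      also have "\<dots> = 9 * (real L ^ m)\<^sup>2 * s\<^sup>2" by (simp add: power_mult_distrib)
      finally have "(real (card G))\<^sup>2 \<le> 9 * (real L ^ m)\<^sup>2 * s\<^sup>2" .
      also have "9 * (real L ^ m)\<^sup>2 * s\<^sup>2 \<le> 9 * (real L ^ m)\<^sup>2 * real L ^ m"
      proof (rule mult_left_mono, rule power2_le_imp_le)
        have "(s\<^sup>2)\<^sup>2 = ((33/32) ^ 16) ^ m * (1 / q0) ^ (4 * (2 * r + 1))"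
        proof -
          have e: "4 * m * 2 * 2 = 16 * m" "(2 * r + 1) * 2 * 2 = 4 * (2 * r + 1)" by simp_all
          show ?thesis unfolding s_def power_mult_distrib power_mult[symmetric] e ..
        qed
        also have "\<dots> \<le> real L ^ m * real L ^ m"
        proof (intro mult_mono)
          have "(33/32::real) ^ 16 \<le> 2" by (simp add: power_divide)
          then show "((33/32) ^ 16) ^ m \<le> real L ^ m" using L by (intro power_mono) auto
          have "(1 / q0) ^ (4 * (2 * r + 1)) \<le> (1 / q0) ^ (12 * r)"
            using q0 r1 by (intro power_increasing) auto
          also have "\<dots> = ((1 / q0) ^ 12) ^ r" by (simp add: power_mult)
          also have "\<dots> \<le> (real L ^ h) ^ r" using h q0 by (intro power_mono) auto
          also have "\<dots> = real L ^ m" by (simp add: m_def power_mult)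
          finally show "(1 / q0) ^ (4 * (2 * r + 1)) \<le> real L ^ m" .
        qed (use q0 in auto)
        finally show "(s\<^sup>2)\<^sup>2 \<le> (real L ^ m)\<^sup>2" by (simp add: power2_eq_square)
      qed simp_all
      also have "\<dots> = 9 * real L ^ (3 * m)"
        by (simp add: power3_eq_cube power2_eq_square mult.commute power_mult flip: power_mult_distrib)
      finally show ?thesis .
    qed
    have X_meas: "X \<in> lmeasurable" unfolding X_def by (rule bad_angles_lmeasurable[OF finG])
    \<comment> \<open>At most \<open>9 * L ^ (3 * m)\<close> pairs of integers, each excluding
      angles of measure \<open>O(L^-4m)\<close>, leave \<open>O(L^-m)\<close>.\<close>
    have X_le: "measure lebesgue X \<le> 1296 * pi / \<Delta> / K"
    proof -
      have "measure lebesgue X \<le> (real (card G))\<^sup>2 * (36 / Q)"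
        unfolding X_def using Q_ge Qpos by (intro measure_bad_angles_le finG) linarith
      also have "\<dots> \<le> 9 * real L ^ (3 * m) * (36 / (real L ^ (4 * m) * \<Delta> / (4 * pi)))"
        using cardG Q_ge Qpos by (intro mult_mono divide_left_mono mult_pos_pos) auto
      also have "\<dots> = 1296 * pi / \<Delta> / real L ^ m"
      proof -
        have "real L ^ (4 * m) = real L ^ (3 * m) * real L ^ m" by (simp flip: power_add)
        then show ?thesis using L \<Delta> by (simp add: field_simps)
      qed
      also have "\<dots> \<le> 1296 * pi / \<Delta> / K" using KL K \<Delta> by (intro frac_le) auto
      finally show ?thesis .
    qed
    have good: "measure lebesgue (line_ifs.shadow L (\<lambda>j. c j \<bullet> cis \<theta>) n) \<le> 18 / K" if \<theta>: "\<theta> \<in> {0..pi} - X" for \<theta>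
    proof -
      interpret line_ifs L "\<lambda>j. c j \<bullet> cis \<theta>" by (rule ifs)
      have \<kappa>: "norm (Phi (4 * m) y) \<le> \<kappa>" if y: "y \<in> {1..real L ^ m}" for y
      proof (rule ccontr)
        assume "\<not> norm (Phi (4 * m) y) \<le> \<kappa>"
        then have "(1 - phi_gap L) ^ Suc r < norm (Phi (4 * m) y)" by (simp add: \<kappa>_def g_def)
        then have "\<theta> \<in> X"
          unfolding X_def G_def Q_def \<Delta>_def
          using bad_angle_of_Phi_large[OF line_ifs_axioms I d_def d'_def d2 _ _ y] \<Delta> \<theta> by (auto simp: \<Delta>_def)
        then show False using \<theta> by simp
      qed
      have "expsum {1..L} (\<lambda>_. 1 / of_nat L) (\<lambda>j. c j \<bullet> cis \<theta>) 0 = 1" using phi_0 by (simp add: phi_def)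
      moreover have "1 \<le> L ^ m" using L by simp
      moreover have "1 / real L ^ (5 * m) \<le> 1" using L by simp
      moreover have "0 < 1 / real L ^ (5 * m)" by simp
      ultimately obtain Z where Z: "finite Z" "card Z \<le> 4 ^ L * L ^ m"
        "{t \<in> {0..real (L ^ m)}. norm (phi t) \<le> \<delta>} \<subseteq> (\<Union>z\<in>Z. {z - 1 / real L ^ (5 * m)..z + 1 / real L ^ (5 * m)})"
        using cover[rule_format, of "{1..L}" "\<lambda>j. c j \<bullet> cis \<theta>" "\<lambda>_. 1 / of_nat L" "1 / real L ^ (5 * m)" "L ^ m"]
          abs_a_le_1 unfolding phi_def \<delta>_def by auto
      have "real (card Z) \<le> real (4 ^ L * L ^ m)" using Z(2) by (rule of_nat_mono)
      then have cardZ: "real (card Z) \<le> 4 ^ L * real L ^ m" by simp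
      have "shadow_length (N * M) \<le> 18 / K"
        by (rule shadow_length_le_of_small_Phi[OF K m1(1) N_def M \<kappa> \<delta> Z(1) cardZ _ big _ J])
          (use Z(3) small in auto)
      then show ?thesis using shadow_length_antimono[OF NM] by linarith
    qed
    have "Fav (cantor_stage L c n) \<le> ennreal (1296 * pi / \<Delta> / K + 18 / K)"
      using K by (intro Fav_le[OF ifs X_meas X_le _ good]) auto
    also have "1296 * pi / \<Delta> / K + 18 / K = C / (b ^ h) ^ r"
      by (simp add: C_def Kr add_divide_distrib)
    finally show ?thesis .
  qed
  have "1 < b ^ h" using b h1 by (intro one_less_power) auto
  moreover have "1 < F ^ (h\<^sup>2)" using F h1 by (intro one_less_power) auto
  ultimately show ?thesis
    using C main by (intro exI[of _ "b ^ h"] exI[of _ "F ^ (h\<^sup>2)"] exI[of _ C] exI[of _ r0]) auto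
qed

theorem theorem1:
  fixes L :: nat and c :: "nat \<Rightarrow> complex"
  assumes discs: "\<And>j. j \<in> {1..L} \<Longrightarrow> cball (c j) (1 / real L) \<subseteq> cball 0 1"
    and noncollinear: "\<not> collinear (c ` {1..L})"
  shows "\<exists>C \<epsilon>0 :: real. \<epsilon>0 > 0 \<and>
    (\<forall>n::nat. n \<ge> 1 \<longrightarrow>
      Fav (cantor_stage L c n) \<le> ennreal (C * exp (- \<epsilon>0 * sqrt (ln (real n)))))"
proof -
  have L1: "1 \<le> L"
  proof (rule ccontr)
    assume "\<not> 1 \<le> L"
    then have "c ` {1..L} = {}" by simp
    then show False using noncollinear by (metis collinear_empty)
  qed
  then obtain p' q' where I: "p' \<in> {1..L}" "q' \<in> {1..L}"
    and \<Delta>: "Im (cnj (c p' - c 1) * (c q' - c 1)) \<noteq> 0"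
    using not_collinear_imp_basis[OF noncollinear, of "c 1"] by auto
  have "p' \<noteq> 1" using \<Delta> by auto
  then have L: "2 \<le> L" using I by auto
  have cn: "norm (c j) \<le> 1 - 1 / real L" if j: "j \<in> {1..L}" for j
    using discs[OF j] L1 by (simp add: cball_subset_cball_iff)
  have cn1: "norm (c j) \<le> 1" if "j \<in> {1..L}" for j
  proof -
    have "0 \<le> 1 / real L" by simp
    then show ?thesis using cn[OF that] by linarith
  qed
  have ifs: "line_ifs L (\<lambda>j. c j \<bullet> cis \<theta>)" for \<theta>
  proof
    fix j assume "j \<in> {1..L}"
    then show "\<bar>c j \<bullet> cis \<theta>\<bar> \<le> 1 - 1 / real L"
      using Cauchy_Schwarz_ineq2[of "c j" "cis \<theta>"] cn by fastforce
  qed (rule L)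
  have one: "1 \<in> {1..L}" using L1 by simp
  obtain B D C and r0 :: nat where B: "1 < B" and D: "1 < D" and C: "0 \<le> C"
    and key: "\<forall>r\<ge>r0. \<forall>n. D ^ (r\<^sup>2) \<le> real n \<longrightarrow> Fav (cantor_stage L c n) \<le> ennreal (C / B ^ r)"
    using Fav_cantor_stage_le[where c = c, OF ifs I(1) one I(2) one _ \<Delta>, OF cn1, simplified]
    by auto
  \<comment> \<open>Chosen so that \<open>exp (- \<epsilon>0 * sqrt (ln n))\<close> equals
    \<open>1 / B powr t\<close> for the \<open>t\<close> below.\<close>
  define \<epsilon>0 where "\<epsilon>0 = ln B / sqrt (ln D)"
  have lnD: "0 < ln D" and lnB: "0 < ln B" using B D by simp_all
  have \<epsilon>0: "0 < \<epsilon>0" using lnB lnD by (simp add: \<epsilon>0_def)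
  \<comment> \<open>\<open>C * B\<close> pays for rounding \<open>t\<close> down to
    \<open>r\<close>; \<open>2 * B ^ r0\<close> covers the case \<open>r < r0\<close>, where the
    trivial bound \<open>2\<close> is used.\<close>
  define C' where "C' = max (C * B) (2 * B ^ r0)"
  have C': "C * B \<le> C'" "2 * B ^ r0 \<le> C'" by (auto simp: C'_def)
  have "Fav (cantor_stage L c n) \<le> ennreal (C' * exp (- \<epsilon>0 * sqrt (ln (real n))))" if n: "1 \<le> n" for n
  proof -
    \<comment> \<open>The real solution of \<open>D powr (t^2) = n\<close>.\<close>
    define t where "t = sqrt (ln (real n) / ln D)"
    have t0: "0 \<le> t" using n lnD by (simp add: t_def)
    have e: "exp (- \<epsilon>0 * sqrt (ln (real n))) = 1 / B powr t"
      using B by (simp add: \<epsilon>0_def t_def real_sqrt_divide powr_def exp_minus field_simps)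
    define r where "r = nat \<lfloor>t\<rfloor>"
    have r: "real r \<le> t" "t \<le> real r + 1" using t0 unfolding r_def by linarith+
    show ?thesis
    proof (cases "r0 \<le> r")
      case True
      have "real (r\<^sup>2) \<le> t\<^sup>2" using r(1) by (simp add: power_mono)
      also have "\<dots> = ln (real n) / ln D" using n lnD by (simp add: t_def)
      finally have "real (r\<^sup>2) * ln D \<le> ln (real n)" using lnD by (simp add: le_divide_eq)
      then have "ln (D ^ (r\<^sup>2)) \<le> ln (real n)" using D by (simp add: ln_realpow)
      then have "D ^ (r\<^sup>2) \<le> real n" using D n by (subst (asm) ln_le_cancel_iff) auto
      then have "Fav (cantor_stage L c n) \<le> ennreal (C / B ^ r)" using key True by blast
      also have "C / B ^ r \<le> C' * exp (- \<epsilon>0 * sqrt (ln (real n)))"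
      proof -
        have "B powr t \<le> B powr (real r + 1)" using r B by (intro powr_mono) auto
        also have "\<dots> = B ^ r * B" using B by (simp add: powr_add powr_realpow)
        finally have "C * B powr t \<le> C * (B ^ r * B)" using C by (rule mult_left_mono)
        also have "\<dots> = (C * B) * B ^ r" by simp
        also have "\<dots> \<le> C' * B ^ r" using C' B by (intro mult_right_mono) auto
        finally have "C / B ^ r \<le> C' / B powr t" using B by (simp add: field_simps)
        then show ?thesis unfolding e by simp
      qed
      finally show ?thesis by (simp add: ennreal_leI)
    next
      case False
      have "Fav (cantor_stage L c n) \<le> ennreal (0 + 2)"
        using line_ifs.shadow_length_le_2[OF ifs] by (intro Fav_le[OF ifs, of "{}"]) auto
      also have "0 + 2 \<le> C' * exp (- \<epsilon>0 * sqrt (ln (real n)))"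
      proof -
        have "t \<le> real r0" using r(2) False by linarith
        then have "B powr t \<le> B powr real r0" using B by (intro powr_mono) auto
        also have "\<dots> = B ^ r0" using B by (simp add: powr_realpow)
        finally have "2 * B powr t \<le> C'" using C'(2) by linarith
        then have "2 \<le> C' / B powr t" using B by (simp add: le_divide_eq)
        then show ?thesis unfolding e by simp
      qed
      finally show ?thesis by (simp add: ennreal_leI)
    qed
  qed
  with \<epsilon>0 show ?thesis by blast
qed

end
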